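(* Let $G=(V,E)$ be an $(m,d,\gamma)$-spectral expander such that for any two distinct $u,v\in V$ it holds that $|\Gamma(u)\cap\Gamma(v)|\le 1$, and let $c:V\to\{0,1\}$ be a balanced coloring of $G$. Assume also that $m\ge 1/\gamma^2$. Then for any $b\in\{0,1\}$ there is a $\left(\frac{1}{10},\ \lfloor 2\log_2(1/\gamma)\rfloor-100\right)$-hitting distribution $\mu_b$ over $b$-monochromatic rectangles of $g(G,c)$. All the probabilities of $\mu_b$ are rational. Moreover, there is a deterministic Turing machine which, having $G$ and $c$ on input, in time $m^{O(1)}$ lists all the rectangles from the support of $\mu_b$, together with the probabilities $\mu_b$ assigns to them.
   Context: Graphs are undirected and may have parallel edges and self-loops; a self-loop at $v$ contributes 1 to the degree of $v$. A graph is $d$-regular if every vertex has degree $d$. For $A\subseteq V$, $\Gamma(A)$ is the set of all $v\in V$ such that some $u\in A$ is joined to $v$ by an edge; $\Gamma(v)=\Gamma(\{v\})$. A $d$-regular graph $G$ on $m$ vertices with adjacency matrix $M_G$ is an $(m,d,\gamma)$-spectral expander if the eigenvalue $d$ of $M_G$ has multiplicity $1$ and every other eigenvalue of $M_G$ has absolute value at most $\gamma d$. A coloring $c:V\to\{0,1\}$ is balanced if $|V|/3\le |c^{-1}(1)|\le 2|V|/3$. When any two distinct vertices have at most one common neighbor, $g(G,c):V\times V\to\{0,1\}$ is the partial function with $g(G,c)(u,v)=1$ if $u\ne v$ and there is $w\in\Gamma(u)\cap\Gamma(v)$ with $c(w)=1$; $g(G,c)(u,v)=0$ if $u\ne v$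 and there is $w\in\Gamma(u)\cap\Gamma(v)$ with $c(w)=0$; undefined otherwise. For a (possibly partial) $g:A\times B\to\{0,1\}$, a rectangle is a set $U\times V$ with $U\subseteq A$, $V\subseteq B$; it is $b$-monochromatic if $g$ is defined and equal to $b$ at every point of it. A probability distribution $\mu$ over rectangles is $(\delta,h)$-hitting ($\delta>0$, $h$ an integer) if for all $X\subseteq A$, $Y\subseteq B$ with $|X|\ge 2^{-h}|A|$ and $|Y|\ge 2^{-h}|B|$ we have $\Pr_{R\sim\mu}[R\cap (X\times Y)\ne\varnothing]\ge 1-\delta$. *)

theory Defs
  imports
    "HOL-Probability.Probability_Mass_Function"
    "HOL-Library.Uprod"
    "Jordan_Normal_Form.Char_Poly"
begin

section \<open>Graphs with parallel edges and self-loops\<close>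

record 'a multigraph =
  verts :: "'a set"
  edges :: "'a uprod multiset"

definition multigraph :: "'a multigraph \<Rightarrow> bool" where
  "multigraph G \<longleftrightarrow> finite (verts G) \<and> (\<forall>e \<in># edges G. set_uprod e \<subseteq> verts G)"

text \<open>A self-loop at \<open>v\<close> is the edge \<open>Upair v v\<close>; it contributes 1 to the degree of \<open>v\<close>.\<close>

definition degree_of :: "'a multigraph \<Rightarrow> 'a \<Rightarrow> nat" where
  "degree_of G v = size {#e \<in># edges G. v \<in> set_uprod e#}"

definition regular :: "nat \<Rightarrow> 'a multigraph \<Rightarrow> bool" where
  "regular d G \<longleftrightarrow> (\<forall>v \<in> verts G. degree_of G v = d)"

definition nbrs :: "'a multigraph \<Rightarrow> 'a set \<Rightarrow> 'a set" where
  "nbrs G A = {v \<in> verts G. \<exists>u \<in> A. Upair u v \<in># edges G}"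

definition adj_matrix :: "nat \<Rightarrow> nat multigraph \<Rightarrow> real mat" where
  "adj_matrix m G = Matrix.mat m m (\<lambda>(u, v). real (count (edges G) (Upair u v)))"

text \<open>The vertices of a graph on \<open>m\<close> vertices are numbered \<open>0, \<dots>, m - 1\<close>. The adjacency matrix
  is real symmetric, so all its eigenvalues are real.\<close>

definition spectral_expander :: "nat \<Rightarrow> nat \<Rightarrow> real \<Rightarrow> nat multigraph \<Rightarrow> bool" where
  "spectral_expander m d \<gamma> G \<longleftrightarrow>
     multigraph G \<and> verts G = {..<m} \<and> regular d G \<and>
     order (real d) (char_poly (adj_matrix m G)) = 1 \<and>
     (\<forall>x. eigenvalue (adj_matrix m G) x \<and> x \<noteq> real d \<longrightarrow> \<bar>x\<bar> \<le> \<gamma> * real d)"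

section \<open>Colorings, rectangles and hitting distributions\<close>

text \<open>The bits 1 and 0 are represented by \<open>True\<close> and \<open>False\<close>.\<close>

definition balanced_coloring :: "'a multigraph \<Rightarrow> ('a \<Rightarrow> bool) \<Rightarrow> bool" where
  "balanced_coloring G c \<longleftrightarrow>
     real (card (verts G)) / 3 \<le> real (card {v \<in> verts G. c v}) \<and>
     real (card {v \<in> verts G. c v}) \<le> 2 * real (card (verts G)) / 3"

text \<open>Meaningful when distinct vertices have at most one common neighbour, in which case the
  first two branches exclude each other.\<close>

definition gadget :: "'a multigraph \<Rightarrow> ('a \<Rightarrow> bool) \<Rightarrow> 'a \<times> 'a \<rightharpoonup> bool" where
  "gadget G c = (\<lambda>(u, v).
     if u \<noteq> v \<and> (\<exists>w \<in> nbrs G {u} \<inter> nbrs G {v}. c w) then Some True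
     else if u \<noteq> v \<and> (\<exists>w \<in> nbrs G {u} \<inter> nbrs G {v}. \<not> c w) then Some False
     else None)"

definition rectangle :: "'a set \<Rightarrow> 'b set \<Rightarrow> ('a \<times> 'b) set \<Rightarrow> bool" where
  "rectangle A B R \<longleftrightarrow> (\<exists>U V. U \<subseteq> A \<and> V \<subseteq> B \<and> R = U \<times> V)"

definition monochromatic :: "('a \<times> 'b \<rightharpoonup> bool) \<Rightarrow> bool \<Rightarrow> ('a \<times> 'b) set \<Rightarrow> bool" where
  "monochromatic g b R \<longleftrightarrow> (\<forall>x \<in> R. g x = Some b)"

definition hitting ::
  "real \<Rightarrow> int \<Rightarrow> 'a set \<Rightarrow> 'b set \<Rightarrow> ('a \<times> 'b) set pmf \<Rightarrow> bool" where
  "hitting \<delta> h A B \<mu> \<longleftrightarrow>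
     \<delta> > 0 \<and>
     (\<forall>X Y. X \<subseteq> A \<and> Y \<subseteq> B \<and>
        real (card X) \<ge> 2 powr (- real_of_int h) * real (card A) \<and>
        real (card Y) \<ge> 2 powr (- real_of_int h) * real (card B) \<longrightarrow>
        measure_pmf.prob \<mu> {R. R \<inter> (X \<times> Y) \<noteq> {}} \<ge> 1 - \<delta>)"

section \<open>Deterministic multi-tape Turing machines\<close>

text \<open>Symbol 0 is the blank and symbol 1 marks the left end of each (one-way infinite) tape;
  2 and 3 are the bits 0 and 1, and 4 is a separator. A machine is the finite list of its
  non-halting states, each given by its transition function, which maps the symbols read on all
  tapes to the next state and, for each tape, the symbol to write and the head movement.
  The state \<open>length M\<close> is the halting state, and 0 is the initial state.\<close>

datatype move = Go_Left | Stay | Go_Right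

type_synonym symbol = nat
type_synonym tape = "(nat \<Rightarrow> symbol) \<times> nat"
type_synonym config = "nat \<times> tape list"
type_synonym machine = "(symbol list \<Rightarrow> nat \<times> (symbol \<times> move) list) list"

text \<open>\<open>k\<close> tapes and tape alphabet \<open>{..<a}\<close>.\<close>

definition turing_machine :: "nat \<Rightarrow> nat \<Rightarrow> machine \<Rightarrow> bool" where
  "turing_machine k a M \<longleftrightarrow>
     k \<ge> 1 \<and> a \<ge> 5 \<and>
     (\<forall>\<delta> \<in> set M. \<forall>rs. length rs = k \<and> set rs \<subseteq> {..<a} \<longrightarrow>
        fst (\<delta> rs) \<le> length M \<and>
        length (snd (\<delta> rs)) = k \<and>
        (\<forall>(s, _) \<in> set (snd (\<delta> rs)). s < a))"

text \<open>A head on cell 0 that is told to go left stays there.\<close>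

definition act :: "symbol \<times> move \<Rightarrow> tape \<Rightarrow> tape" where
  "act = (\<lambda>(s, mv) (cells, pos).
     (cells(pos := s),
      case mv of Go_Left \<Rightarrow> pos - 1 | Stay \<Rightarrow> pos | Go_Right \<Rightarrow> pos + 1))"

definition step :: "machine \<Rightarrow> config \<Rightarrow> config" where
  "step M = (\<lambda>(q, tps).
     if q < length M
     then let (q', acts) = (M ! q) (map (\<lambda>(cells, pos). cells pos) tps)
          in (q', map2 act acts tps)
     else (q, tps))"

definition tape_of :: "symbol list \<Rightarrow> nat \<Rightarrow> symbol" where
  "tape_of xs i = (if i = 0 then 1 else if i \<le> length xs then xs ! (i - 1) else 0)"

definition init_config :: "nat \<Rightarrow> symbol list \<Rightarrow> config" where
  "init_config k xs = (0, (tape_of xs, 0) # replicate (k - 1) (tape_of [], 0))"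

text \<open>The output is what follows cell 0 on the last tape, up to trailing blanks.\<close>

definition computes_in ::
  "nat \<Rightarrow> machine \<Rightarrow> symbol list \<Rightarrow> nat \<Rightarrow> symbol list \<Rightarrow> bool" where
  "computes_in k M xs T ys \<longleftrightarrow>
     (\<exists>t \<le> T. \<exists>tps. (step M ^^ t) (init_config k xs) = (length M, tps) \<and>
        (\<forall>i \<ge> 1. fst (last tps) i = tape_of ys i))"

section \<open>Encodings of inputs and outputs\<close>

definition bit_sym :: "bool \<Rightarrow> symbol" where
  "bit_sym x = (if x then 3 else 2)"

abbreviation sep :: symbol where
  "sep \<equiv> 4"

fun binary :: "nat \<Rightarrow> symbol list" where
  "binary n = (if n < 2 then [bit_sym (n = 1)] else binary (n div 2) @ [bit_sym (odd n)])"

declare binary.simps [simp del]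

definition bit_vector :: "nat \<Rightarrow> (nat \<Rightarrow> bool) \<Rightarrow> symbol list" where
  "bit_vector m P = map (\<lambda>v. bit_sym (P v)) [0..<m]"

text \<open>First the table telling which vertices are joined, row by row, then the coloring, and then
  the multiplicities of all pairs in binary. The multiplicities come last because they are not
  bounded in terms of \<open>m\<close>: placed earlier, they could keep a machine running for \<open>m\<close>-polynomial
  time from ever reaching the rest of its input.\<close>

definition encode_input :: "nat \<Rightarrow> nat multigraph \<Rightarrow> (nat \<Rightarrow> bool) \<Rightarrow> symbol list" where
  "encode_input m G c =
     concat (map (\<lambda>u. bit_vector m (\<lambda>v. Upair u v \<in># edges G) @ [sep]) [0..<m]) @
     bit_vector m c @ [sep] @
     concat (map (\<lambda>(u, v). binary (count (edges G) (Upair u v)) @ [sep])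
       (List.product [0..<m] [0..<m]))"

text \<open>An entry \<open>(U, V, p, q)\<close> stands for the rectangle \<open>U \<times> V\<close> with probability \<open>p / q\<close>.\<close>

definition encode_listing :: "nat \<Rightarrow> (nat set \<times> nat set \<times> nat \<times> nat) list \<Rightarrow> symbol list" where
  "encode_listing m xs =
     concat (map (\<lambda>(U, V, p, q).
       bit_vector m (\<lambda>v. v \<in> U) @ [sep] @ bit_vector m (\<lambda>v. v \<in> V) @ [sep] @
       binary p @ [sep] @ binary q @ [sep]) xs)"

definition lists_distribution :: "nat \<Rightarrow> (nat \<times> nat) set pmf \<Rightarrow> symbol list \<Rightarrow> bool" where
  "lists_distribution m \<mu> ys \<longleftrightarrow>
     (\<exists>xs. ys = encode_listing m xs \<and>
        distinct (map (\<lambda>(U, V, p, q). U \<times> V) xs) \<and>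
        set (map (\<lambda>(U, V, p, q). U \<times> V) xs) = set_pmf \<mu> \<and>
        (\<forall>(U, V, p, q) \<in> set xs. U \<subseteq> {..<m} \<and> V \<subseteq> {..<m} \<and> q > 0 \<and>
           pmf \<mu> (U \<times> V) = real p / real q))"

end

theory Submission
  imports Defs
begin

text \<open>
  Write \<open>\<Gamma>(v)\<close> for the neighbours of \<open>v\<close> and let \<open>v\<close> have colour \<open>b\<close>. Splitting \<open>\<Gamma>(v)\<close> into two parts
  \<open>U\<close> and \<open>V\<close> makes \<open>U \<times> V\<close> a \<open>b\<close>-monochromatic rectangle, because \<open>v\<close> is the only common neighbour
  of two distinct elements of \<open>\<Gamma>(v)\<close>. Number the elements of \<open>\<Gamma>(v)\<close> by \<open>1, \<dots>, n\<close> and, for a mask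
  \<open>a\<close> with as many binary digits as \<open>n\<close>, let \<open>U\<close> consist of the elements whose number has odd inner
  product with \<open>a\<close>. Over a uniform mask the signs of any two elements have nonpositive correlation, so
  a set of \<open>64\<close> elements lies on one prescribed side with probability at most \<open>1/64\<close>. The expander
  hypothesis bounds the number of vertices with no neighbour in \<open>X\<close> by \<open>\<gamma>\<^sup>2 m\<^sup>2 / |X|\<close>; applied to \<open>64\<close>
  disjoint pieces of \<open>X\<close> it shows that almost every \<open>v\<close> has at least \<open>64\<close> neighbours in \<open>X\<close>. So a
  uniform \<open>v\<close> with a uniform mask hits \<open>X \<times> Y\<close> with probability above \<open>9/10\<close>.

  For \<open>n \<ge> 4\<close> all the rectangles obtained in this way are nonempty and pairwise different. Vertices with
  fewer neighbours are left out, and the empty rectangle is added with the weight of one vertex, so that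
  the distribution exists even if no vertex remains. The weights are \<open>1 / (q 2\<^sup>k)\<close>, whose denominators
  are written in binary by appending \<open>k\<close> zeros to the digits of \<open>q\<close>.
\<close>

section \<open>Structured programs for six-tape machines\<close>

text \<open>A uniformly random splitting of a neighbourhood would also hit, but its support is
  exponential in the number of neighbours, and the support has to be listed in polynomial time. The
  bound on one-sided sets needs second moments only, hence only pairwise correlations, and for these
  \<open>2 ^ k\<close> masks suffice, no more than there are neighbours. Fixing the leading digit of
  the mask keeps the odd side nonempty and the number of masks a power of two; it can only push
  correlations from zero to negative values, which is the harmless direction. Nonempty and distinct
  rectangles matter because each member of the support must be listed once, with its full
  probability. The number 64 makes the two one-sided failures cost at most 1/64 each, leaving 31/32,
  and the gap to 9/10 absorbs the exceptional vertices. The 100 in the threshold means that X has at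
  least \<open>2 ^ 100 * \<gamma>\<^sup>2 * m\<close> elements; a 64th part of X, rounded down,
  keeps at least 1/128 of them and is therefore avoided by at most \<open>128 / 2 ^ 100 * m\<close>
  vertices. The distribution is built from G and c alone, which is all that the machine is
  given.\<close>

datatype cmd =
    Skip
  | Op nat "(nat \<Rightarrow> symbol) \<Rightarrow> symbol \<times> move"
  | Seq cmd cmd (infixr ";;" 60)
  | Cond "(nat \<Rightarrow> symbol) \<Rightarrow> bool" cmd cmd
  | While "(nat \<Rightarrow> symbol) \<Rightarrow> bool" cmd

type_synonym state = "nat \<Rightarrow> tape"

text \<open>The default 0 from tape 6 on agrees with that of \<open>view\<close> on a list of six
  symbols, so tests and actions mean the same for states and for machine configurations.\<close>

definition reads :: "state \<Rightarrow> nat \<Rightarrow> symbol" where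
  "reads \<sigma> j = (if j < 6 then fst (\<sigma> j) (snd (\<sigma> j)) else 0)"

definition tapes :: "state \<Rightarrow> tape list" where
  "tapes \<sigma> = map \<sigma> [0..<6]"

definition view :: "symbol list \<Rightarrow> nat \<Rightarrow> symbol" where
  "view rs j = (if j < length rs then rs ! j else 0)"

definition idle :: "symbol list \<Rightarrow> (symbol \<times> move) list" where
  "idle rs = map (\<lambda>r. (r, Stay)) rs"

fun csize :: "cmd \<Rightarrow> nat" where
  "csize Skip = 0"
| "csize (Op i f) = 1"
| "csize (c1 ;; c2) = csize c1 + csize c2"
| "csize (Cond b c1 c2) = csize c1 + csize c2 + 2"
| "csize (While b c) = csize c + 2"

text \<open>Jump targets are absolute, so the code depends on its start \<open>p\<close>; control
  leaves a block at the first address behind it. \<open>Cond\<close> needs an extra state that jumps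
  over the else branch and \<open>While\<close> one that jumps back, hence the 2 in
  \<open>csize\<close>. For \<open>p = 0\<close>, leaving the whole program is halting.\<close>

fun compile :: "cmd \<Rightarrow> nat \<Rightarrow> machine" where
  "compile Skip p = []"
| "compile (Op i f) p = [\<lambda>rs. (p + 1, (idle rs)[i := f (view rs)])]"
| "compile (c1 ;; c2) p = compile c1 p @ compile c2 (p + csize c1)"
| "compile (Cond b c1 c2) p =
     [\<lambda>rs. (if b (view rs) then p + 1 else p + csize c1 + 2, idle rs)] @
     compile c1 (p + 1) @ [\<lambda>rs. (p + csize c1 + csize c2 + 2, idle rs)] @
     compile c2 (p + csize c1 + 2)"
| "compile (While b c) p =
     [\<lambda>rs. (if b (view rs) then p + 1 else p + csize c + 2, idle rs)] @
     compile c (p + 1) @ [\<lambda>rs. (p, idle rs)]"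

lemma length_compile [simp]: "length (compile c p) = csize c"
  by (induction c arbitrary: p) auto

fun wf_cmd :: "cmd \<Rightarrow> bool" where
  "wf_cmd Skip \<longleftrightarrow> True"
| "wf_cmd (Op i f) \<longleftrightarrow> (\<forall>r. (\<forall>j. r j < 5) \<longrightarrow> fst (f r) < 5)"
| "wf_cmd (c1 ;; c2) \<longleftrightarrow> wf_cmd c1 \<and> wf_cmd c2"
| "wf_cmd (Cond b c1 c2) \<longleftrightarrow> wf_cmd c1 \<and> wf_cmd c2"
| "wf_cmd (While b c) \<longleftrightarrow> wf_cmd c"

lemma compile_wf:
  assumes "wf_cmd c" "\<delta> \<in> set (compile c p)" "length rs = 6" "set rs \<subseteq> {..<5}"
  shows "fst (\<delta> rs) \<le> p + csize c \<and> length (snd (\<delta> rs)) = 6 \<and>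
         (\<forall>(s, _) \<in> set (snd (\<delta> rs)). s < 5)"
  using assms(1,2)
proof (induction c arbitrary: p)
  case (Op i f)
  have "view rs j < 5" for j
    using assms(3,4) by (auto simp: view_def subset_iff)
  then have "fst (f (view rs)) < 5" using Op by auto
  then show ?case using Op assms(3,4)
    by (cases "f (view rs)") (auto simp: idle_def dest!: set_update_subset_insert[THEN subsetD])
next
  case (Seq c1 c2)
  then show ?case by (fastforce)
next
  case (Cond b c1 c2)
  from Cond.prems assms(3,4) consider "\<delta> \<in> set (compile c1 (p+1))" | "\<delta> \<in> set (compile c2 (p + csize c1 + 2))"
    | "fst (\<delta> rs) \<le> p + csize (Cond b c1 c2)" "snd (\<delta> rs) = idle rs" by auto
  then show ?case
  proof cases
    case 1 then show ?thesis using Cond.IH(1)[of "p+1"] Cond.prems by auto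
  next
    case 2 then show ?thesis using Cond.IH(2)[of "p + csize c1 + 2"] Cond.prems by auto
  next
    case 3 then show ?thesis using assms(3,4) by (auto simp: idle_def)
  qed
next
  case (While b c)
  from While.prems assms(3,4) consider "\<delta> \<in> set (compile c (p+1))"
    | "fst (\<delta> rs) \<le> p + csize (While b c)" "snd (\<delta> rs) = idle rs" by auto
  then show ?case
  proof cases
    case 1 then show ?thesis using While.IH[of "p+1"] While.prems by auto
  next
    case 2 then show ?thesis using assms(3,4) by (auto simp: idle_def)
  qed
qed auto

lemma turing_machine_compile: "wf_cmd c \<Longrightarrow> turing_machine 6 5 (compile c 0)"
  unfolding turing_machine_def using compile_wf[of c _ 0] by simp_all blast

section \<open>Execution with step counts, and correctness of the compilation\<close>

text \<open>The index is the exact number of machine steps, so that it can be the exponent of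
  \<open>step\<close>. A then branch pays for its test and for the jump over the other branch, an
  else branch for the test only.\<close>

inductive exec :: "cmd \<Rightarrow> nat \<Rightarrow> state \<Rightarrow> state \<Rightarrow> bool" where
  exec_Skip: "exec Skip 0 \<sigma> \<sigma>"
| exec_Op: "i < 6 \<Longrightarrow> exec (Op i f) 1 \<sigma> (\<sigma>(i := act (f (reads \<sigma>)) (\<sigma> i)))"
| exec_Seq: "exec c1 t1 \<sigma> \<sigma>1 \<Longrightarrow> exec c2 t2 \<sigma>1 \<sigma>2 \<Longrightarrow> exec (c1 ;; c2) (t1 + t2) \<sigma> \<sigma>2"
| exec_CondT: "b (reads \<sigma>) \<Longrightarrow> exec c1 t \<sigma> \<sigma>1 \<Longrightarrow> exec (Cond b c1 c2) (t + 2) \<sigma> \<sigma>1"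
| exec_CondF: "\<not> b (reads \<sigma>) \<Longrightarrow> exec c2 t \<sigma> \<sigma>1 \<Longrightarrow> exec (Cond b c1 c2) (t + 1) \<sigma> \<sigma>1"
| exec_WhileF: "\<not> b (reads \<sigma>) \<Longrightarrow> exec (While b c) 1 \<sigma> \<sigma>"
| exec_WhileT: "b (reads \<sigma>) \<Longrightarrow> exec c t1 \<sigma> \<sigma>1 \<Longrightarrow> exec (While b c) t2 \<sigma>1 \<sigma>2 \<Longrightarrow>
    exec (While b c) (t1 + t2 + 2) \<sigma> \<sigma>2"

definition located :: "machine \<Rightarrow> nat \<Rightarrow> machine \<Rightarrow> bool" where
  "located M p N \<longleftrightarrow> p + length N \<le> length M \<and> (\<forall>i < length N. M ! (p + i) = N ! i)"

lemma located_append: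
  "located M p (N1 @ N2) \<longleftrightarrow> located M p N1 \<and> located M (p + length N1) N2"
proof -
  have "(\<forall>i < length N1 + length N2. M ! (p + i) = (N1 @ N2) ! i) \<longleftrightarrow>
    (\<forall>i < length N1. M ! (p + i) = N1 ! i) \<and> (\<forall>i < length N2. M ! (p + length N1 + i) = N2 ! i)"
    (is "?L \<longleftrightarrow> ?R")
  proof
    assume L: ?L
    have "M ! (p + i) = N1 ! i" if "i < length N1" for i
      using L[rule_format, of i] that by (simp add: nth_append)
    moreover have "M ! (p + length N1 + i) = N2 ! i" if "i < length N2" for i
      using L[rule_format, of "length N1 + i"] that by (simp add: add.assoc)
    ultimately show ?R by blast
  next
    assume R: ?R
    show ?L
    proof (intro allI impI)
      fix i assume i: "i < length N1 + length N2"
      show "M ! (p + i) = (N1 @ N2) ! i"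
        using R[THEN conjunct1, rule_format, of i] R[THEN conjunct2, rule_format, of "i - length N1"] i
        by (cases "i < length N1") (auto simp: nth_append)
    qed
  qed
  then show ?thesis by (auto simp: located_def)
qed

lemma located_Cons:
  "located M p (x # N) \<longleftrightarrow> p < length M \<and> M ! p = x \<and> located M (p + 1) N"
  using located_append[of M p "[x]" N] by (auto simp: located_def)

lemma act_Stay: "act (fst t (snd t), Stay) t = t"
  by (cases t) (auto simp: act_def)

lemma map_reads: "map (\<lambda>(cells, pos). cells pos) (tapes \<sigma>) = map (reads \<sigma>) [0..<6]"
  by (auto simp: tapes_def reads_def split: prod.split)

lemma view_reads: "view (map (reads \<sigma>) [0..<6]) = reads \<sigma>"
  by (auto simp: view_def reads_def fun_eq_iff)

lemma map2_act_idle: "map2 act (idle (map (reads \<sigma>) [0..<6])) (tapes \<sigma>) = tapes \<sigma>"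
  by (rule nth_equalityI) (auto simp: idle_def tapes_def reads_def act_Stay)

lemma map2_act_update:
  assumes "i < 6"
  shows "map2 act ((idle (map (reads \<sigma>) [0..<6]))[i := x]) (tapes \<sigma>) = tapes (\<sigma>(i := act x (\<sigma> i)))"
  by (rule nth_equalityI) (auto simp: idle_def tapes_def reads_def act_Stay nth_list_update)

lemma step_at:
  assumes "p < length M"
  shows "step M (p, tapes \<sigma>) = (let (q, acts) = (M ! p) (map (reads \<sigma>) [0..<6]) in (q, map2 act acts (tapes \<sigma>)))"
  using assms by (simp add: step_def map_reads)

lemma funpow_1_apply: "((f :: 'a \<Rightarrow> 'a) ^^ 1) x = f x"
  by simp

text \<open>Rule induction on the execution with \<open>p\<close> arbitrary: the parts of a located
  block are located at the addresses for which they were compiled.\<close>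

lemma exec_steps:
  assumes "exec c t \<sigma> \<sigma>'" "located M p (compile c p)"
  shows "(step M ^^ t) (p, tapes \<sigma>) = (p + csize c, tapes \<sigma>')"
  using assms
proof (induction arbitrary: p rule: exec.induct)
  case (exec_Op i f \<sigma>)
  then show ?case by (simp add: located_Cons step_at view_reads map2_act_update flip: fun_upd_def)
next
  case (exec_Seq c1 t1 \<sigma> \<sigma>1 c2 t2 \<sigma>2)
  then show ?case
    by (simp add: located_append funpow_add add.commute[of t1] add.assoc)
next
  case (exec_CondT b \<sigma> c1 t \<sigma>1 c2)
  then have 1: "step M (p, tapes \<sigma>) = (p + 1, tapes \<sigma>)"
    and 2: "step M (p + 1 + csize c1, tapes \<sigma>1) = (p + csize (Cond b c1 c2), tapes \<sigma>1)"
    by (simp_all add: located_Cons located_append step_at view_reads map2_act_idle)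
  have "(step M ^^ t) (p + 1, tapes \<sigma>) = (p + 1 + csize c1, tapes \<sigma>1)"
    using exec_CondT by (simp add: located_Cons located_append)
  then have "(step M ^^ (1 + (t + 1))) (p, tapes \<sigma>) = (p + csize (Cond b c1 c2), tapes \<sigma>1)"
    using 1 2 by (simp only: funpow_add o_apply funpow_1_apply)
  then show ?case by (simp del: csize.simps)
next
  case (exec_CondF b \<sigma> c2 t \<sigma>1 c1)
  then have 1: "step M (p, tapes \<sigma>) = (p + csize c1 + 2, tapes \<sigma>)"
    by (simp_all add: located_Cons located_append step_at view_reads map2_act_idle)
  have "(step M ^^ t) (p + csize c1 + 2, tapes \<sigma>) = (p + csize c1 + 2 + csize c2, tapes \<sigma>1)"
    using exec_CondF by (simp add: located_Cons located_append add_ac)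
  then show ?case using 1 by (simp add: funpow_swap1 add_ac)
next
  case (exec_WhileF b \<sigma> c)
  then show ?case
    by (simp_all add: located_Cons located_append step_at view_reads map2_act_idle)
next
  case (exec_WhileT b \<sigma> c t1 \<sigma>1 t2 \<sigma>2)
  then have 1: "step M (p, tapes \<sigma>) = (p + 1, tapes \<sigma>)"
    and 2: "step M (p + 1 + csize c, tapes \<sigma>1) = (p, tapes \<sigma>1)"
    by (simp_all add: located_Cons located_append step_at view_reads map2_act_idle)
  have 3: "(step M ^^ t1) (p + 1, tapes \<sigma>) = (p + 1 + csize c, tapes \<sigma>1)"
    using exec_WhileT by (simp add: located_Cons located_append)
  have 4: "(step M ^^ t2) (p, tapes \<sigma>1) = (p + csize (While b c), tapes \<sigma>2)"
    using exec_WhileT by simp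
  \<comment> \<open>What runs first must be the innermost summand: the test, the body, the jump
    back, and then the remaining rounds.\<close>
  have "t1 + t2 + 2 = t2 + (1 + (t1 + 1))" by simp
  then show ?case using 1 2 3 4 by (simp only: funpow_add o_apply funpow_1_apply)
qed auto

text \<open>An upper bound replaces the exact time, since the rounds of a loop and the branches of a
  test differ in length.\<close>

definition runs :: "cmd \<Rightarrow> nat \<Rightarrow> state \<Rightarrow> state \<Rightarrow> bool" where
  "runs c T \<sigma> \<sigma>' \<longleftrightarrow> (\<exists>t \<le> T. exec c t \<sigma> \<sigma>')"

lemma runs_mono: "runs c T \<sigma> \<sigma>' \<Longrightarrow> T \<le> T' \<Longrightarrow> runs c T' \<sigma> \<sigma>'"
  unfolding runs_def using le_trans by blast

lemma runs_Skip: "runs Skip 0 \<sigma> \<sigma>"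
  unfolding runs_def using exec_Skip by blast

lemma runs_Op: "i < 6 \<Longrightarrow> \<sigma>' = \<sigma>(i := act (f (reads \<sigma>)) (\<sigma> i)) \<Longrightarrow> runs (Op i f) 1 \<sigma> \<sigma>'"
  unfolding runs_def using exec_Op by blast

lemma runs_Seq: "runs c1 T1 \<sigma> \<sigma>1 \<Longrightarrow> runs c2 T2 \<sigma>1 \<sigma>2 \<Longrightarrow> runs (c1 ;; c2) (T1 + T2) \<sigma> \<sigma>2"
  unfolding runs_def by (meson add_mono exec_Seq)

lemma runs_CondT: "b (reads \<sigma>) \<Longrightarrow> runs c1 T \<sigma> \<sigma>' \<Longrightarrow> runs (Cond b c1 c2) (T + 2) \<sigma> \<sigma>'"
  unfolding runs_def by (meson add_le_mono1 exec_CondT)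

lemma runs_CondF: "\<not> b (reads \<sigma>) \<Longrightarrow> runs c2 T \<sigma> \<sigma>' \<Longrightarrow> runs (Cond b c1 c2) (T + 2) \<sigma> \<sigma>'"
  unfolding runs_def
  by (metis add_le_mono exec_CondF one_le_numeral)

text \<open>The invariant is an explicit sequence of states, \<open>s i\<close> after
  \<open>i\<close> rounds, so that correctness, termination and the time bound come from one
  induction on the number of rounds.\<close>

lemma runs_While:
  assumes "\<And>i. i < n \<Longrightarrow> b (reads (s i))"
    and "\<And>i. i < n \<Longrightarrow> runs c B (s i) (s (Suc i))"
    and "\<not> b (reads (s n))"
  shows "runs (While b c) (n * (B + 2) + 1) (s 0) (s n)"
  using assms
proof (induction n arbitrary: s)
  case 0
  then show ?case unfolding runs_def using exec_WhileF[of b "s 0" c] by auto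
next
  case (Suc n)
  have "runs (While b c) (n * (B + 2) + 1) (s (Suc 0)) (s (Suc n))"
    using Suc.IH[of "\<lambda>i. s (Suc i)"] Suc.prems by auto
  then obtain t2 where t2: "t2 \<le> n * (B + 2) + 1" "exec (While b c) t2 (s (Suc 0)) (s (Suc n))"
    by (auto simp: runs_def)
  obtain t1 where t1: "t1 \<le> B" "exec c t1 (s 0) (s (Suc 0))"
    using Suc.prems(2)[of 0] by (auto simp: runs_def)
  have "exec (While b c) (t1 + t2 + 2) (s 0) (s (Suc n))"
    using exec_WhileT t1 t2 Suc.prems(1)[of 0] by blast
  moreover have "t1 + t2 + 2 \<le> Suc n * (B + 2) + 1" using t1 t2 by simp
  ultimately show ?case unfolding runs_def by blast
qed

lemma runs_computes_in:
  assumes "runs c T \<sigma>0 \<sigma>" "\<sigma>0 0 = (tape_of xs, 0)"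
    and "\<And>i. 0 < i \<Longrightarrow> i < 6 \<Longrightarrow> \<sigma>0 i = (tape_of [], 0)" "fst (\<sigma> 5) = tape_of ys"
  shows "computes_in 6 (compile c 0) xs T ys"
proof -
  obtain t where t: "t \<le> T" "exec c t \<sigma>0 \<sigma>"
    using assms(1) by (auto simp: runs_def)
  have "init_config 6 xs = (0, tapes \<sigma>0)"
    by (auto simp: init_config_def tapes_def assms(2,3) nth_Cons split: nat.split intro!: nth_equalityI)
  then have "(step (compile c 0) ^^ t) (init_config 6 xs) = (length (compile c 0), tapes \<sigma>)"
    using exec_steps[OF t(2), of "compile c 0" 0] by (simp add: located_def)
  moreover have "last (tapes \<sigma>) = \<sigma> 5"
    by (simp add: tapes_def last_map)
  ultimately show ?thesis
    unfolding computes_in_def using assms(4) t(1) by (intro exI[of _ t]) auto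
qed

section \<open>States as six-tuples of tapes, and tape contents around the head\<close>

text \<open>The fixed default beyond tape 5 makes the update of one tape again a tuple, as an
  equation between functions; simplification can then run programs symbolically.\<close>

definition S :: "tape \<Rightarrow> tape \<Rightarrow> tape \<Rightarrow> tape \<Rightarrow> tape \<Rightarrow> tape \<Rightarrow> state" where
  "S t0 t1 t2 t3 t4 t5 =
     (\<lambda>i. if i = 0 then t0 else if i = 1 then t1 else if i = 2 then t2 else if i = 3 then t3
          else if i = 4 then t4 else if i = 5 then t5 else (\<lambda>_. 0, 0))"

lemma S_simps [simp]:
  "S t0 t1 t2 t3 t4 t5 0 = t0" "S t0 t1 t2 t3 t4 t5 (Suc 0) = t1" "S t0 t1 t2 t3 t4 t5 2 = t2"
  "S t0 t1 t2 t3 t4 t5 3 = t3" "S t0 t1 t2 t3 t4 t5 4 = t4" "S t0 t1 t2 t3 t4 t5 5 = t5"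
  by (auto simp: S_def)

lemma reads_S [simp]:
  "reads (S t0 t1 t2 t3 t4 t5) 0 = fst t0 (snd t0)"
  "reads (S t0 t1 t2 t3 t4 t5) (Suc 0) = fst t1 (snd t1)"
  "reads (S t0 t1 t2 t3 t4 t5) 2 = fst t2 (snd t2)"
  "reads (S t0 t1 t2 t3 t4 t5) 3 = fst t3 (snd t3)"
  "reads (S t0 t1 t2 t3 t4 t5) 4 = fst t4 (snd t4)"
  "reads (S t0 t1 t2 t3 t4 t5) 5 = fst t5 (snd t5)"
  by (auto simp: reads_def)

lemma S_upd [simp]:
  "(S t0 t1 t2 t3 t4 t5)(0 := t) = S t t1 t2 t3 t4 t5"
  "(S t0 t1 t2 t3 t4 t5)(Suc 0 := t) = S t0 t t2 t3 t4 t5"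
  "(S t0 t1 t2 t3 t4 t5)(2 := t) = S t0 t1 t t3 t4 t5"
  "(S t0 t1 t2 t3 t4 t5)(3 := t) = S t0 t1 t2 t t4 t5"
  "(S t0 t1 t2 t3 t4 t5)(4 := t) = S t0 t1 t2 t3 t t5"
  "(S t0 t1 t2 t3 t4 t5)(5 := t) = S t0 t1 t2 t3 t4 t"
  by (auto simp: S_def fun_eq_iff)

lemma reads_upd [simp]: "i < 6 \<Longrightarrow> reads (\<sigma>(i := t)) i = fst t (snd t)"
  by (auto simp: reads_def)

lemma act_simps [simp]:
  "act (s, Go_Left) (f, p) = (f(p := s), p - 1)"
  "act (s, Stay) (f, p) = (f(p := s), p)"
  "act (s, Go_Right) (f, p) = (f(p := s), Suc p)"
  by (auto simp: act_def)

text \<open>Contents without blanks and end markers: a scanning head recognises both ends of such a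
  tape.\<close>

definition clean :: "symbol list \<Rightarrow> bool" where
  "clean xs \<longleftrightarrow> set xs \<subseteq> {2, 3, 4}"

lemma clean_append [simp]: "clean (xs @ ys) \<longleftrightarrow> clean xs \<and> clean ys"
  and clean_Cons [simp]: "clean (x # xs) \<longleftrightarrow> x \<in> {2, 3, 4} \<and> clean xs"
  and clean_Nil [simp]: "clean []"
  by (auto simp: clean_def)

lemma clean_replicate [simp]: "x \<in> {2, 3, 4} \<Longrightarrow> clean (replicate n x)"
  by (auto simp: clean_def)

lemma tape_of_clean: "clean xs \<Longrightarrow> 0 < p \<Longrightarrow> p \<le> length xs \<Longrightarrow> tape_of xs p \<in> {2, 3, 4}"
proof -
  assume *: "clean xs" "0 < p" "p \<le> length xs"
  then have "xs ! (p - 1) \<in> set xs" by (intro nth_mem) auto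
  then have "xs ! (p - 1) \<in> {2, 3, 4}" using * unfolding clean_def by blast
  then show ?thesis using * by (simp add: tape_of_def)
qed

lemma tape_of_eq_0: "clean xs \<Longrightarrow> tape_of xs p = 0 \<longleftrightarrow> length xs < p"
  using tape_of_clean[of xs p] by (cases "p = 0"; cases "p \<le> length xs") (auto simp: tape_of_def)

lemma tape_of_eq_1: "clean xs \<Longrightarrow> tape_of xs p = Suc 0 \<longleftrightarrow> p = 0"
  using tape_of_clean[of xs p] by (cases "p = 0"; cases "p \<le> length xs") (auto simp: tape_of_def)

text \<open>Contents are split at the head, with \<open>us\<close> to its left; the head position is
  shifted by one because cell 0 carries the end marker.\<close>

lemma tape_of_read [simp]: "tape_of (us @ x # vs) (Suc (length us)) = x"
  by (simp add: tape_of_def)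

lemma tape_of_end [simp]: "tape_of us (Suc (length us)) = 0"
  by (simp add: tape_of_def)

lemma tape_of_0 [simp]: "tape_of us 0 = Suc 0"
  by (simp add: tape_of_def)

lemma tape_of_write [simp]:
  "(tape_of (us @ x # vs))(Suc (length us) := s) = tape_of (us @ s # vs)"
  by (auto simp: tape_of_def fun_eq_iff nth_append nth_Cons split: nat.split)

lemma tape_of_write_end [simp]: "(tape_of us)(Suc (length us) := s) = tape_of (us @ [s])"
  by (auto simp: tape_of_def fun_eq_iff nth_append)

lemma tape_of_erase: "(tape_of (take p xs))(p := 0) = tape_of (take (p - 1) xs)" if "p > 0"
  using that by (auto simp: tape_of_def fun_eq_iff)

abbreviation out :: "symbol list \<Rightarrow> tape" where
  "out ys \<equiv> (tape_of ys, Suc (length ys))"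

definition Mv :: "nat \<Rightarrow> move \<Rightarrow> cmd" where
  "Mv i mv = Op i (\<lambda>r. (r i, mv))"

definition Home :: "nat \<Rightarrow> cmd" where
  "Home i = While (\<lambda>r. r i \<noteq> 1) (Mv i Go_Left) ;; Mv i Go_Right"

definition Erase :: "nat \<Rightarrow> cmd" where
  "Erase i = While (\<lambda>r. r i \<noteq> 0) (Mv i Go_Right) ;; Mv i Go_Left ;;
     While (\<lambda>r. r i \<noteq> 1) (Op i (\<lambda>r. (0, Go_Left))) ;; Mv i Go_Right"

text \<open>A run of ones turns into zeros, and the cell where the carry stops, a zero or the blank,
  becomes one.\<close>

definition Inc :: "nat \<Rightarrow> cmd" where
  "Inc i = While (\<lambda>r. r i = 3) (Op i (\<lambda>r. (2, Go_Right))) ;; Op i (\<lambda>r. (3, Stay)) ;; Home i"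

section \<open>Binary numerals, least significant digit first\<close>

text \<open>Zero is the empty word: an empty tape already holds the number 0, and testing for zero
  is testing one cell for the blank.\<close>

fun lsb :: "nat \<Rightarrow> symbol list" where
  "lsb n = (if n = 0 then [] else bit_sym (odd n) # lsb (n div 2))"

declare lsb.simps [simp del]

lemma lsb_0 [simp]: "lsb 0 = []"
  by (simp add: lsb.simps)

lemma bit_sym_simps [simp]: "bit_sym True = 3" "bit_sym False = 2"
  by (auto simp: bit_sym_def)

lemma bit_sym_clean [simp]: "bit_sym x = 2 \<or> bit_sym x = 3 \<or> bit_sym x = 4"
  by (auto simp: bit_sym_def)

lemma bit_sym_neq [simp]: "bit_sym x \<noteq> 0" "bit_sym x \<noteq> 1" "bit_sym x \<noteq> Suc 0" "bit_sym x \<noteq> 4"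
  "bit_sym x = 3 \<longleftrightarrow> x" "bit_sym x = bit_sym y \<longleftrightarrow> x = y" "bit_sym x < 5" "0 < bit_sym x"
  by (auto simp: bit_sym_def)

lemma clean_lsb [simp]: "clean (lsb n)"
proof (induction n rule: lsb.induct)
  case (1 n)
  then show ?case by (subst lsb.simps) auto
qed

lemma tape_lsb:
  "tape_of (lsb a) (Suc i) = (if a div 2 ^ i = 0 then 0 else bit_sym (odd (a div 2 ^ i)))"
proof (induction a arbitrary: i rule: lsb.induct)
  case (1 n)
  show ?case
  proof (cases "n = 0")
    case False
    then show ?thesis
    proof (cases i)
      case 0
      then show ?thesis using False by (subst lsb.simps) (simp add: tape_of_def)
    next
      case (Suc l)
      have "tape_of (lsb n) (Suc i) = tape_of (lsb (n div 2)) (Suc l)"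
        using False Suc by (subst lsb.simps) (simp add: tape_of_def)
      then show ?thesis using 1[OF False, of l] Suc by (simp add: div_mult2_eq)
    qed
  qed (simp add: tape_of_def)
qed

lemma length_lsb_le: "length (lsb n) \<le> n"
proof (induction n rule: lsb.induct)
  case (1 n)
  show ?case
  proof (cases "n = 0")
    case False
    have "length (lsb n) = Suc (length (lsb (n div 2)))" using False by (subst lsb.simps) simp
    also have "\<dots> \<le> Suc (n div 2)" using 1 False by simp
    also have "\<dots> \<le> n" using False by (cases "n = 1") auto
    finally show ?thesis .
  qed simp
qed

lemma length_lsb: "length (lsb a) \<le> i \<longleftrightarrow> a < 2 ^ i"
proof -
  have "length (lsb a) < Suc i \<longleftrightarrow> tape_of (lsb a) (Suc i) = 0"
    by (subst tape_of_eq_0) auto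
  also have "\<dots> \<longleftrightarrow> a div 2 ^ i = 0"
    by (simp add: tape_lsb)
  finally show ?thesis by (simp add: div_eq_0_iff less_Suc_eq_le)
qed

text \<open>The number is cut where the carry stops, behind its \<open>t\<close> trailing ones. If
  it consists of ones only then \<open>ys\<close> is empty, and \<open>tl [] = []\<close> lets the
  same formula describe the numeral that grows by a digit.\<close>

lemma lsb_Suc:
  obtains t ys where "lsb n = replicate t 3 @ ys" "ys = [] \<or> hd ys = 2"
    "lsb (Suc n) = replicate t 2 @ 3 # tl ys"
proof -
  have "\<exists>t ys. lsb n = replicate t 3 @ ys \<and> (ys = [] \<or> hd ys = 2) \<and>
    lsb (Suc n) = replicate t 2 @ 3 # tl ys"
  proof (induction n rule: lsb.induct)
    case (1 n)
    consider "n = 0" | "n \<noteq> 0" "even n" | "odd n" by blast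
    then show ?case
    proof cases
      case 1
      then show ?thesis by (intro exI[of _ 0] exI[of _ "[]"]) (simp add: lsb.simps[of "Suc 0"])
    next
      case 2
      then show ?thesis
        by (intro exI[of _ 0] exI[of _ "lsb n"]) (simp add: lsb.simps[of n] lsb.simps[of "Suc n"])
    next
      case 3
      then have "n \<noteq> 0" by (cases n) auto
      from 1[OF this] obtain t ys where *: "lsb (n div 2) = replicate t 3 @ ys"
        "ys = [] \<or> hd ys = 2" "lsb (Suc (n div 2)) = replicate t 2 @ 3 # tl ys" by blast
      have "Suc n div 2 = Suc (n div 2)" using 3 by presburger
      then show ?thesis using 3 * \<open>n \<noteq> 0\<close>
        by (intro exI[of _ "Suc t"] exI[of _ ys]) (simp add: lsb.simps[of n] lsb.simps[of "Suc n"])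
    qed
  qed
  then show thesis using that by blast
qed

lemma lsb_pow2: "lsb (2 ^ k) = replicate k 2 @ [3]"
proof (induction k)
  case 0
  then show ?case by (simp add: lsb.simps[of "Suc 0"])
next
  case (Suc k)
  then show ?case by (subst lsb.simps) simp
qed

text \<open>Zero is excluded because \<open>binary 0\<close> is one digit while \<open>lsb 0\<close>
  is empty.\<close>

lemma binary_lsb: "n > 0 \<Longrightarrow> binary n = rev (lsb n)"
proof (induction n rule: lsb.induct)
  case (1 n)
  show ?case
  proof (cases "n = 1")
    case True
    then show ?thesis by (simp add: binary.simps lsb.simps[of "Suc 0"])
  next
    case False
    then show ?thesis using 1 by (subst binary.simps, subst lsb.simps) (auto simp: less_2_cases_iff)
  qed
qed

lemma binary_mult_pow2: "n > 0 \<Longrightarrow> binary (n * 2 ^ k) = binary n @ replicate k 2"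
proof (induction k)
  case (Suc k)
  have "binary (n * 2 ^ Suc k) = binary (n * 2 ^ k) @ [2]"
    using Suc.prems by (subst binary.simps) auto
  then show ?case using Suc by (simp add: replicate_append_same)
qed simp

section \<open>Programs with polynomial time bounds\<close>

locale clocked =
  fixes N :: nat
  assumes N_ge: "3 \<le> N"
begin

text \<open>Exponents instead of times: any polynomial bound suffices, and exponents compose by simplification.\<close>

definition pruns :: "cmd \<Rightarrow> nat \<Rightarrow> state \<Rightarrow> state \<Rightarrow> bool" where
  "pruns c e \<sigma> \<sigma>' \<longleftrightarrow> runs c (N ^ e) \<sigma> \<sigma>'"

lemma N_pow [simp]: "Suc 0 \<le> N ^ e" "0 < N ^ e"
  using N_ge by (auto simp: Suc_le_eq)

lemma pruns_mono: "pruns c e \<sigma> \<sigma>' \<Longrightarrow> e \<le> e' \<Longrightarrow> pruns c e' \<sigma> \<sigma>'"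
  unfolding pruns_def using N_ge by (meson runs_mono power_increasing order_trans one_le_numeral)

lemma pruns_Skip: "\<sigma> = \<sigma>' \<Longrightarrow> pruns Skip 0 \<sigma> \<sigma>'"
  unfolding pruns_def using runs_Skip runs_mono by blast

lemma pruns_Op: "i < 6 \<Longrightarrow> \<sigma>' = \<sigma>(i := act (f (reads \<sigma>)) (\<sigma> i)) \<Longrightarrow> pruns (Op i f) 0 \<sigma> \<sigma>'"
  unfolding pruns_def using runs_Op by simp

lemma pruns_Mv:
  assumes "i < 6" "\<sigma> i = (f, p)"
    "\<sigma>' = \<sigma>(i := (f, case mv of Go_Left \<Rightarrow> p - 1 | Stay \<Rightarrow> p | Go_Right \<Rightarrow> Suc p))"
  shows "pruns (Mv i mv) 0 \<sigma> \<sigma>'"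
  unfolding Mv_def by (rule pruns_Op) (use assms in \<open>auto simp: act_def reads_def split: move.split\<close>)

lemma pruns_Seq:
  assumes "pruns c1 e1 \<sigma> \<sigma>1" "pruns c2 e2 \<sigma>1 \<sigma>2"
  shows "pruns (c1 ;; c2) (Suc (max e1 e2)) \<sigma> \<sigma>2"
proof -
  have "runs (c1 ;; c2) (N ^ max e1 e2 + N ^ max e1 e2) \<sigma> \<sigma>2"
    using runs_Seq pruns_mono[OF assms(1), of "max e1 e2"] pruns_mono[OF assms(2), of "max e1 e2"]
    unfolding pruns_def by auto
  then show ?thesis unfolding pruns_def
    by (rule runs_mono) (use N_ge in \<open>simp flip: mult_2\<close>)
qed

text \<open>The place where \<open>3 \<le> N\<close> pays: raising the exponent by one absorbs the
  test and the jump of a conditional or of a loop round.\<close>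

lemma pow3: "N ^ e + 2 \<le> N ^ Suc e"
proof -
  have "N ^ e + 2 \<le> 3 * N ^ e" using N_pow(1)[of e] by linarith
  also have "\<dots> \<le> N ^ Suc e" using N_ge by simp
  finally show ?thesis .
qed

lemma pruns_CondT: "b (reads \<sigma>) \<Longrightarrow> pruns c1 e \<sigma> \<sigma>' \<Longrightarrow> pruns (Cond b c1 c2) (Suc e) \<sigma> \<sigma>'"
  unfolding pruns_def using runs_CondT runs_mono pow3 by metis

lemma pruns_CondF: "\<not> b (reads \<sigma>) \<Longrightarrow> pruns c2 e \<sigma> \<sigma>' \<Longrightarrow> pruns (Cond b c1 c2) (Suc e) \<sigma> \<sigma>'"
  unfolding pruns_def using runs_CondF runs_mono pow3 by metis

text \<open>At most \<open>N\<close> rounds, each within \<open>N ^ Suc e\<close> including its test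
  and jump, stay within \<open>N ^ (e + 2)\<close>; the third increment covers the final
  test.\<close>

lemma pruns_While:
  assumes "\<And>i. i < n \<Longrightarrow> b (reads (s i))"
    and "\<And>i. i < n \<Longrightarrow> pruns c e (s i) (s (Suc i))"
    and "\<not> b (reads (s n))" "n \<le> N" "\<sigma> = s 0" "\<sigma>' = s n"
  shows "pruns (While b c) (e + 3) \<sigma> \<sigma>'"
proof -
  have "runs (While b c) (n * (N ^ e + 2) + 1) (s 0) (s n)"
    by (rule runs_While) (use assms in \<open>auto simp: pruns_def\<close>)
  moreover have "n * (N ^ e + 2) + 1 \<le> N ^ (e + 3)"
  proof -
    have "n * (N ^ e + 2) \<le> N * N ^ Suc e" using assms(4) pow3 by (rule mult_le_mono)
    then have "n * (N ^ e + 2) + 1 \<le> N ^ (e + 2) + 2" by simp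
    also have "\<dots> \<le> N ^ (e + 3)" using pow3[of "e + 2"] by (simp add: numeral_eq_Suc)
    finally show ?thesis .
  qed
  ultimately show ?thesis unfolding pruns_def using assms(5,6) runs_mono by blast
qed

lemma pruns_Home:
  assumes "i < 6" "\<sigma> i = (tape_of xs, p)" "clean xs" "p \<le> N" "\<sigma>' = \<sigma>(i := (tape_of xs, 1))"
  shows "pruns (Home i) 4 \<sigma> \<sigma>'"
proof -
  have 1: "pruns (While (\<lambda>r. r i \<noteq> 1) (Mv i Go_Left)) (0 + 3) \<sigma> (\<sigma>(i := (tape_of xs, 0)))"
    by (rule pruns_While[where s = "\<lambda>n. \<sigma>(i := (tape_of xs, p - n))" and n = p])
      (use assms in \<open>auto simp: tape_of_eq_1 intro!: pruns_Mv\<close>)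
  have 2: "pruns (Mv i Go_Right) 0 (\<sigma>(i := (tape_of xs, 0))) \<sigma>'"
    by (rule pruns_Mv) (use assms in auto)
  show ?thesis
    unfolding Home_def by (rule pruns_mono[OF pruns_Seq[OF 1 2]]) simp
qed

text \<open>The head may also stand beyond the contents, as it does after the test for a third digit
  of a short number. Then the first loop is empty and \<open>q\<close> is the head position
  itself.\<close>

lemma pruns_Erase:
  assumes "i < 6" "\<sigma> i = (tape_of xs, p)" "clean xs" "p > 0" "p \<le> N" "length xs < N"
    "\<sigma>' = \<sigma>(i := (tape_of [], 1))"
  shows "pruns (Erase i) 6 \<sigma> \<sigma>'"
proof -
  define q where "q = max p (Suc (length xs))"
  have 1: "pruns (While (\<lambda>r. r i \<noteq> 0) (Mv i Go_Right)) (0 + 3) \<sigma> (\<sigma>(i := (tape_of xs, q)))"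
    by (rule pruns_While[where s = "\<lambda>n. \<sigma>(i := (tape_of xs, p + n))" and n = "q - p"])
      (use assms in \<open>auto simp: q_def tape_of_eq_0 intro!: pruns_Mv\<close>)
  have 2: "pruns (Mv i Go_Left) 0 (\<sigma>(i := (tape_of xs, q))) (\<sigma>(i := (tape_of xs, q - 1)))"
    by (rule pruns_Mv) (use assms in auto)
  have ck: "clean (take n xs)" for n
    using assms(3) set_take_subset[of n xs] by (auto simp: clean_def)
  have 3: "pruns (While (\<lambda>r. r i \<noteq> 1) (Op i (\<lambda>r. (0, Go_Left)))) (0 + 3)
      (\<sigma>(i := (tape_of xs, q - 1))) (\<sigma>(i := (tape_of [], 0)))"
    by (rule pruns_While[where s = "\<lambda>n. \<sigma>(i := (tape_of (take (q - 1 - n) xs), q - 1 - n))" and n = "q - 1"])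
      (use assms in \<open>auto simp: q_def ck tape_of_eq_1 tape_of_erase intro!: pruns_Op\<close>)
  have 4: "pruns (Mv i Go_Right) 0 (\<sigma>(i := (tape_of [], 0))) \<sigma>'"
    by (rule pruns_Mv) (use assms in auto)
  show ?thesis
    unfolding Erase_def
    by (rule pruns_mono[OF pruns_Seq[OF 1 pruns_Seq[OF 2 pruns_Seq[OF 3 4]]]]) simp
qed

text \<open>Shared by \<open>Inc\<close> and \<open>Next_Mask\<close>, which differ only in what
  they do with the cell where the carry stops.\<close>

lemma pruns_carry:
  assumes "i < 6" "\<sigma> i = (tape_of (replicate t 3 @ ys), 1)" "ys = [] \<or> hd ys = 2" "t \<le> N"
    "\<sigma>' = \<sigma>(i := (tape_of (replicate t 2 @ ys), Suc t))"
  shows "pruns (While (\<lambda>r. r i = 3) (Op i (\<lambda>r. (2, Go_Right)))) 3 \<sigma> \<sigma>'"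
proof -
  let ?s = "\<lambda>n. \<sigma>(i := (tape_of (replicate n 2 @ replicate (t - n) 3 @ ys), Suc n))"
  have r: "tape_of (replicate n 2 @ x # zs) (Suc n) = x" for n x zs
    using tape_of_read[of "replicate n 2" x zs] by simp
  have w: "(tape_of (replicate n 2 @ x # zs))(Suc n := y) = tape_of (replicate n 2 @ y # zs)" for n x y zs
    using tape_of_write[of "replicate n 2" x zs y] by simp
  have e: "tape_of (replicate n 2) (Suc n) = 0" for n
    using tape_of_end[of "replicate n 2"] by (simp del: tape_of_end)
  have sp: "replicate (t - n) 3 = 3 # replicate (t - Suc n) (3::nat)" if "n < t" for n
    using that by (metis Suc_diff_Suc replicate_Suc)
  have "pruns (While (\<lambda>r. r i = 3) (Op i (\<lambda>r. (2, Go_Right)))) (0 + 3) \<sigma> \<sigma>'"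
  proof (rule pruns_While[where s = ?s and n = t])
    show "pruns (Op i (\<lambda>r. (2, Go_Right))) 0 (?s n) (?s (Suc n))" if "n < t" for n
      by (rule pruns_Op) (use assms that in \<open>auto simp: sp w r replicate_app_Cons_same\<close>)
    show "reads (?s n) i = 3" if "n < t" for n
      using assms that by (simp add: sp r)
    show "reads (?s t) i \<noteq> 3"
      using assms by (cases ys) (auto simp: r e)
  qed (use assms in auto)
  then show ?thesis by simp
qed

lemma pruns_Inc:
  assumes "i < 6" "\<sigma> i = (tape_of (lsb n), 1)" "n < N" "\<sigma>' = \<sigma>(i := (tape_of (lsb (Suc n)), 1))"
  shows "pruns (Inc i) 6 \<sigma> \<sigma>'"
proof -
  obtain t ys where t: "lsb n = replicate t 3 @ ys" "ys = [] \<or> hd ys = 2"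
    "lsb (Suc n) = replicate t 2 @ 3 # tl ys" using lsb_Suc .
  have tN: "t \<le> n" using t(1) length_lsb_le[of n] by simp
  have w: "(tape_of (replicate t 2 @ ys))(Suc t := 3) = tape_of (lsb (Suc n))"
    using tape_of_write[of "replicate t 2" "hd ys" "tl ys" 3] tape_of_write_end[of "replicate t 2" 3] t
    by (cases ys) auto
  have 1: "pruns (While (\<lambda>r. r i = 3) (Op i (\<lambda>r. (2, Go_Right)))) 3 \<sigma>
     (\<sigma>(i := (tape_of (replicate t 2 @ ys), Suc t)))"
    by (rule pruns_carry) (use assms t tN in auto)
  have 2: "pruns (Op i (\<lambda>r. (3, Stay))) 0 (\<sigma>(i := (tape_of (replicate t 2 @ ys), Suc t)))
     (\<sigma>(i := (tape_of (lsb (Suc n)), Suc t)))"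
    by (rule pruns_Op) (use assms w in auto)
  have 3: "pruns (Home i) 4 (\<sigma>(i := (tape_of (lsb (Suc n)), Suc t))) \<sigma>'"
    by (rule pruns_Home[where p = "Suc t" and xs = "lsb (Suc n)"]) (use assms tN in auto)
  show ?thesis
    unfolding Inc_def by (rule pruns_mono[OF pruns_Seq[OF 1 pruns_Seq[OF 2 3]]]) simp
qed

end

section \<open>The listing machine\<close>

text \<open>The inner product modulo 2 of the binary digits of \<open>a\<close> and
  \<open>j\<close>, by recursion on the digits in the order in which the machine meets them.\<close>

fun par :: "nat \<Rightarrow> nat \<Rightarrow> bool" where
  "par a j = (if a = 0 then False else (odd a \<and> odd j) \<noteq> par (a div 2) (j div 2))"

declare par.simps [simp del]

lemma par_0 [simp]: "par 0 j = False"
  by (simp add: par.simps)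

lemma par_rec: "par a j = ((odd a \<and> odd j) \<noteq> par (a div 2) (j div 2))"
  by (cases "a = 0") (simp_all add: par.simps[of a])

text \<open>For an element \<open>u\<close> of \<open>P\<close>, \<open>rk P (Suc u)\<close> is its
  number, counted from 1. Counting from 1 makes every power of two up to the size of the set occur
  as a number, and these numbers pick out single digits of a mask.\<close>

definition rk :: "(nat \<Rightarrow> bool) \<Rightarrow> nat \<Rightarrow> nat" where
  "rk P i = card {u. u < i \<and> P u}"

lemma rk_Suc: "rk P (Suc i) = (if P i then Suc (rk P i) else rk P i)"
proof -
  have "{u. u < Suc i \<and> P u} = (if P i then insert i {u. u < i \<and> P u} else {u. u < i \<and> P u})"
    by (auto simp: less_Suc_eq)
  then show ?thesis by (auto simp: rk_def)
qed

lemma rk_0 [simp]: "rk P 0 = 0"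
  by (simp add: rk_def)

lemma rk_le: "rk P i \<le> i"
  by (induction i) (auto simp: rk_Suc)

text \<open>\<open>neg = False\<close> gives the odd side, which becomes the left factor of a
  rectangle, and \<open>neg = True\<close> the complementary even side.\<close>

definition side :: "bool \<Rightarrow> (nat \<Rightarrow> bool) \<Rightarrow> nat \<Rightarrow> nat \<Rightarrow> bool" where
  "side neg P a u \<longleftrightarrow> P u \<and> par a (rk P (Suc u)) \<noteq> neg"

definition lg :: "nat \<Rightarrow> nat" where
  "lg n = length (lsb n) - 1"

lemma length_lsb_lg: "n > 0 \<Longrightarrow> length (lsb n) = Suc (lg n)"
  unfolding lg_def by (subst (1 2) lsb.simps) simp

lemma lg_bounds: "n > 0 \<Longrightarrow> 2 ^ lg n \<le> n" "n > 0 \<Longrightarrow> n < 2 ^ Suc (lg n)"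
  using length_lsb[of n "lg n"] length_lsb[of n "Suc (lg n)"] length_lsb_lg[of n] by auto

lemma length_lsb_eq: "2 ^ k \<le> a \<Longrightarrow> a < 2 ^ Suc k \<Longrightarrow> length (lsb a) = Suc k"
  using length_lsb[of a k] length_lsb[of a "Suc k"] by linarith

lemma clean_bit_vector [simp]: "clean (bit_vector n P)"
  by (auto simp: clean_def bit_vector_def bit_sym_def)

lemma length_bit_vector [simp]: "length (bit_vector n P) = n"
  by (simp add: bit_vector_def)

text \<open>
  Tape 0 holds the input, tape 1 the colours, tape 2 the number \<open>q\<close> of vertices in use (plus one for
  the empty rectangle), tape 3 the number of the current neighbour, tape 4 the mask and tape 5 the
  output. Numbers are stored with the least significant digit first.
\<close>

definition Emit :: "((nat \<Rightarrow> symbol) \<Rightarrow> symbol) \<Rightarrow> cmd" where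
  "Emit f = Op 5 (\<lambda>r. (f r, Go_Right))"

definition Next_Row :: cmd where
  "Next_Row = While (\<lambda>r. r 0 \<noteq> 4) (Mv 0 Go_Right) ;; Mv 0 Go_Right"

text \<open>The initial move leaves the separator that ends the current row. The loop stops at the
  separator of the row before, or at the end marker if there is none.\<close>

definition Row_Start :: cmd where
  "Row_Start = Mv 0 Go_Left ;; While (\<lambda>r. r 0 \<noteq> 4 \<and> r 0 \<noteq> 1) (Mv 0 Go_Left) ;; Mv 0 Go_Right"

definition Copy_Row :: cmd where
  "Copy_Row = While (\<lambda>r. r 0 \<noteq> 4) (Op 1 (\<lambda>r. (r 0, Go_Right)) ;; Mv 0 Go_Right) ;; Home 1"

definition Count_Row :: cmd where
  "Count_Row = While (\<lambda>r. r 0 \<noteq> 4) (Cond (\<lambda>r. r 0 = 3) (Inc 3) Skip ;; Mv 0 Go_Right)"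

text \<open>The output cell that is about to be finished accumulates the parity.\<close>

definition Parity :: cmd where
  "Parity = While (\<lambda>r. r 4 \<noteq> 0)
     (Cond (\<lambda>r. r 4 = 3 \<and> r 3 = 3) (Op 5 (\<lambda>r. (if r 5 = 3 then 2 else 3, Stay))) Skip ;;
      Mv 4 Go_Right ;; Mv 3 Go_Right) ;; Home 4 ;; Home 3"

text \<open>The output cell starts as \<open>neg\<close> and is toggled by the inner product, so it
  ends as the bit that \<open>side neg\<close> prescribes. The counter on tape 3 supplies the number
  of the neighbour and is rebuilt on each traversal of the row.\<close>

definition Emit_Side :: "bool \<Rightarrow> cmd" where
  "Emit_Side neg = While (\<lambda>r. r 0 \<noteq> 4)
     (Cond (\<lambda>r. r 0 = 3)
        (Inc 3 ;; Op 5 (\<lambda>r. (bit_sym neg, Stay)) ;; Parity ;; Mv 5 Go_Right)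
        (Emit (\<lambda>r. 2)) ;;
      Mv 0 Go_Right) ;; Emit (\<lambda>r. 4) ;; Erase 3 ;; Row_Start"

text \<open>The stored number is read from right to left, which yields the most significant digit
  first, as the output format requires.\<close>

definition Emit_Count :: cmd where
  "Emit_Count = While (\<lambda>r. r 2 \<noteq> 0) (Mv 2 Go_Right) ;; Mv 2 Go_Left ;;
     While (\<lambda>r. r 2 \<noteq> 1) (Emit (\<lambda>r. r 2) ;; Mv 2 Go_Left) ;; Mv 2 Go_Right"

text \<open>A mask has \<open>k + 1\<close> digits, so it serves as a unary copy of \<open>k\<close>
  once its first cell is skipped.\<close>

definition Emit_Zeros :: cmd where
  "Emit_Zeros = Mv 4 Go_Right ;; While (\<lambda>r. r 4 \<noteq> 0) (Emit (\<lambda>r. 2) ;; Mv 4 Go_Right) ;; Home 4"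

text \<open>The mask overflows iff the carry reaches the blank; then the tape is erased, which ends the
  loop over the masks.\<close>

definition Next_Mask :: cmd where
  "Next_Mask = While (\<lambda>r. r 4 = 3) (Op 4 (\<lambda>r. (2, Go_Right))) ;;
     Cond (\<lambda>r. r 4 = 0) (Erase 4) (Op 4 (\<lambda>r. (3, Stay)) ;; Home 4)"

definition Emit_Entry :: cmd where
  "Emit_Entry = Emit_Side False ;; Emit_Side True ;; Emit (\<lambda>r. 3) ;; Emit (\<lambda>r. 4) ;;
     Emit_Count ;; Emit_Zeros ;; Emit (\<lambda>r. 4) ;; Next_Mask"

text \<open>A word of zeros as long as the number on tape 3, with its top digit turned into one: the
  least mask of that length.\<close>

definition Init_Mask :: cmd where
  "Init_Mask = While (\<lambda>r. r 3 \<noteq> 0) (Op 4 (\<lambda>r. (2, Go_Right)) ;; Mv 3 Go_Right) ;;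
     Mv 4 Go_Left ;; Op 4 (\<lambda>r. (3, Stay)) ;; Home 4 ;; Erase 3"

text \<open>A number on tape 3 is at least 4 iff its third digit is not blank.\<close>

definition Count_Good :: "bool \<Rightarrow> cmd" where
  "Count_Good b = While (\<lambda>r. r 1 \<noteq> 0)
     (Count_Row ;; Mv 3 Go_Right ;; Mv 3 Go_Right ;;
      Cond (\<lambda>r. r 1 = bit_sym b \<and> r 3 \<noteq> 0) (Inc 2) Skip ;;
      Erase 3 ;; Next_Row ;; Mv 1 Go_Right)"

definition List_Good :: "bool \<Rightarrow> cmd" where
  "List_Good b = While (\<lambda>r. r 1 \<noteq> 0)
     (Count_Row ;; Mv 3 Go_Right ;; Mv 3 Go_Right ;;
      Cond (\<lambda>r. r 1 = bit_sym b \<and> r 3 \<noteq> 0)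
        (Home 3 ;; Init_Mask ;; Row_Start ;; While (\<lambda>r. r 4 \<noteq> 0) Emit_Entry)
        (Erase 3) ;;
      Next_Row ;; Mv 1 Go_Right)"

definition Blank_Side :: cmd where
  "Blank_Side = While (\<lambda>r. r 1 \<noteq> 0) (Emit (\<lambda>r. 2) ;; Mv 1 Go_Right) ;; Home 1 ;; Emit (\<lambda>r. 4)"

text \<open>The input does not state \<open>m\<close>. Row 0 is copied to tape 1 as a yardstick of
  length \<open>m\<close>; advancing the input by one row per cell of it reaches row
  \<open>m\<close>, the colouring, which then overwrites the copy.\<close>

definition Load_Colors :: cmd where
  "Load_Colors =
     Mv 0 Go_Right ;; Mv 1 Go_Right ;; Mv 2 Go_Right ;; Mv 3 Go_Right ;; Mv 4 Go_Right ;;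
     Mv 5 Go_Right ;; Copy_Row ;; Home 0 ;;
     While (\<lambda>r. r 1 \<noteq> 0) (Next_Row ;; Mv 1 Go_Right) ;; Home 1 ;; Copy_Row ;; Home 0"

text \<open>Two passes over the vertices, because the number of vertices in use enters every
  denominator and must be known before the first entry is written. Its count starts at 1 on account
  of the empty rectangle.\<close>

definition Lister :: "bool \<Rightarrow> cmd" where
  "Lister b = Load_Colors ;; Op 2 (\<lambda>r. (3, Stay)) ;; Count_Good b ;; Home 1 ;; Home 0 ;;
     Blank_Side ;; Blank_Side ;; Emit (\<lambda>r. 3) ;; Emit (\<lambda>r. 4) ;; Emit_Count ;;
     Emit (\<lambda>r. 4) ;; List_Good b"

lemma wf_Lister: "wf_cmd (Lister b)"
  by (simp add: Lister_def Load_Colors_def Count_Good_def List_Good_def Blank_Side_def Emit_Entry_def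
      Init_Mask_def Next_Mask_def Emit_Zeros_def Emit_Count_def Emit_Side_def Parity_def
      Count_Row_def Copy_Row_def Row_Start_def Next_Row_def Emit_def Inc_def Erase_def Home_def Mv_def)

section \<open>Correctness of the listing program\<close>

text \<open>All that the program relies on in its input: \<open>m + 1\<close> rows of
  \<open>m\<close> bits with a separator each, row \<open>m\<close> being the colouring.
  \<open>N\<close> exceeds every position in these rows.\<close>

locale layout = clocked +
  fixes m :: nat and inp :: "symbol list" and R :: "nat \<Rightarrow> nat \<Rightarrow> bool"
  assumes clean_inp: "clean inp"
    and m_pos: "m > 0"
    and N_large: "Suc (Suc m * Suc m) \<le> N"
    and row_bit: "\<And>v u. v \<le> m \<Longrightarrow> u < m \<Longrightarrow> tape_of inp (Suc (v * Suc m) + u) = bit_sym (R v u)"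
    and row_sep: "\<And>v. v \<le> m \<Longrightarrow> tape_of inp (Suc (v * Suc m) + m) = 4"
begin

definition st :: "nat \<Rightarrow> nat" where
  "st v = Suc (v * Suc m)"

abbreviation I :: "nat \<Rightarrow> tape" where
  "I p \<equiv> (tape_of inp, p)"

abbreviation num :: "nat \<Rightarrow> tape" where
  "num n \<equiv> (tape_of (lsb n), Suc 0)"

lemma bit_st [simp]: "v \<le> m \<Longrightarrow> u < m \<Longrightarrow> tape_of inp (st v + u) = bit_sym (R v u)"
  and sep_st [simp]: "v \<le> m \<Longrightarrow> tape_of inp (st v + m) = 4"
  using row_bit row_sep by (auto simp: st_def)

lemma st_Suc: "Suc (st v + m) = st (Suc v)"
  by (simp add: st_def)

lemma st_less: "v \<le> m \<Longrightarrow> st v + m < N"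
proof -
  assume "v \<le> m"
  then have "v * Suc m \<le> m * Suc m" by (rule mult_le_mono1)
  then show ?thesis using N_large by (simp add: st_def)
qed

lemma m_less: "Suc (Suc m) < N"
  using N_large m_pos by (cases m) auto

lemma pruns_Emit:
  "f (reads (S t0 t1 t2 t3 t4 (out ys))) = x \<Longrightarrow>
   pruns (Emit f) 0 (S t0 t1 t2 t3 t4 (out ys)) (S t0 t1 t2 t3 t4 (out (ys @ [x])))"
  unfolding Emit_def by (rule pruns_Op) auto

lemma pruns_Next_Row:
  assumes "v \<le> m" "i \<le> m"
  shows "pruns Next_Row 4 (S (I (st v + i)) t1 t2 t3 t4 t5) (S (I (st (Suc v))) t1 t2 t3 t4 t5)"
proof -
  have 1: "pruns (While (\<lambda>r. r 0 \<noteq> 4) (Mv 0 Go_Right)) (0 + 3)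
     (S (I (st v + i)) t1 t2 t3 t4 t5) (S (I (st v + m)) t1 t2 t3 t4 t5)"
    by (rule pruns_While[where s = "\<lambda>n. S (I (st v + (i + n))) t1 t2 t3 t4 t5" and n = "m - i"])
      (use assms m_less in \<open>auto intro!: pruns_Mv\<close>)
  have 2: "pruns (Mv 0 Go_Right) 0 (S (I (st v + m)) t1 t2 t3 t4 t5) (S (I (st (Suc v))) t1 t2 t3 t4 t5)"
    by (rule pruns_Mv) (auto simp: st_Suc)
  show ?thesis
    unfolding Next_Row_def by (rule pruns_mono[OF pruns_Seq[OF 1 2]]) simp
qed

lemma pruns_Row_Start:
  assumes "v \<le> m"
  shows "pruns Row_Start 5 (S (I (st v + m)) t1 t2 t3 t4 t5) (S (I (st v)) t1 t2 t3 t4 t5)"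
proof -
  have b: "tape_of inp (v * Suc m) = 4 \<or> tape_of inp (v * Suc m) = 1"
  proof (cases v)
    case (Suc w)
    then have "v * Suc m = st w + m" by (simp add: st_def)
    then show ?thesis using sep_st[of w] assms Suc by (simp only: Suc_leD) simp
  qed simp
  have p: "st v + m - 1 - n = st v + (m - 1 - n)" if "n < m" for n using that by simp
  have 1: "pruns (Mv 0 Go_Left) 0 (S (I (st v + m)) t1 t2 t3 t4 t5) (S (I (st v + m - 1)) t1 t2 t3 t4 t5)"
    by (rule pruns_Mv) auto
  have 2: "pruns (While (\<lambda>r. r 0 \<noteq> 4 \<and> r 0 \<noteq> 1) (Mv 0 Go_Left)) (0 + 3)
     (S (I (st v + m - 1)) t1 t2 t3 t4 t5) (S (I (v * Suc m)) t1 t2 t3 t4 t5)"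
  proof (rule pruns_While[where s = "\<lambda>n. S (I (st v + m - 1 - n)) t1 t2 t3 t4 t5" and n = m])
    show "reads (S (I (st v + m - 1 - n)) t1 t2 t3 t4 t5) 0 \<noteq> 4 \<and>
      reads (S (I (st v + m - 1 - n)) t1 t2 t3 t4 t5) 0 \<noteq> 1" if "n < m" for n
    proof -
      have "tape_of inp (st v + m - 1 - n) = bit_sym (R v (m - 1 - n))"
        unfolding p[OF that] by (rule bit_st) (use assms that in auto)
      then show ?thesis by simp
    qed
    show "\<not> (reads (S (I (st v + m - 1 - m)) t1 t2 t3 t4 t5) 0 \<noteq> 4 \<and>
      reads (S (I (st v + m - 1 - m)) t1 t2 t3 t4 t5) 0 \<noteq> 1)"
      using b by (simp add: st_def)
  qed (use m_less in \<open>auto simp: st_def intro!: pruns_Mv\<close>)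
  have 3: "pruns (Mv 0 Go_Right) 0 (S (I (v * Suc m)) t1 t2 t3 t4 t5) (S (I (st v)) t1 t2 t3 t4 t5)"
    by (rule pruns_Mv) (auto simp: st_def)
  show ?thesis
    unfolding Row_Start_def by (rule pruns_mono[OF pruns_Seq[OF 1 pruns_Seq[OF 2 3]]]) simp
qed

lemma pruns_Copy_Row:
  assumes "v \<le> m" "length xs \<le> m" "clean xs"
  shows "pruns Copy_Row 5 (S (I (st v)) (tape_of xs, 1) t2 t3 t4 t5)
    (S (I (st v + m)) (tape_of (bit_vector m (R v)), 1) t2 t3 t4 t5)"
proof -
  \<comment> \<open>The first \<open>n\<close> cells are new and the rest is still old. As
    \<open>xs\<close> has at most \<open>m\<close> symbols, nothing of it is left at the
    end.\<close>
  let ?c = "\<lambda>n. map (\<lambda>u. bit_sym (R v u)) [0..<n] @ drop n xs"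
  let ?s = "\<lambda>n. S (I (st v + n)) (tape_of (?c n), Suc n) t2 t3 t4 t5"
  have w: "(tape_of (?c n))(Suc n := bit_sym (R v n)) = tape_of (?c (Suc n))" for n
  proof (cases "n < length xs")
    case True
    then have "drop n xs = xs ! n # drop (Suc n) xs" by (simp add: Cons_nth_drop_Suc)
    then show ?thesis
      using tape_of_write[of "map (\<lambda>u. bit_sym (R v u)) [0..<n]" "xs ! n" "drop (Suc n) xs"] by simp
  next
    case False
    then show ?thesis
      using tape_of_write_end[of "map (\<lambda>u. bit_sym (R v u)) [0..<n]"] by simp
  qed
  have 1: "pruns (While (\<lambda>r. r 0 \<noteq> 4) (Op 1 (\<lambda>r. (r 0, Go_Right)) ;; Mv 0 Go_Right)) (1 + 3)
     (?s 0) (?s m)"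
  proof (rule pruns_While[where s = ?s and n = m])
    fix n assume n: "n < m"
    have a: "pruns (Op 1 (\<lambda>r. (r 0, Go_Right))) 0 (?s n)
      (S (I (st v + n)) (tape_of (?c (Suc n)), Suc (Suc n)) t2 t3 t4 t5)"
      by (rule pruns_Op) (use n assms w in auto)
    have b: "pruns (Mv 0 Go_Right) 0 (S (I (st v + n)) (tape_of (?c (Suc n)), Suc (Suc n)) t2 t3 t4 t5) (?s (Suc n))"
      by (rule pruns_Mv) auto
    show "pruns (Op 1 (\<lambda>r. (r 0, Go_Right)) ;; Mv 0 Go_Right) 1 (?s n) (?s (Suc n))"
      using pruns_Seq[OF a b] by simp
  qed (use assms m_less in auto)
  have 2: "pruns (Home 1) 4 (?s m) (S (I (st v + m)) (tape_of (bit_vector m (R v)), 1) t2 t3 t4 t5)"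
    by (rule pruns_Home[where p = "Suc m" and xs = "bit_vector m (R v)"])
      (use assms m_less in \<open>auto simp: bit_vector_def clean_def bit_sym_def simp del: clean_bit_vector\<close>)
  show ?thesis
    unfolding Copy_Row_def using pruns_mono[OF pruns_Seq[OF 1 2]] by simp
qed

lemma pruns_Count_Row:
  assumes "v \<le> m"
  shows "pruns Count_Row 11 (S (I (st v)) t1 t2 (num 0) t4 t5) (S (I (st v + m)) t1 t2 (num (rk (R v) m)) t4 t5)"
proof -
  let ?s = "\<lambda>n. S (I (st v + n)) t1 t2 (num (rk (R v) n)) t4 t5"
  have "pruns Count_Row (8 + 3) (?s 0) (?s m)"
    unfolding Count_Row_def
  proof (rule pruns_While[where s = ?s and n = m])
    fix n assume n: "n < m"
    have a: "pruns (Cond (\<lambda>r. r 0 = 3) (Inc 3) Skip) 7 (?s n) (S (I (st v + n)) t1 t2 (num (rk (R v) (Suc n))) t4 t5)"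
    proof (cases "R v n")
      case True
      have "pruns (Inc 3) 6 (?s n) (S (I (st v + n)) t1 t2 (num (rk (R v) (Suc n))) t4 t5)"
        by (rule pruns_Inc[where n = "rk (R v) n"]) (use True m_less rk_le[of "R v" n] n in \<open>auto simp: rk_Suc\<close>)
      then show ?thesis
        using pruns_CondT[of "\<lambda>r. r 0 = 3" "?s n" "Inc 3" 6] True assms n by simp
    next
      case False
      have "pruns (Cond (\<lambda>r. r 0 = 3) (Inc 3) Skip) (Suc 0) (?s n) (S (I (st v + n)) t1 t2 (num (rk (R v) (Suc n))) t4 t5)"
        by (rule pruns_CondF) (use False assms n in \<open>auto simp: rk_Suc intro!: pruns_Skip\<close>)
      then show ?thesis by (rule pruns_mono) simp
    qed
    have b: "pruns (Mv 0 Go_Right) 0 (S (I (st v + n)) t1 t2 (num (rk (R v) (Suc n))) t4 t5) (?s (Suc n))"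
      by (rule pruns_Mv) auto
    show "pruns (Cond (\<lambda>r. r 0 = 3) (Inc 3) Skip ;; Mv 0 Go_Right) 8 (?s n) (?s (Suc n))"
      using pruns_Seq[OF a b] by simp
  qed (use assms m_less in auto)
  then show ?thesis by simp
qed

lemma pruns_Parity:
  assumes "length (lsb a) < N"
  shows "pruns Parity 8
    (S t0 t1 t2 (num j) (num a) (tape_of (ys @ [bit_sym x]), Suc (length ys)))
    (S t0 t1 t2 (num j) (num a) (tape_of (ys @ [bit_sym (x \<noteq> par a j)]), Suc (length ys)))"
proof -
  \<comment> \<open>The contribution of the first \<open>n\<close> digits, written as the difference
    between the full inner product and that of the remaining digits, so that \<open>par_rec\<close>
    performs one round.\<close>
  let ?x = "\<lambda>n. x \<noteq> (par a j \<noteq> par (a div 2 ^ n) (j div 2 ^ n))"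
  let ?o = "\<lambda>n. (tape_of (ys @ [bit_sym (?x n)]), Suc (length ys))"
  let ?s = "\<lambda>n. S t0 t1 t2 (tape_of (lsb j), Suc n) (tape_of (lsb a), Suc n) (?o n)"
  let ?l = "length (lsb a)"
  have st: "par (a div 2 ^ n) (j div 2 ^ n) =
     ((odd (a div 2 ^ n) \<and> odd (j div 2 ^ n)) \<noteq> par (a div 2 ^ Suc n) (j div 2 ^ Suc n))" for n
    by (subst par_rec) (simp only: power_Suc2 div_mult2_eq)
  have nz: "a div 2 ^ n \<noteq> 0" if "n < ?l" for n
    using that length_lsb[of a n] by (simp add: div_eq_0_iff)
  have z: "a div 2 ^ ?l = 0"
    using length_lsb[of a ?l] by simp
  have 1: "pruns (While (\<lambda>r. r 4 \<noteq> 0)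
     (Cond (\<lambda>r. r 4 = 3 \<and> r 3 = 3) (Op 5 (\<lambda>r. (if r 5 = 3 then 2 else 3, Stay))) Skip ;;
      Mv 4 Go_Right ;; Mv 3 Go_Right)) (2 + 3) (?s 0) (?s ?l)"
  proof (rule pruns_While[where s = ?s and n = ?l])
    fix n assume n: "n < ?l"
    let ?t = "S t0 t1 t2 (tape_of (lsb j), Suc n) (tape_of (lsb a), Suc n) (?o (Suc n))"
    let ?c = "Cond (\<lambda>r. r 4 = 3 \<and> r 3 = 3) (Op 5 (\<lambda>r. (if r 5 = 3 then 2 else 3, Stay))) Skip"
    have a: "pruns ?c 1 (?s n) ?t"
    proof (cases "odd (a div 2 ^ n) \<and> odd (j div 2 ^ n)")
      case True
      then have jz: "j div 2 ^ n \<noteq> 0" by (metis even_zero)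
      have x: "?x (Suc n) = (\<not> ?x n)" using st[of n] True by blast
      have o: "pruns (Op 5 (\<lambda>r. (if r 5 = 3 then 2 else 3, Stay))) 0 (?s n) ?t"
        by (rule pruns_Op) (use x in \<open>auto simp: bit_sym_def\<close>)
      have c: "reads (?s n) 4 = 3 \<and> reads (?s n) 3 = 3"
        using True jz nz[OF n] by (simp add: tape_lsb)
      show ?thesis using pruns_CondT[OF _ o, of "\<lambda>r. r 4 = 3 \<and> r 3 = 3"] c by simp
    next
      case False
      then have x: "?x (Suc n) = ?x n" using st[of n] by blast
      have o: "pruns Skip 0 (?s n) ?t"
        by (rule pruns_Skip) (simp only: x)
      have c: "\<not> (reads (?s n) 4 = 3 \<and> reads (?s n) 3 = 3)"
        using False nz[OF n] by (auto simp: tape_lsb)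
      show ?thesis using pruns_CondF[OF _ o, of "\<lambda>r. r 4 = 3 \<and> r 3 = 3"] c by simp
    qed
    have b: "pruns (Mv 4 Go_Right) 0 ?t (S t0 t1 t2 (tape_of (lsb j), Suc n) (tape_of (lsb a), Suc (Suc n)) (?o (Suc n)))"
      by (rule pruns_Mv) auto
    have c: "pruns (Mv 3 Go_Right) 0 (S t0 t1 t2 (tape_of (lsb j), Suc n) (tape_of (lsb a), Suc (Suc n)) (?o (Suc n))) (?s (Suc n))"
      by (rule pruns_Mv) auto
    show "pruns (?c ;; Mv 4 Go_Right ;; Mv 3 Go_Right) 2 (?s n) (?s (Suc n))"
      using pruns_Seq[OF a pruns_Seq[OF b c]] by (simp add: numeral_2_eq_2)
  qed (use assms nz z in \<open>auto simp: tape_lsb\<close>)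
  have 2: "pruns (Home 4) 4 (?s ?l) (S t0 t1 t2 (tape_of (lsb j), Suc ?l) (num a) (?o ?l))"
    by (rule pruns_Home[where p = "Suc ?l" and xs = "lsb a"]) (use assms in auto)
  have 3: "pruns (Home 3) 4 (S t0 t1 t2 (tape_of (lsb j), Suc ?l) (num a) (?o ?l)) (S t0 t1 t2 (num j) (num a) (?o ?l))"
    by (rule pruns_Home[where p = "Suc ?l" and xs = "lsb j"]) (use assms in auto)
  have "pruns Parity 8 (?s 0) (S t0 t1 t2 (num j) (num a) (?o ?l))"
    unfolding Parity_def by (rule pruns_mono[OF pruns_Seq[OF 1 pruns_Seq[OF 2 3]]]) simp
  then show ?thesis using z by simp
qed

lemma pruns_Emit_Side:
  assumes "v \<le> m" "length (lsb a) < N"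
  shows "pruns (Emit_Side neg) 20 (S (I (st v)) t1 t2 (num 0) (num a) (out ys))
    (S (I (st v)) t1 t2 (num 0) (num a) (out (ys @ bit_vector m (side neg (R v) a) @ [4])))"
proof -
  let ?o = "\<lambda>n. ys @ map (\<lambda>u. bit_sym (side neg (R v) a u)) [0..<n]"
  let ?s = "\<lambda>n. S (I (st v + n)) t1 t2 (num (rk (R v) n)) (num a) (out (?o n))"
  let ?c = "Cond (\<lambda>r. r 0 = 3)
        (Inc 3 ;; Op 5 (\<lambda>r. (bit_sym neg, Stay)) ;; Parity ;; Mv 5 Go_Right)
        (Emit (\<lambda>r. 2))"
  have 1: "pruns (While (\<lambda>r. r 0 \<noteq> 4) (?c ;; Mv 0 Go_Right)) (13 + 3) (?s 0) (?s m)"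
  proof (rule pruns_While[where s = ?s and n = m])
    fix n assume n: "n < m"
    let ?t = "S (I (st v + n)) t1 t2 (num (rk (R v) (Suc n))) (num a) (out (?o (Suc n)))"
    have x: "pruns ?c 12 (?s n) ?t"
    proof (cases "R v n")
      case True
      let ?k = "rk (R v) (Suc n)"
      have a: "pruns (Inc 3) 6 (?s n) (S (I (st v + n)) t1 t2 (num ?k) (num a) (out (?o n)))"
        by (rule pruns_Inc[where n = "rk (R v) n"]) (use True m_less rk_le[of "R v" n] n in \<open>auto simp: rk_Suc\<close>)
      have b: "pruns (Op 5 (\<lambda>r. (bit_sym neg, Stay))) 0 (S (I (st v + n)) t1 t2 (num ?k) (num a) (out (?o n)))
         (S (I (st v + n)) t1 t2 (num ?k) (num a) (tape_of (?o n @ [bit_sym neg]), Suc (length (?o n))))"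
        by (rule pruns_Op) (auto simp only: reads_S S_simps act_simps tape_of_write_end S_upd)
      have c: "pruns Parity 8
         (S (I (st v + n)) t1 t2 (num ?k) (num a) (tape_of (?o n @ [bit_sym neg]), Suc (length (?o n))))
         (S (I (st v + n)) t1 t2 (num ?k) (num a) (tape_of (?o n @ [bit_sym (neg \<noteq> par a ?k)]), Suc (length (?o n))))"
        by (rule pruns_Parity) (use assms in auto)
      have d: "pruns (Mv 5 Go_Right) 0
         (S (I (st v + n)) t1 t2 (num ?k) (num a) (tape_of (?o n @ [bit_sym (neg \<noteq> par a ?k)]), Suc (length (?o n)))) ?t"
        by (rule pruns_Mv) (use True in \<open>auto simp: side_def eq_commute[of neg]\<close>)
      show ?thesis
        by (rule pruns_mono[OF pruns_CondT[OF _ pruns_Seq[OF a pruns_Seq[OF b pruns_Seq[OF c d]]]]])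
          (use assms n True in auto)
    next
      case False
      have a: "pruns (Emit (\<lambda>r. 2)) 0 (?s n) ?t"
        using pruns_Emit[of "\<lambda>r. 2" "I (st v + n)" t1 t2 "num (rk (R v) n)" "num a" "?o n" 2] False
        by (simp add: side_def rk_Suc)
      show ?thesis
        by (rule pruns_mono[OF pruns_CondF[OF _ a]]) (use assms n False in auto)
    qed
    have y: "pruns (Mv 0 Go_Right) 0 ?t (?s (Suc n))"
      by (rule pruns_Mv) auto
    show "pruns (?c ;; Mv 0 Go_Right) 13 (?s n) (?s (Suc n))"
      using pruns_Seq[OF x y] by simp
  qed (use assms m_less in auto)
  let ?z = "ys @ bit_vector m (side neg (R v) a) @ [4]"
  have 2: "pruns (Emit (\<lambda>r. 4)) 0 (?s m) (S (I (st v + m)) t1 t2 (num (rk (R v) m)) (num a) (out ?z))"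
    using pruns_Emit[of "\<lambda>r. 4" "I (st v + m)" t1 t2 "num (rk (R v) m)" "num a" "?o m" 4]
    by (simp add: bit_vector_def)
  have 3: "pruns (Erase 3) 6 (S (I (st v + m)) t1 t2 (num (rk (R v) m)) (num a) (out ?z))
     (S (I (st v + m)) t1 t2 (num 0) (num a) (out ?z))"
    by (rule pruns_Erase[where xs = "lsb (rk (R v) m)" and p = 1])
      (use m_less rk_le[of "R v" m] length_lsb_le[of "rk (R v) m"] in auto)
  have "pruns (Emit_Side neg) 20 (?s 0) (S (I (st v)) t1 t2 (num 0) (num a) (out ?z))"
    unfolding Emit_Side_def
    by (rule pruns_mono[OF pruns_Seq[OF 1 pruns_Seq[OF 2 pruns_Seq[OF 3 pruns_Row_Start[OF assms(1)]]]]]) simp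
  then show ?thesis by simp
qed

lemma pruns_Emit_Count:
  assumes "length (lsb q) < N"
  shows "pruns Emit_Count 7 (S t0 t1 (num q) t3 t4 (out ys)) (S t0 t1 (num q) t3 t4 (out (ys @ rev (lsb q))))"
proof -
  let ?l = "length (lsb q)"
  let ?T = "\<lambda>p. (tape_of (lsb q), p)"
  have 1: "pruns (While (\<lambda>r. r 2 \<noteq> 0) (Mv 2 Go_Right)) (0 + 3) (S t0 t1 (num q) t3 t4 (out ys))
     (S t0 t1 (?T (Suc ?l)) t3 t4 (out ys))"
    by (rule pruns_While[where s = "\<lambda>n. S t0 t1 (?T (Suc n)) t3 t4 (out ys)" and n = ?l])
      (use assms in \<open>auto simp: tape_of_eq_0 intro!: pruns_Mv\<close>)
  have 2: "pruns (Mv 2 Go_Left) 0 (S t0 t1 (?T (Suc ?l)) t3 t4 (out ys)) (S t0 t1 (?T ?l) t3 t4 (out ys))"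
    by (rule pruns_Mv) auto
  let ?s = "\<lambda>n. S t0 t1 (?T (?l - n)) t3 t4 (out (ys @ take n (rev (lsb q))))"
  have 3: "pruns (While (\<lambda>r. r 2 \<noteq> 1) (Emit (\<lambda>r. r 2) ;; Mv 2 Go_Left)) (1 + 3) (?s 0) (?s ?l)"
  proof (rule pruns_While[where s = ?s and n = ?l])
    fix n assume n: "n < ?l"
    let ?o = "out (ys @ take (Suc n) (rev (lsb q)))"
    have "tape_of (lsb q) (?l - n) = rev (lsb q) ! n"
      using n by (simp add: tape_of_def rev_nth)
    then have a: "pruns (Emit (\<lambda>r. r 2)) 0 (?s n) (S t0 t1 (?T (?l - n)) t3 t4 ?o)"
      using pruns_Emit[of "\<lambda>r. r 2" t0 t1 "?T (?l - n)" t3 t4 "ys @ take n (rev (lsb q))"] n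
      by (simp add: take_Suc_conv_app_nth)
    have b: "pruns (Mv 2 Go_Left) 0 (S t0 t1 (?T (?l - n)) t3 t4 ?o) (?s (Suc n))"
      by (rule pruns_Mv) auto
    show "pruns (Emit (\<lambda>r. r 2) ;; Mv 2 Go_Left) 1 (?s n) (?s (Suc n))"
      using pruns_Seq[OF a b] by simp
  qed (use assms in \<open>auto simp: tape_of_eq_1\<close>)
  have 4: "pruns (Mv 2 Go_Right) 0 (?s ?l) (S t0 t1 (num q) t3 t4 (out (ys @ rev (lsb q))))"
    by (rule pruns_Mv) auto
  have r3: "pruns (While (\<lambda>r. r 2 \<noteq> 1) (Emit (\<lambda>r. r 2) ;; Mv 2 Go_Left)) 4
     (S t0 t1 (?T ?l) t3 t4 (out ys)) (?s ?l)"
    using 3 by simp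
  show ?thesis
    unfolding Emit_Count_def
    by (rule pruns_mono[OF pruns_Seq[OF 1 pruns_Seq[OF 2 pruns_Seq[OF r3 4]]]]) simp
qed

lemma pruns_Emit_Zeros:
  assumes "length (lsb a) = Suc k" "Suc k < N"
  shows "pruns Emit_Zeros 6 (S t0 t1 t2 t3 (num a) (out ys)) (S t0 t1 t2 t3 (num a) (out (ys @ replicate k 2)))"
proof -
  let ?s = "\<lambda>n. S t0 t1 t2 t3 (tape_of (lsb a), Suc (Suc n)) (out (ys @ replicate n 2))"
  have 1: "pruns (Mv 4 Go_Right) 0 (S t0 t1 t2 t3 (num a) (out ys)) (?s 0)"
    by (rule pruns_Mv) auto
  have 2: "pruns (While (\<lambda>r. r 4 \<noteq> 0) (Emit (\<lambda>r. 2) ;; Mv 4 Go_Right)) (1 + 3) (?s 0) (?s k)"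
  proof (rule pruns_While[where s = ?s and n = k])
    fix n assume n: "n < k"
    let ?t = "S t0 t1 t2 t3 (tape_of (lsb a), Suc (Suc n)) (out (ys @ replicate (Suc n) 2))"
    have a: "pruns (Emit (\<lambda>r. 2)) 0 (?s n) ?t"
      using pruns_Emit[of "\<lambda>r. 2" t0 t1 t2 t3 "(tape_of (lsb a), Suc (Suc n))" "ys @ replicate n 2"]
      by (simp add: replicate_append_same)
    have b: "pruns (Mv 4 Go_Right) 0 ?t (?s (Suc n))"
      by (rule pruns_Mv) auto
    show "pruns (Emit (\<lambda>r. 2) ;; Mv 4 Go_Right) 1 (?s n) (?s (Suc n))"
      using pruns_Seq[OF a b] by simp
  qed (use assms in \<open>auto simp: tape_of_eq_0\<close>)
  have 3: "pruns (Home 4) 4 (?s k) (S t0 t1 t2 t3 (num a) (out (ys @ replicate k 2)))"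
    by (rule pruns_Home[where p = "Suc (Suc k)" and xs = "lsb a"]) (use assms in auto)
  show ?thesis
    unfolding Emit_Zeros_def
    by (rule pruns_mono[OF pruns_Seq[OF 1 pruns_Seq[OF 2 3]]]) simp
qed

lemma pruns_Next_Mask:
  assumes "2 ^ k \<le> a" "a < 2 ^ Suc k" "Suc (Suc k) \<le> N"
  shows "pruns Next_Mask 8 (S t0 t1 t2 t3 (num a) t5)
    (S t0 t1 t2 t3 (num (if Suc a < 2 ^ Suc k then Suc a else 0)) t5)"
proof -
  obtain t ys where t: "lsb a = replicate t 3 @ ys" "ys = [] \<or> hd ys = 2"
    "lsb (Suc a) = replicate t 2 @ 3 # tl ys" using lsb_Suc .
  have len: "t + length ys = Suc k"
    using length_lsb_eq[OF assms(1,2)] t(1) by simp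
  let ?t = "S t0 t1 t2 t3 (tape_of (replicate t 2 @ ys), Suc t) t5"
  have cl: "clean ys" using clean_lsb[of a] t(1) by simp
  have 1: "pruns (While (\<lambda>r. r 4 = 3) (Op 4 (\<lambda>r. (2, Go_Right)))) 3 (S t0 t1 t2 t3 (num a) t5) ?t"
    by (rule pruns_carry[where t = t and ys = ys]) (use assms t len in auto)
  have 2: "pruns (Cond (\<lambda>r. r 4 = 0) (Erase 4) (Op 4 (\<lambda>r. (3, Stay)) ;; Home 4)) 7 ?t
    (S t0 t1 t2 t3 (num (if Suc a < 2 ^ Suc k then Suc a else 0)) t5)"
  proof (cases ys)
    case Nil
    then have "\<not> Suc a < 2 ^ Suc k"
      using t(3) len length_lsb[of "Suc a" "Suc k"] by simp
    then have e: "pruns (Erase 4) 6 ?t (S t0 t1 t2 t3 (num (if Suc a < 2 ^ Suc k then Suc a else 0)) t5)"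
      by (intro pruns_Erase[where p = "Suc t" and xs = "replicate t 2"]) (use Nil len assms in auto)
    show ?thesis
      by (rule pruns_mono[OF pruns_CondT[OF _ e]])
        (use Nil tape_of_end[of "replicate t 2"] in \<open>auto simp del: tape_of_end\<close>)
  next
    case (Cons y zs)
    then have "length (lsb (Suc a)) = Suc k" using t(3) len by simp
    then have su: "Suc a < 2 ^ Suc k" using length_lsb[of "Suc a" "Suc k"] by simp
    have a: "pruns (Op 4 (\<lambda>r. (3, Stay))) 0 ?t (S t0 t1 t2 t3 (tape_of (lsb (Suc a)), Suc t) t5)"
      by (rule pruns_Op) (use Cons t(3) tape_of_write[of "replicate t 2" y zs 3] in auto)
    have b: "pruns (Home 4) 4 (S t0 t1 t2 t3 (tape_of (lsb (Suc a)), Suc t) t5)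
       (S t0 t1 t2 t3 (num (if Suc a < 2 ^ Suc k then Suc a else 0)) t5)"
      by (rule pruns_Home[where p = "Suc t" and xs = "lsb (Suc a)"]) (use su len assms in auto)
    show ?thesis
      by (rule pruns_mono[OF pruns_CondF[OF _ pruns_Seq[OF a b]]])
        (use Cons cl tape_of_read[of "replicate t 2" y zs] in auto)
  qed
  show ?thesis
    unfolding Next_Mask_def by (rule pruns_mono[OF pruns_Seq[OF 1 2]]) simp
qed

definition entry :: "nat \<Rightarrow> nat \<Rightarrow> nat \<Rightarrow> nat \<Rightarrow> symbol list" where
  "entry q k v a = bit_vector m (side False (R v) a) @ [4] @ bit_vector m (side True (R v) a) @ [4] @
     [3, 4] @ rev (lsb q) @ replicate k 2 @ [4]"

lemma pruns_Emit_Entry: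
  assumes "v \<le> m" "2 ^ k \<le> a" "a < 2 ^ Suc k" "Suc (Suc k) \<le> N" "length (lsb q) < N"
  shows "pruns Emit_Entry 28 (S (I (st v)) t1 (num q) (num 0) (num a) (out ys))
    (S (I (st v)) t1 (num q) (num 0) (num (if Suc a < 2 ^ Suc k then Suc a else 0))
      (out (ys @ entry q k v a)))"
proof -
  note len = length_lsb_eq[OF assms(2,3)]
  let ?s = "\<lambda>ys. S (I (st v)) t1 (num q) (num 0) (num a) (out ys)"
  let ?y1 = "ys @ bit_vector m (side False (R v) a) @ [4]"
  let ?y2 = "?y1 @ bit_vector m (side True (R v) a) @ [4]"
  let ?y3 = "(?y2 @ [3]) @ [4]"
  let ?y4 = "?y3 @ rev (lsb q)"
  let ?y5 = "?y4 @ replicate k 2"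
  have l: "length (lsb a) < N" using len assms by simp
  note 1 = pruns_Emit_Side[OF assms(1) l, of False t1 "num q" ys]
  note 2 = pruns_Emit_Side[OF assms(1) l, of True t1 "num q" ?y1]
  note 3 = pruns_Emit[of "\<lambda>r. 3" "I (st v)" t1 "num q" "num 0" "num a" ?y2 3, OF refl]
  note 4 = pruns_Emit[of "\<lambda>r. 4" "I (st v)" t1 "num q" "num 0" "num a" "?y2 @ [3]" 4, OF refl]
  note 5 = pruns_Emit_Count[OF assms(5), of "I (st v)" t1 "num 0" "num a" ?y3]
  have 6: "pruns Emit_Zeros 6 (?s ?y4) (?s ?y5)"
    by (rule pruns_Emit_Zeros) (use len assms in auto)
  note 7 = pruns_Emit[of "\<lambda>r. 4" "I (st v)" t1 "num q" "num 0" "num a" ?y5 4, OF refl]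
  note 8 = pruns_Next_Mask[OF assms(2-4), of "I (st v)" t1 "num q" "num 0" "out (?y5 @ [4])"]
  have "pruns Emit_Entry 28 (?s ys) (S (I (st v)) t1 (num q) (num 0) (num (if Suc a < 2 ^ Suc k then Suc a else 0))
     (out (?y5 @ [4])))"
    unfolding Emit_Entry_def
    by (rule pruns_mono[OF pruns_Seq[OF 1 pruns_Seq[OF 2 pruns_Seq[OF 3 pruns_Seq[OF 4
       pruns_Seq[OF 5 pruns_Seq[OF 6 pruns_Seq[OF 7 8]]]]]]]]) simp
  then show ?thesis by (simp add: entry_def)
qed

lemma pruns_Init_Mask:
  assumes "n > 0" "n < N"
  shows "pruns Init_Mask 10 (S t0 t1 t2 (num n) (num 0) t5) (S t0 t1 t2 (num 0) (num (2 ^ lg n)) t5)"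
proof -
  let ?l = "length (lsb n)" and ?k = "lg n"
  note len = length_lsb_lg[OF assms(1)]
  have lN: "?l \<le> n" by (rule length_lsb_le)
  let ?s = "\<lambda>i. S t0 t1 t2 (tape_of (lsb n), Suc i) (out (replicate i 2)) t5"
  have 1: "pruns (While (\<lambda>r. r 3 \<noteq> 0) (Op 4 (\<lambda>r. (2, Go_Right)) ;; Mv 3 Go_Right)) (1 + 3) (?s 0) (?s ?l)"
  proof (rule pruns_While[where s = ?s and n = ?l])
    fix i assume i: "i < ?l"
    let ?t = "S t0 t1 t2 (tape_of (lsb n), Suc i) (out (replicate (Suc i) 2)) t5"
    have a: "pruns (Op 4 (\<lambda>r. (2, Go_Right))) 0 (?s i) ?t"
      by (rule pruns_Op) (use tape_of_write_end[of "replicate i 2" 2] in \<open>auto simp: replicate_append_same simp del: tape_of_write_end\<close>)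
    have b: "pruns (Mv 3 Go_Right) 0 ?t (?s (Suc i))"
      by (rule pruns_Mv) auto
    show "pruns (Op 4 (\<lambda>r. (2, Go_Right)) ;; Mv 3 Go_Right) 1 (?s i) (?s (Suc i))"
      using pruns_Seq[OF a b] by simp
  qed (use assms lN in \<open>auto simp: tape_of_eq_0\<close>)
  let ?J = "(tape_of (lsb n), Suc ?l)"
  have 2: "pruns (Mv 4 Go_Left) 0 (?s ?l) (S t0 t1 t2 ?J (tape_of (replicate ?k 2 @ [2]), Suc ?k) t5)"
    by (rule pruns_Mv) (auto simp: len replicate_append_same)
  have 3: "pruns (Op 4 (\<lambda>r. (3, Stay))) 0 (S t0 t1 t2 ?J (tape_of (replicate ?k 2 @ [2]), Suc ?k) t5)
     (S t0 t1 t2 ?J (tape_of (lsb (2 ^ ?k)), Suc ?k) t5)"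
    by (rule pruns_Op) (use tape_of_write[of "replicate ?k 2" 2 "[]" 3] in \<open>auto simp: lsb_pow2\<close>)
  have 4: "pruns (Home 4) 4 (S t0 t1 t2 ?J (tape_of (lsb (2 ^ ?k)), Suc ?k) t5) (S t0 t1 t2 ?J (num (2 ^ ?k)) t5)"
    by (rule pruns_Home[where p = "Suc ?k" and xs = "lsb (2 ^ ?k)"]) (use len lN assms in auto)
  have 5: "pruns (Erase 3) 6 (S t0 t1 t2 ?J (num (2 ^ ?k)) t5) (S t0 t1 t2 (num 0) (num (2 ^ ?k)) t5)"
    by (rule pruns_Erase[where p = "Suc ?l" and xs = "lsb n"]) (use lN assms in auto)
  have "pruns Init_Mask 10 (?s 0) (S t0 t1 t2 (num 0) (num (2 ^ ?k)) t5)"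
    unfolding Init_Mask_def
    by (rule pruns_mono[OF pruns_Seq[OF 1 pruns_Seq[OF 2 pruns_Seq[OF 3 pruns_Seq[OF 4 5]]]]]) simp
  then show ?thesis by simp
qed

text \<open>The neighbours numbered 1, 2 and 3 will make the even side nonempty. The bound is the
  next power of two, which the machine can recognise from the number of digits.\<close>

definition good :: "bool \<Rightarrow> nat \<Rightarrow> bool" where
  "good b v \<longleftrightarrow> R m v = b \<and> 4 \<le> rk (R v) m"

abbreviation gc :: "bool \<Rightarrow> nat \<Rightarrow> nat" where
  "gc b \<equiv> rk (good b)"

abbreviation col :: "nat \<Rightarrow> tape" where
  "col p \<equiv> (tape_of (bit_vector m (R m)), p)"

lemma col_read: "v < m \<Longrightarrow> tape_of (bit_vector m (R m)) (Suc v) = bit_sym (R m v)"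
  "tape_of (bit_vector m (R m)) (Suc m) = 0"
  by (auto simp: tape_of_def bit_vector_def)

lemma test_good:
  "v < m \<Longrightarrow> tape_of (bit_vector m (R m)) (Suc v) = bit_sym b \<and> tape_of (lsb (rk (R v) m)) 3 \<noteq> 0 \<longleftrightarrow> good b v"
  using length_lsb[of "rk (R v) m" 2] by (auto simp: col_read good_def tape_of_eq_0)

text \<open>The common beginning of both passes, with an arbitrary continuation
  \<open>c\<close>.\<close>

lemma pruns_Test:
  assumes "v < m" "pruns c e (S (I (st v + m)) t1 t2 (tape_of (lsb (rk (R v) m)), 3) t4 t5) \<sigma>"
  shows "pruns (Count_Row ;; Mv 3 Go_Right ;; Mv 3 Go_Right ;; c) (Suc (max 11 (Suc (Suc e))))
     (S (I (st v)) t1 t2 (num 0) t4 t5) \<sigma>"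
proof -
  have 2: "pruns (Mv 3 Go_Right) 0 (S (I (st v + m)) t1 t2 (num (rk (R v) m)) t4 t5)
    (S (I (st v + m)) t1 t2 (tape_of (lsb (rk (R v) m)), 2) t4 t5)"
    by (rule pruns_Mv) (auto simp: numeral_2_eq_2)
  have 3: "pruns (Mv 3 Go_Right) 0 (S (I (st v + m)) t1 t2 (tape_of (lsb (rk (R v) m)), 2) t4 t5)
    (S (I (st v + m)) t1 t2 (tape_of (lsb (rk (R v) m)), 3) t4 t5)"
    by (rule pruns_Mv) auto
  show ?thesis
    using pruns_Seq[OF pruns_Count_Row pruns_Seq[OF 2 pruns_Seq[OF 3 assms(2)]]] assms(1) by simp
qed

lemma rk_bounds: "rk (R v) m < N" "length (lsb (rk (R v) m)) < N"
  using rk_le[of "R v" m] length_lsb_le[of "rk (R v) m"] m_less by linarith+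

lemma pruns_Count_Good:
  "pruns (Count_Good b) 18 (S (I (st 0)) (col 1) (num 1) (num 0) t4 t5)
    (S (I (st m)) (col (Suc m)) (num (Suc (gc b m))) (num 0) t4 t5)"
proof -
  let ?s = "\<lambda>v. S (I (st v)) (col (Suc v)) (num (Suc (gc b v))) (num 0) t4 t5"
  have "pruns (Count_Good b) (15 + 3) (?s 0) (?s m)"
    unfolding Count_Good_def
  proof (rule pruns_While[where s = ?s and n = m])
    fix v assume v: "v < m"
    let ?J = "(tape_of (lsb (rk (R v) m)), 3)"
    let ?c = "Cond (\<lambda>r. r 1 = bit_sym b \<and> r 3 \<noteq> 0) (Inc 2) Skip"
    let ?t = "\<lambda>v J. S (I (st v + m)) (col (Suc v)) (num (Suc (gc b (Suc v)))) J t4 t5"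
    have 1: "pruns ?c 7 (S (I (st v + m)) (col (Suc v)) (num (Suc (gc b v))) ?J t4 t5) (?t v ?J)"
    proof (cases "good b v")
      case True
      have a: "pruns (Inc 2) 6 (S (I (st v + m)) (col (Suc v)) (num (Suc (gc b v))) ?J t4 t5) (?t v ?J)"
        by (rule pruns_Inc[where n = "Suc (gc b v)"])
          (use True v rk_le[of "good b" v] m_less in \<open>auto simp: rk_Suc\<close>)
      show ?thesis
        by (rule pruns_mono[OF pruns_CondT[OF _ a]]) (use test_good[OF v, of b] True in auto)
    next
      case False
      have a: "pruns Skip 0 (S (I (st v + m)) (col (Suc v)) (num (Suc (gc b v))) ?J t4 t5) (?t v ?J)"
        by (rule pruns_Skip) (use False in \<open>simp add: rk_Suc\<close>)
      show ?thesis
        by (rule pruns_mono[OF pruns_CondF[OF _ a]]) (use test_good[OF v, of b] False in auto)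
    qed
    have 2: "pruns (Erase 3) 6 (?t v ?J) (?t v (num 0))"
      by (rule pruns_Erase[where xs = "lsb (rk (R v) m)" and p = 3])
        (use rk_bounds N_ge in auto)
    have 3: "pruns Next_Row 4 (?t v (num 0))
      (S (I (st (Suc v))) (col (Suc v)) (num (Suc (gc b (Suc v)))) (num 0) t4 t5)"
      by (rule pruns_Next_Row) (use v in auto)
    have 4: "pruns (Mv 1 Go_Right) 0
      (S (I (st (Suc v))) (col (Suc v)) (num (Suc (gc b (Suc v)))) (num 0) t4 t5) (?s (Suc v))"
      by (rule pruns_Mv) auto
    show "pruns (Count_Row ;; Mv 3 Go_Right ;; Mv 3 Go_Right ;; ?c ;;
      Erase 3 ;; Next_Row ;; Mv 1 Go_Right) 15 (?s v) (?s (Suc v))"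
      by (rule pruns_mono[OF pruns_Test[OF v pruns_Seq[OF 1 pruns_Seq[OF 2 pruns_Seq[OF 3 4]]]]]) simp
  qed (use m_less in \<open>auto simp: col_read\<close>)
  then show ?thesis by simp
qed

definition entries :: "bool \<Rightarrow> nat \<Rightarrow> nat \<Rightarrow> symbol list" where
  "entries b q v = (if good b v
     then let k = lg (rk (R v) m) in concat (map (entry q k v) [2 ^ k..<2 ^ Suc k]) else [])"

text \<open>The loop fits the clock because its \<open>2 ^ k\<close> rounds are at most as many as
  the vertex has neighbours.\<close>

lemma pruns_entries:
  assumes "v \<le> m" "4 \<le> rk (R v) m" "k = lg (rk (R v) m)" "length (lsb q) < N"
  shows "pruns (While (\<lambda>r. r 4 \<noteq> 0) Emit_Entry) 31
    (S (I (st v)) t1 (num q) (num 0) (num (2 ^ k)) (out ys))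
    (S (I (st v)) t1 (num q) (num 0) (num 0) (out (ys @ concat (map (entry q k v) [2 ^ k..<2 ^ Suc k]))))"
proof -
  have k: "2 ^ k \<le> rk (R v) m" "rk (R v) m < 2 ^ Suc k" "Suc k \<le> rk (R v) m"
    using lg_bounds[of "rk (R v) m"] length_lsb_lg[of "rk (R v) m"] length_lsb_le[of "rk (R v) m"] assms by auto
  \<comment> \<open>After the last round the mask has overflowed and been erased, hence the value 0,
    which ends the loop.\<close>
  let ?s = "\<lambda>i. S (I (st v)) t1 (num q) (num 0) (num (if i < 2 ^ k then 2 ^ k + i else 0))
     (out (ys @ concat (map (entry q k v) [2 ^ k..<2 ^ k + i])))"
  have "pruns (While (\<lambda>r. r 4 \<noteq> 0) Emit_Entry) (28 + 3) (?s 0) (?s (2 ^ k))"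
  proof (rule pruns_While[where s = ?s and n = "2 ^ k"])
    fix i :: nat assume i: "i < 2 ^ k"
    show "pruns Emit_Entry 28 (?s i) (?s (Suc i))"
      using pruns_Emit_Entry[OF assms(1), of k "2 ^ k + i" q t1 "ys @ concat (map (entry q k v) [2 ^ k..<2 ^ k + i])"]
        i k rk_le[of "R v" m] m_less assms(4) by (auto split: if_splits)
    show "reads (?s i) 4 \<noteq> 0" using i by (simp add: tape_of_eq_0 Suc_le_eq length_lsb_eq)
      (simp add: lsb.simps)
  qed (use k rk_bounds(1)[of v] in \<open>auto simp: tape_of_def\<close>)
  then show ?thesis by (simp flip: mult_2)
qed

lemma pruns_List_Good:
  assumes "length (lsb q) < N"
  shows "pruns (List_Good b) 43 (S (I (st 0)) (col 1) (num q) (num 0) (num 0) (out ys))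
    (S (I (st m)) (col (Suc m)) (num q) (num 0) (num 0) (out (ys @ concat (map (entries b q) [0..<m]))))"
proof -
  let ?o = "\<lambda>v. ys @ concat (map (entries b q) [0..<v])"
  let ?s = "\<lambda>v. S (I (st v)) (col (Suc v)) (num q) (num 0) (num 0) (out (?o v))"
  have "pruns (List_Good b) (40 + 3) (?s 0) (?s m)"
    unfolding List_Good_def
  proof (rule pruns_While[where s = ?s and n = m])
    fix v assume v: "v < m"
    let ?J = "(tape_of (lsb (rk (R v) m)), 3)"
    let ?k = "lg (rk (R v) m)"
    let ?c = "Cond (\<lambda>r. r 1 = bit_sym b \<and> r 3 \<noteq> 0)
        (Home 3 ;; Init_Mask ;; Row_Start ;; While (\<lambda>r. r 4 \<noteq> 0) Emit_Entry) (Erase 3)"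
    \<comment> \<open>Listing ends at the start of the row and skipping at its end;
      \<open>Next_Row\<close> works from either place.\<close>
    let ?i = "if good b v then 0 else m"
    let ?t = "\<lambda>p J A z. S (I p) (col (Suc v)) (num q) J A z"
    have 1: "pruns ?c 36 (?t (st v + m) ?J (num 0) (out (?o v))) (?t (st v + ?i) (num 0) (num 0) (out (?o (Suc v))))"
    proof (cases "good b v")
      case True
      then have r: "4 \<le> rk (R v) m" by (simp add: good_def)
      have a: "pruns (Home 3) 4 (?t (st v + m) ?J (num 0) (out (?o v)))
         (?t (st v + m) (num (rk (R v) m)) (num 0) (out (?o v)))"
        by (rule pruns_Home[where p = 3 and xs = "lsb (rk (R v) m)"]) (use N_ge in auto)
      have c: "pruns Init_Mask 10 (?t (st v + m) (num (rk (R v) m)) (num 0) (out (?o v)))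
         (?t (st v + m) (num 0) (num (2 ^ ?k)) (out (?o v)))"
        by (rule pruns_Init_Mask) (use r rk_bounds in auto)
      have d: "pruns Row_Start 5 (?t (st v + m) (num 0) (num (2 ^ ?k)) (out (?o v)))
         (?t (st v) (num 0) (num (2 ^ ?k)) (out (?o v)))"
        by (rule pruns_Row_Start) (use v in auto)
      have e: "pruns (While (\<lambda>r. r 4 \<noteq> 0) Emit_Entry) 31 (?t (st v) (num 0) (num (2 ^ ?k)) (out (?o v)))
         (?t (st v + ?i) (num 0) (num 0) (out (?o (Suc v))))"
        using pruns_entries[OF _ r refl assms, of "col (Suc v)" "?o v"] v True
        by (simp add: entries_def Let_def)
      show ?thesis
        by (rule pruns_mono[OF pruns_CondT[OF _ pruns_Seq[OF a pruns_Seq[OF c pruns_Seq[OF d e]]]]])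
          (use test_good[OF v, of b] True in auto)
    next
      case False
      have a: "pruns (Erase 3) 6 (?t (st v + m) ?J (num 0) (out (?o v))) (?t (st v + ?i) (num 0) (num 0) (out (?o (Suc v))))"
        by (rule pruns_Erase[where xs = "lsb (rk (R v) m)" and p = 3])
          (use rk_bounds N_ge False in \<open>auto simp: entries_def\<close>)
      show ?thesis
        by (rule pruns_mono[OF pruns_CondF[OF _ a]]) (use test_good[OF v, of b] False in auto)
    qed
    have 2: "pruns Next_Row 4 (?t (st v + ?i) (num 0) (num 0) (out (?o (Suc v))))
      (?t (st (Suc v)) (num 0) (num 0) (out (?o (Suc v))))"
      by (rule pruns_Next_Row) (use v in auto)
    have 3: "pruns (Mv 1 Go_Right) 0 (?t (st (Suc v)) (num 0) (num 0) (out (?o (Suc v)))) (?s (Suc v))"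
      by (rule pruns_Mv) auto
    show "pruns (Count_Row ;; Mv 3 Go_Right ;; Mv 3 Go_Right ;; ?c ;; Next_Row ;; Mv 1 Go_Right) 40 (?s v) (?s (Suc v))"
      by (rule pruns_mono[OF pruns_Test[OF v pruns_Seq[OF 1 pruns_Seq[OF 2 3]]]]) simp
  qed (use m_less in \<open>auto simp: col_read\<close>)
  then show ?thesis by simp
qed

lemma pruns_Blank_Side:
  "pruns Blank_Side 6 (S t0 (col 1) t2 t3 t4 (out ys))
    (S t0 (col 1) t2 t3 t4 (out (ys @ bit_vector m (\<lambda>_. False) @ [4])))"
proof -
  let ?o = "\<lambda>n. ys @ map (\<lambda>_. 2) [0..<n]"
  let ?s = "\<lambda>n. S t0 (col (Suc n)) t2 t3 t4 (out (?o n))"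
  have 1: "pruns (While (\<lambda>r. r 1 \<noteq> 0) (Emit (\<lambda>r. 2) ;; Mv 1 Go_Right)) (1 + 3) (?s 0) (?s m)"
  proof (rule pruns_While[where s = ?s and n = m])
    fix n assume n: "n < m"
    have a: "pruns (Emit (\<lambda>r. 2)) 0 (?s n) (S t0 (col (Suc n)) t2 t3 t4 (out (?o (Suc n))))"
      using pruns_Emit[of "\<lambda>r. 2" t0 "col (Suc n)" t2 t3 t4 "?o n" 2] by simp
    have b: "pruns (Mv 1 Go_Right) 0 (S t0 (col (Suc n)) t2 t3 t4 (out (?o (Suc n)))) (?s (Suc n))"
      by (rule pruns_Mv) auto
    show "pruns (Emit (\<lambda>r. 2) ;; Mv 1 Go_Right) 1 (?s n) (?s (Suc n))"
      using pruns_Seq[OF a b] by simp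
  qed (use m_less in \<open>auto simp: col_read\<close>)
  have 2: "pruns (Home 1) 4 (?s m) (S t0 (col 1) t2 t3 t4 (out (?o m)))"
    by (rule pruns_Home[where p = "Suc m" and xs = "bit_vector m (R m)"]) (use m_less in auto)
  have 3: "pruns (Emit (\<lambda>r. 4)) 0 (S t0 (col 1) t2 t3 t4 (out (?o m)))
     (S t0 (col 1) t2 t3 t4 (out (ys @ bit_vector m (\<lambda>_. False) @ [4])))"
    using pruns_Emit[of "\<lambda>r. 4" t0 "col 1" t2 t3 t4 "?o m" 4] by (simp add: bit_vector_def)
  have "pruns Blank_Side 6 (?s 0) (S t0 (col 1) t2 t3 t4 (out (ys @ bit_vector m (\<lambda>_. False) @ [4])))"
    unfolding Blank_Side_def
    by (rule pruns_mono[OF pruns_Seq[OF 1 pruns_Seq[OF 2 3]]]) simp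
  then show ?thesis by simp
qed

lemma pruns_Load_Colors:
  "pruns Load_Colors 20
    (S (I 0) (tape_of [], 0) (tape_of [], 0) (tape_of [], 0) (tape_of [], 0) (tape_of [], 0))
    (S (I (st 0)) (col 1) (num 0) (num 0) (num 0) (out []))"
proof -
  let ?e = "(tape_of [], 0)" and ?f = "(tape_of [], Suc 0)"
  have 1: "pruns (Mv 0 Go_Right) 0 (S (I 0) ?e ?e ?e ?e ?e) (S (I (st 0)) ?e ?e ?e ?e ?e)"
    by (rule pruns_Mv) (auto simp: st_def)
  have 2: "pruns (Mv 1 Go_Right) 0 (S (I (st 0)) ?e ?e ?e ?e ?e) (S (I (st 0)) ?f ?e ?e ?e ?e)"
    by (rule pruns_Mv) auto
  have 3: "pruns (Mv 2 Go_Right) 0 (S (I (st 0)) ?f ?e ?e ?e ?e) (S (I (st 0)) ?f ?f ?e ?e ?e)"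
    by (rule pruns_Mv) auto
  have 4: "pruns (Mv 3 Go_Right) 0 (S (I (st 0)) ?f ?f ?e ?e ?e) (S (I (st 0)) ?f ?f ?f ?e ?e)"
    by (rule pruns_Mv) auto
  have 5: "pruns (Mv 4 Go_Right) 0 (S (I (st 0)) ?f ?f ?f ?e ?e) (S (I (st 0)) ?f ?f ?f ?f ?e)"
    by (rule pruns_Mv) auto
  have 6: "pruns (Mv 5 Go_Right) 0 (S (I (st 0)) ?f ?f ?f ?f ?e) (S (I (st 0)) ?f ?f ?f ?f ?f)"
    by (rule pruns_Mv) auto
  let ?c = "\<lambda>p. (tape_of (bit_vector m (R 0)), p)"
  have 7: "pruns Copy_Row 5 (S (I (st 0)) ?f ?f ?f ?f ?f) (S (I (st 0 + m)) (?c 1) ?f ?f ?f ?f)"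
    using pruns_Copy_Row[of 0 "[]"] by simp
  have 8: "pruns (Home 0) 4 (S (I (st 0 + m)) (?c 1) ?f ?f ?f ?f) (S (I (st 0)) (?c 1) ?f ?f ?f ?f)"
    by (rule pruns_Home[where p = "st 0 + m" and xs = inp])
      (use clean_inp st_less[of 0] in \<open>auto simp: st_def\<close>)
  let ?s = "\<lambda>n. S (I (st n)) (?c (Suc n)) ?f ?f ?f ?f"
  have 9: "pruns (While (\<lambda>r. r 1 \<noteq> 0) (Next_Row ;; Mv 1 Go_Right)) (5 + 3) (?s 0) (?s m)"
  proof (rule pruns_While[where s = ?s and n = m])
    fix n assume n: "n < m"
    have a: "pruns Next_Row 4 (?s n) (S (I (st (Suc n))) (?c (Suc n)) ?f ?f ?f ?f)"
      using pruns_Next_Row[of n 0] n by simp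
    have b: "pruns (Mv 1 Go_Right) 0 (S (I (st (Suc n))) (?c (Suc n)) ?f ?f ?f ?f) (?s (Suc n))"
      by (rule pruns_Mv) auto
    show "pruns (Next_Row ;; Mv 1 Go_Right) 5 (?s n) (?s (Suc n))"
      using pruns_Seq[OF a b] by simp
  qed (use m_less in \<open>auto simp: tape_of_eq_0\<close>)
  have 10: "pruns (Home 1) 4 (?s m) (S (I (st m)) (?c 1) ?f ?f ?f ?f)"
    by (rule pruns_Home[where p = "Suc m" and xs = "bit_vector m (R 0)"]) (use m_less in auto)
  have 11: "pruns Copy_Row 5 (S (I (st m)) (?c 1) ?f ?f ?f ?f) (S (I (st m + m)) (col 1) ?f ?f ?f ?f)"
    by (rule pruns_Copy_Row) auto
  have 12: "pruns (Home 0) 4 (S (I (st m + m)) (col 1) ?f ?f ?f ?f) (S (I (st 0)) (col 1) ?f ?f ?f ?f)"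
    by (rule pruns_Home[where p = "st m + m" and xs = inp])
      (use clean_inp st_less[of m] in \<open>auto simp: st_def\<close>)
  have r9: "pruns (While (\<lambda>r. r 1 \<noteq> 0) (Next_Row ;; Mv 1 Go_Right)) 8
     (S (I (st 0)) (?c 1) ?f ?f ?f ?f) (?s m)"
    using 9 by simp
  have "pruns Load_Colors 20 (S (I 0) ?e ?e ?e ?e ?e) (S (I (st 0)) (col 1) ?f ?f ?f ?f)"
    unfolding Load_Colors_def
    by (rule pruns_mono[OF pruns_Seq[OF 1 pruns_Seq[OF 2 pruns_Seq[OF 3 pruns_Seq[OF 4
      pruns_Seq[OF 5 pruns_Seq[OF 6 pruns_Seq[OF 7 pruns_Seq[OF 8 pruns_Seq[OF r9 pruns_Seq[OF 10
      pruns_Seq[OF 11 12]]]]]]]]]]]]) simp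
  then show ?thesis by simp
qed

definition listing_out :: "bool \<Rightarrow> symbol list" where
  "listing_out b = (let q = Suc (gc b m) in
     bit_vector m (\<lambda>_. False) @ [4] @ bit_vector m (\<lambda>_. False) @ [4] @ [3, 4] @ rev (lsb q) @ [4] @
     concat (map (entries b q) [0..<m]))"

lemma pruns_Lister:
  "\<exists>\<sigma>. pruns (Lister b) 60
    (S (I 0) (tape_of [], 0) (tape_of [], 0) (tape_of [], 0) (tape_of [], 0) (tape_of [], 0)) \<sigma> \<and>
    fst (\<sigma> 5) = tape_of (listing_out b)"
proof -
  define q where "q = Suc (gc b m)"
  have q: "length (lsb q) < N"
    using length_lsb_le[of q] rk_le[of "good b" m] m_less unfolding q_def by linarith
  let ?t = "\<lambda>p c ys. S (I p) (col c) (num q) (num 0) (num 0) (out ys)"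
  have 1: "pruns (Op 2 (\<lambda>r. (3, Stay))) 0 (S (I (st 0)) (col 1) (num 0) (num 0) (num 0) (out []))
    (S (I (st 0)) (col 1) (num 1) (num 0) (num 0) (out []))"
    by (rule pruns_Op) (use tape_of_write_end[of "[]" 3] in \<open>auto simp: lsb.simps[of "Suc 0"]\<close>)
  have 2: "pruns (Count_Good b) 18 (S (I (st 0)) (col 1) (num 1) (num 0) (num 0) (out [])) (?t (st m) (Suc m) [])"
    unfolding q_def by (rule pruns_Count_Good)
  have 3: "pruns (Home 1) 4 (?t (st m) (Suc m) []) (?t (st m) 1 [])"
    by (rule pruns_Home[where p = "Suc m" and xs = "bit_vector m (R m)"]) (use m_less in auto)
  have 4: "pruns (Home 0) 4 (?t (st m) 1 []) (?t (st 0) 1 [])"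
    by (rule pruns_Home[where p = "st m" and xs = inp])
      (use clean_inp st_less[of m] in \<open>auto simp: st_def\<close>)
  let ?z = "bit_vector m (\<lambda>_. False) @ [4]"
  have 5: "pruns Blank_Side 6 (?t (st 0) 1 []) (?t (st 0) 1 ?z)"
    using pruns_Blank_Side[of _ _ _ _ "[]"] by simp
  have 6: "pruns Blank_Side 6 (?t (st 0) 1 ?z) (?t (st 0) 1 (?z @ ?z))"
    by (rule pruns_Blank_Side)
  have 7: "pruns (Emit (\<lambda>r. 3)) 0 (?t (st 0) 1 (?z @ ?z)) (?t (st 0) 1 ((?z @ ?z) @ [3]))"
    by (rule pruns_Emit) (rule refl)
  have 8: "pruns (Emit (\<lambda>r. 4)) 0 (?t (st 0) 1 ((?z @ ?z) @ [3])) (?t (st 0) 1 (((?z @ ?z) @ [3]) @ [4]))"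
    by (rule pruns_Emit) (rule refl)
  note 9 = pruns_Emit_Count[OF q, of "I (st 0)" "col 1" "num 0" "num 0" "((?z @ ?z) @ [3]) @ [4]"]
  let ?w = "(((?z @ ?z) @ [3]) @ [4]) @ rev (lsb q)"
  have 10: "pruns (Emit (\<lambda>r. 4)) 0 (?t (st 0) 1 ?w) (?t (st 0) 1 (?w @ [4]))"
    by (rule pruns_Emit) (rule refl)
  note 11 = pruns_List_Good[OF q, of b "?w @ [4]"]
  have "pruns (Lister b) 60
    (S (I 0) (tape_of [], 0) (tape_of [], 0) (tape_of [], 0) (tape_of [], 0) (tape_of [], 0))
    (?t (st m) (Suc m) ((?w @ [4]) @ concat (map (entries b q) [0..<m])))"
    unfolding Lister_def
    by (rule pruns_mono[OF pruns_Seq[OF pruns_Load_Colors pruns_Seq[OF 1 pruns_Seq[OF 2 pruns_Seq[OF 3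
      pruns_Seq[OF 4 pruns_Seq[OF 5 pruns_Seq[OF 6 pruns_Seq[OF 7 pruns_Seq[OF 8 pruns_Seq[OF 9
      pruns_Seq[OF 10 11]]]]]]]]]]]]) simp
  moreover have "(?w @ [4]) @ concat (map (entries b q) [0..<m]) = listing_out b"
    by (simp add: listing_out_def Let_def q_def)
  ultimately show ?thesis by fastforce
qed

lemma computes_Lister: "computes_in 6 (compile (Lister b) 0) inp (N ^ 60) (listing_out b)"
proof -
  obtain \<sigma> where s: "runs (Lister b) (N ^ 60)
    (S (I 0) (tape_of [], 0) (tape_of [], 0) (tape_of [], 0) (tape_of [], 0) (tape_of [], 0)) \<sigma>"
    "fst (\<sigma> 5) = tape_of (listing_out b)"
    using pruns_Lister by (auto simp: pruns_def)
  show ?thesis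
    by (rule runs_computes_in[OF s(1) _ _ s(2)]) (auto simp: S_def)
qed

end

section \<open>The spectral gap\<close>

lemma sum_const_poly: "(\<Sum>k\<in>K. [:f k:]) = [:\<Sum>k\<in>K. f k:]"
  by (induction K rule: infinite_finite_induct) auto

text \<open>Replacing rows \<open>p\<close> and \<open>q\<close> of the identity by the eigenvectors gives an invertible matrix whose
  product with \<open>x I - A\<close> has the factor \<open>x - e\<close> in both rows.\<close>

lemma two_left_eigenvectors_imp_square_dvd_char_poly:
  fixes A :: "'a::field mat"
  assumes A: "A \<in> carrier_mat n n" and pq: "p < n" "q < n" "p \<noteq> q"
    and y: "\<And>j. j < n \<Longrightarrow> (\<Sum>i<n. y i * A $$ (i, j)) = e * y j" "y p \<noteq> 0"
    and z: "\<And>j. j < n \<Longrightarrow> (\<Sum>i<n. z i * A $$ (i, j)) = e * z j" "z p = 0" "z q \<noteq> 0"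
  shows "[:- e, 1:] ^ 2 dvd char_poly A"
proof -
  let ?X = "[:- e, 1:]"
  define P where "P = Matrix.mat n n (\<lambda>(i, j). if i = p then y j else if i = q then z j
     else if i = j then 1 else (0::'a))"
  define B where "B = char_poly_matrix A"
  define C where "C = Matrix.mat n n (\<lambda>(i, j). if i = p then [:y j:] else if i = q then [:z j:]
     else B $$ (i, j))"
  let ?P = "map_mat (\<lambda>a. [:a:]) P"
  have cP: "P \<in> carrier_mat n n" and cC: "C \<in> carrier_mat n n" and cB: "B \<in> carrier_mat n n"
    using A by (auto simp: P_def C_def B_def)
  have B: "B $$ (i, j) = (if i = j then [:0, 1:] else 0) + [:- A $$ (i, j):]" if "i < n" "j < n" for i j
    using A that by (auto simp: B_def char_poly_matrix_def)
  have row: "(\<Sum>k<n. [:x k:] * B $$ (k, j)) = ?X * [:x j:]"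
    if j: "j < n" and x: "(\<Sum>i<n. x i * A $$ (i, j)) = e * x j" for x j
  proof -
    have "(\<Sum>k<n. [:x k:] * B $$ (k, j)) =
       (\<Sum>k<n. (if k = j then [:0, x k:] else 0) + [:- (x k * A $$ (k, j)):])"
      by (rule sum.cong) (use j in \<open>auto simp: B\<close>)
    also have "\<dots> = [:0, x j:] + [:- (\<Sum>k<n. x k * A $$ (k, j)):]"
      using j by (simp add: sum.distrib sum_const_poly sum_negf)
    finally show ?thesis using x by simp
  qed
  have "?P * B = multrow p ?X (multrow q ?X C)"
  proof (rule eq_matI)
    fix i j assume "i < dim_row (multrow p ?X (multrow q ?X C))" "j < dim_col (multrow p ?X (multrow q ?X C))"
    then have ij: "i < n" "j < n" using cC by auto
    have "(?P * B) $$ (i, j) = (\<Sum>k<n. [:P $$ (i, k):] * B $$ (k, j))"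
      using ij cP cB by (auto simp: scalar_prod_def atLeast0LessThan intro!: sum.cong)
    also have "\<dots> = multrow p ?X (multrow q ?X C) $$ (i, j)"
    proof -
      consider "i = p" | "i = q" | "i \<noteq> p" "i \<noteq> q" by blast
      then show ?thesis
      proof cases
        case 1
        have "(\<Sum>k<n. [:P $$ (i, k):] * B $$ (k, j)) = (\<Sum>k<n. [:y k:] * B $$ (k, j))"
          by (rule sum.cong) (use 1 ij in \<open>auto simp: P_def\<close>)
        then show ?thesis using row[OF ij(2) y(1)] ij 1 pq by (simp add: C_def)
      next
        case 2
        have "(\<Sum>k<n. [:P $$ (i, k):] * B $$ (k, j)) = (\<Sum>k<n. [:z k:] * B $$ (k, j))"
          by (rule sum.cong) (use 2 pq ij in \<open>auto simp: P_def\<close>)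
        then show ?thesis using row[OF ij(2) z(1)] ij 2 pq by (simp add: C_def)
      next
        case 3
        have "(\<Sum>k<n. [:P $$ (i, k):] * B $$ (k, j)) = (\<Sum>k<n. if k = i then B $$ (k, j) else 0)"
          by (rule sum.cong) (use 3 ij in \<open>auto simp: P_def\<close>)
        then show ?thesis using ij 3 by (simp add: C_def)
      qed
    qed
    finally show "(?P * B) $$ (i, j) = multrow p ?X (multrow q ?X C) $$ (i, j)" .
  qed (use cP cB cC in auto)
  then have "det ?P * det B = ?X * (?X * det C)"
    using cP cB cC pq
    by (subst det_mult[symmetric, of _ n]) (auto simp: det_multrow[of _ n])
  moreover have "det ?P = [:det P:]"
  proof -
    interpret comm_ring_hom "\<lambda>a::'a. [:a:]"
      by unfold_locales (auto simp: one_pCons)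
    show ?thesis by (rule hom_det)
  qed
  moreover have P0: "det P \<noteq> 0"
  proof
    assume "det P = 0"
    then obtain v where v: "v \<in> carrier_vec n" "v \<noteq> 0\<^sub>v n" "P *\<^sub>v v = 0\<^sub>v n"
      using det_0_iff_vec_prod_zero[OF cP] by auto
    have e: "(\<Sum>k<n. P $$ (i, k) * v $ k) = 0" if "i < n" for i
    proof -
      have "(P *\<^sub>v v) $ i = (\<Sum>k<n. P $$ (i, k) * v $ k)"
        using cP v(1) that by (auto simp: scalar_prod_def atLeast0LessThan intro!: sum.cong)
      then show ?thesis using v(3) that by simp
    qed
    \<comment> \<open>The system is triangular: the identity rows kill all other coordinates, then
      \<open>z p = 0\<close> lets row \<open>q\<close> kill \<open>v $ q\<close>, and row
      \<open>p\<close> kills the last one.\<close>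
    have oth: "v $ i = 0" if "i < n" "i \<noteq> p" "i \<noteq> q" for i
    proof -
      have "(\<Sum>k<n. P $$ (i, k) * v $ k) = (\<Sum>k<n. if k = i then v $ k else 0)"
        by (rule sum.cong) (use that in \<open>auto simp: P_def\<close>)
      then show ?thesis using e[OF that(1)] that by simp
    qed
    have "(\<Sum>k<n. P $$ (q, k) * v $ k) = (\<Sum>k<n. if k = q then z q * v $ q else 0)"
      by (rule sum.cong) (use pq z oth in \<open>auto simp: P_def\<close>)
    then have vq: "v $ q = 0" using e[OF pq(2)] pq z by simp
    have "(\<Sum>k<n. P $$ (p, k) * v $ k) = (\<Sum>k<n. if k = p then y p * v $ p else 0)"
      by (rule sum.cong) (use pq vq oth in \<open>auto simp: P_def\<close>)
    then have vp: "v $ p = 0" using e[OF pq(1)] pq y by simp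
    have "v $ i = 0" if "i < n" for i
      using vp vq oth that by metis
    then have "v = 0\<^sub>v n"
      using v(1) by (intro eq_vecI) auto
    then show False using v(2) by simp
  qed
  ultimately have "[:det P:] * char_poly A = ?X * (?X * det C)"
    by (simp only: B_def char_poly_def)
  then have "?X ^ 2 dvd [:det P:] * char_poly A"
    by (metis dvd_triv_left power2_eq_square mult.assoc)
  then show ?thesis using P0 by (simp add: dvd_smult_iff)
qed

section \<open>Symmetric matrices on the vectors with sum zero\<close>

text \<open>Vectors are functions that vanish from \<open>m\<close> on. In the product topology the
  sphere is a closed part of a product of compact intervals, and evaluation at a coordinate is
  continuous.\<close>

lemma compact_sphere_orthogonal_ones:
  "compact {x :: nat \<Rightarrow> real. (\<forall>i. i \<ge> m \<longrightarrow> x i = 0) \<and> (\<Sum>i<m. x i) = 0 \<and> (\<Sum>i<m. (x i)\<^sup>2) = 1}"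
proof -
  let ?Q = "PiE UNIV (\<lambda>i. if i < m then {-1..1} else {0::real})"
  let ?K = "{x :: nat \<Rightarrow> real. (\<forall>i. i \<ge> m \<longrightarrow> x i = 0) \<and> (\<Sum>i<m. x i) = 0 \<and> (\<Sum>i<m. (x i)\<^sup>2) = 1}"
  have "compactin (product_topology (\<lambda>i. euclidean) UNIV) ?Q"
    by (subst compactin_PiE) auto
  then have Q: "compact ?Q"
    by (simp add: euclidean_product_topology)
  have "closed {x :: nat \<Rightarrow> real. (\<Sum>i<m. x i) = 0}"
    by (intro closed_Collect_eq continuous_intros continuous_on_product_coordinates)
  moreover have "closed {x :: nat \<Rightarrow> real. (\<Sum>i<m. (x i)\<^sup>2) = 1}"
    by (intro closed_Collect_eq continuous_intros continuous_on_product_coordinates)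
  ultimately have c: "compact (?Q \<inter> ({x. (\<Sum>i<m. x i) = 0} \<inter> {x. (\<Sum>i<m. (x i)\<^sup>2) = 1}))"
    using Q by (intro compact_Int_closed closed_Int)
  have "x i \<in> {-1..1}" if "(\<Sum>i<m. (x i)\<^sup>2) = 1" "i < m" for x :: "nat \<Rightarrow> real" and i
  proof -
    have "(x i)\<^sup>2 \<le> (\<Sum>i<m. (x i)\<^sup>2)"
      using that(2) by (intro member_le_sum) auto
    then have "\<bar>x i\<bar> \<le> 1" using that(1) by (simp add: abs_square_le_1)
    then show ?thesis by auto
  qed
  then have "?K = ?Q \<inter> ({x. (\<Sum>i<m. x i) = 0} \<inter> {x. (\<Sum>i<m. (x i)\<^sup>2) = 1})"
    by (auto simp: PiE_iff split: if_splits)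
  then show ?thesis using c by metis
qed

text \<open>A maximiser \<open>x\<close> of \<open>|M x|\<close> on the sphere satisfies \<open>M\<^sup>2 x = L x\<close>, hence \<open>\<surd>L\<close> or \<open>-\<surd>L\<close> is an eigenvalue
  with an eigenvector orthogonal to the ones.\<close>

lemma symmetric_contraction_orthogonal_ones:
  fixes w :: "nat \<Rightarrow> nat \<Rightarrow> real" and m :: nat and D g :: real
  defines "M \<equiv> \<lambda>x i. \<Sum>j<m. w i j * x j"
  assumes sym: "\<And>i j. i < m \<Longrightarrow> j < m \<Longrightarrow> w i j = w j i"
    and row: "\<And>i. i < m \<Longrightarrow> (\<Sum>j<m. w i j) = D"
    and eig: "\<And>x l. (\<Sum>i<m. x i) = 0 \<Longrightarrow> (\<exists>i<m. x i \<noteq> 0) \<Longrightarrow> (\<And>i. i < m \<Longrightarrow> M x i = l * x i) \<Longrightarrow> \<bar>l\<bar> \<le> g"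
    and x: "(\<Sum>i<m. x i) = 0"
  shows "(\<Sum>i<m. (M x i)\<^sup>2) \<le> g\<^sup>2 * (\<Sum>i<m. (x i)\<^sup>2)"
proof (cases "\<exists>i<m. x i \<noteq> 0")
  case False
  then have "M x i = 0" for i unfolding M_def by (intro sum.neutral) auto
  then show ?thesis using False by simp
next
  case True
  let ?n = "\<lambda>x. \<Sum>i<m. (x i)\<^sup>2"
  let ?K = "{x :: nat \<Rightarrow> real. (\<forall>i. i \<ge> m \<longrightarrow> x i = 0) \<and> (\<Sum>i<m. x i) = 0 \<and> ?n x = 1}"
  have pos: "?n z > 0" if nz: "\<exists>i<m. z i \<noteq> 0" for z :: "nat \<Rightarrow> real"
  proof -
    obtain i where "i < m" "z i \<noteq> 0" using nz by blast
    then show ?thesis by (intro sum_pos2[of _ i]) auto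
  qed
  have adj: "(\<Sum>i<m. u i * M v i) = (\<Sum>i<m. M u i * v i)" for u v
  proof -
    have "(\<Sum>i<m. u i * M v i) = (\<Sum>i<m. \<Sum>j<m. u i * w i j * v j)"
      by (simp add: M_def sum_distrib_left mult.assoc)
    also have "\<dots> = (\<Sum>j<m. \<Sum>i<m. u i * w i j * v j)" by (rule sum.swap)
    also have "\<dots> = (\<Sum>j<m. M u j * v j)"
      by (auto simp: M_def sum_distrib_left sum_distrib_right sym mult_ac intro!: sum.cong)
    finally show ?thesis .
  qed
  have Msum: "(\<Sum>i<m. M u i) = D * (\<Sum>i<m. u i)" for u
  proof -
    have "(\<Sum>i<m. M u i) = (\<Sum>i<m. M (\<lambda>_. 1) i * u i)" using adj[of "\<lambda>_. 1" u] by simp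
    then show ?thesis using row by (simp add: M_def sum_distrib_left)
  qed
  have Mlin: "M (\<lambda>i. u i + c * v i) i = M u i + c * M v i" for u v c i
    by (simp add: M_def algebra_simps sum.distrib sum_distrib_left)
  have Mscale: "M (\<lambda>i. c * v i) i = c * M v i" for v c i
    by (simp add: M_def algebra_simps sum_distrib_left)
  have Mcong: "M u i = M v i" if "\<And>i. i < m \<Longrightarrow> u i = v i" for u v i
    unfolding M_def by (rule sum.cong) (use that in auto)
  have normalize: "\<exists>y\<in>?K. \<exists>c>0. c\<^sup>2 = ?n z \<and> (\<forall>i<m. z i = c * y i)" if z: "(\<Sum>i<m. z i) = 0" "\<exists>i<m. z i \<noteq> 0" for z
  proof -
    define c where "c = sqrt (?n z)"
    have c: "c > 0" "c\<^sup>2 = ?n z" using pos[OF z(2)] by (auto simp: c_def)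
    let ?y = "\<lambda>i. if i < m then z i / c else 0"
    have "(\<Sum>i<m. ?y i) = (\<Sum>i<m. z i) / c" by (simp add: sum_divide_distrib)
    moreover have "?n ?y = ?n z / c\<^sup>2" by (simp add: sum_divide_distrib power_divide)
    ultimately have "?y \<in> ?K" using z c by auto
    moreover have "\<forall>i<m. z i = c * ?y i" using c by simp
    ultimately show ?thesis using c by (intro bexI[of _ ?y] exI[of _ c]) auto
  qed
  have ne: "?K \<noteq> {}" using normalize[OF x True] by blast
  have "continuous_on ?K (\<lambda>x. \<Sum>i<m. (M x i)\<^sup>2)"
    unfolding M_def by (intro continuous_intros continuous_on_subset[OF continuous_on_product_coordinates]) auto
  from continuous_attains_sup[OF compact_sphere_orthogonal_ones ne this]
  obtain x0 where x0: "x0 \<in> ?K" "\<And>y. y \<in> ?K \<Longrightarrow> (\<Sum>i<m. (M y i)\<^sup>2) \<le> (\<Sum>i<m. (M x0 i)\<^sup>2)" by blast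
  define L where "L = (\<Sum>i<m. (M x0 i)\<^sup>2)"
  have L0: "L \<ge> 0" unfolding L_def by (intro sum_nonneg) auto
  have bound: "(\<Sum>i<m. (M z i)\<^sup>2) \<le> L * ?n z" if z: "(\<Sum>i<m. z i) = 0" for z
  proof (cases "\<exists>i<m. z i \<noteq> 0")
    case True
    from normalize[OF z True] obtain y c where y: "y \<in> ?K" "c\<^sup>2 = ?n z" "\<forall>i<m. z i = c * y i" by blast
    have "M z i = c * M y i" for i
      using Mcong[of z "\<lambda>i. c * y i"] y(3) Mscale by simp
    then have "(\<Sum>i<m. (M z i)\<^sup>2) = c\<^sup>2 * (\<Sum>i<m. (M y i)\<^sup>2)"
      by (simp add: power_mult_distrib sum_distrib_left)
    also have "\<dots> \<le> c\<^sup>2 * L" using x0(2)[OF y(1)] by (intro mult_left_mono) (auto simp: L_def)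
    finally show ?thesis using y(2) by (simp add: mult.commute)
  next
    case False
    then have "M z i = 0" for i unfolding M_def by (intro sum.neutral) auto
    then show ?thesis using False by simp
  qed
  have x0s: "(\<Sum>i<m. x0 i) = 0" "?n x0 = 1" using x0(1) by auto
  define r where "r = (\<lambda>i. L * x0 i - M (M x0) i)"
  have rs: "(\<Sum>i<m. r i) = 0"
    using Msum[of x0] Msum[of "M x0"] x0s by (simp add: r_def sum_subtractf flip: sum_distrib_left)
  have r0: "?n r = 0"
  proof -
    \<comment> \<open>On vectors with sum zero, \<open>L\<close> times the squared norm minus the
      squared norm of the image is nonnegative, and it vanishes at \<open>x0\<close>. Moving from
      \<open>x0\<close> in the direction of the residual \<open>r\<close> gives this quadratic in
      \<open>t\<close>, whose linear coefficient is twice the squared norm of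
      \<open>r\<close>.\<close>
    have quad: "0 \<le> 2 * t * ?n r + t\<^sup>2 * (L * ?n r - (\<Sum>i<m. (M r i)\<^sup>2))" for t
    proof -
      let ?z = "\<lambda>i. x0 i + t * r i"
      have "(\<Sum>i<m. ?z i) = 0" using x0s rs by (simp add: sum.distrib flip: sum_distrib_left)
      from bound[OF this] have "(\<Sum>i<m. (M x0 i + t * M r i)\<^sup>2) \<le> L * ?n ?z"
        by (simp add: Mlin)
      moreover have "(\<Sum>i<m. (M x0 i + t * M r i)\<^sup>2) = L + 2 * t * (\<Sum>i<m. M x0 i * M r i) + t\<^sup>2 * (\<Sum>i<m. (M r i)\<^sup>2)"
        by (simp add: L_def power2_sum power_mult_distrib sum.distrib sum_distrib_left algebra_simps)
      moreover have "?n ?z = 1 + 2 * t * (\<Sum>i<m. x0 i * r i) + t\<^sup>2 * ?n r"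
        using x0s(2) by (simp add: power2_sum power_mult_distrib sum.distrib sum_distrib_left algebra_simps)
      moreover have "L * (\<Sum>i<m. x0 i * r i) - (\<Sum>i<m. M x0 i * M r i) = ?n r"
      proof -
        have "(\<Sum>i<m. M x0 i * M r i) = (\<Sum>i<m. M (M x0) i * r i)" by (rule adj)
        then show ?thesis
          by (simp add: r_def power2_eq_square sum_distrib_left algebra_simps flip: sum_subtractf)
      qed
      moreover have "2 * t * R + t\<^sup>2 * (L * R - W) = L * (1 + 2 * t * P + t\<^sup>2 * R) - (L + 2 * t * Q + t\<^sup>2 * W)"
        if "L * P - Q = R" for P Q R W :: real
        unfolding that[symmetric] by (simp add: algebra_simps)
      ultimately show ?thesis by simp
    qed
    show ?thesis
    proof (rule ccontr)
      assume "?n r \<noteq> 0"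
      then have n: "?n r > 0" by (simp add: sum_nonneg less_le)
      define c where "c = L * ?n r - (\<Sum>i<m. (M r i)\<^sup>2)"
      have c: "c \<ge> 0" using bound[OF rs] by (simp add: c_def)
      \<comment> \<open>A negative \<open>t\<close>, small enough for the linear term to dominate;
        the 1 avoids a division by zero.\<close>
      define t where "t = - ?n r / (c + 1)"
      have t: "t < 0" using n c by (simp add: t_def)
      have "0 \<le> t * (2 * ?n r + t * c)" using quad[of t] by (simp add: c_def power2_eq_square algebra_simps)
      then have "2 * ?n r + t * c \<le> 0" using t by (simp add: zero_le_mult_iff)
      moreover have "t * c \<ge> - ?n r"
        using n c by (simp add: t_def field_simps)
      ultimately show False using n by simp
    qed
  qed
  have Mr: "M (M x0) i = L * x0 i" if "i < m" for i
  proof -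
    have "(r i)\<^sup>2 \<le> ?n r" using that by (intro member_le_sum) auto
    then show ?thesis using r0 by (simp add: r_def)
  qed
  define l where "l = sqrt L"
  have l: "l * l = L" "l \<ge> 0" using L0 by (auto simp: l_def)
  \<comment> \<open>The factorisation (M - l)(M + l) x0 = 0: either \<open>y\<close> is a nonzero
    eigenvector for \<open>l\<close>, or it vanishes and \<open>x0\<close> is one for
    \<open>-l\<close>.\<close>
  define y where "y = (\<lambda>i. M x0 i + l * x0 i)"
  have "\<bar>l\<bar> \<le> g"
  proof (cases "\<exists>i<m. y i \<noteq> 0")
    case True
    have "(\<Sum>i<m. y i) = 0" using Msum[of x0] x0s by (simp add: y_def sum.distrib flip: sum_distrib_left)
    moreover have "M y i = l * y i" if "i < m" for i
      unfolding y_def Mlin using Mr[OF that] l(1) by (simp add: algebra_simps)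
    ultimately show ?thesis using eig True by blast
  next
    case False
    have "\<exists>i<m. x0 i \<noteq> 0"
    proof (rule ccontr)
      assume "\<not> (\<exists>i<m. x0 i \<noteq> 0)"
      then have "?n x0 = 0" by simp
      then show False using x0s by simp
    qed
    moreover have "M x0 i = - l * x0 i" if "i < m" for i using False that by (auto simp: y_def)
    ultimately have "\<bar>- l\<bar> \<le> g" using eig[of x0 "- l"] x0s(1) by blast
    then show ?thesis by simp
  qed
  then have "l\<^sup>2 \<le> g\<^sup>2" using l(2) by (intro power_mono) auto
  then have "L \<le> g\<^sup>2" using l(1) by (simp add: power2_eq_square)
  have "(\<Sum>i<m. (M x i)\<^sup>2) \<le> L * ?n x" by (rule bound[OF x])
  also have "\<dots> \<le> g\<^sup>2 * ?n x" using \<open>L \<le> g\<^sup>2\<close> by (intro mult_right_mono) (auto intro: sum_nonneg)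
  finally show ?thesis .
qed

section \<open>Consequences of the spectral gap for graphs\<close>

text \<open>An edge at \<open>v\<close> is \<open>Upair v u\<close> for exactly one
  \<open>u\<close>; for a loop this is \<open>v\<close> itself, so a loop counts once on both
  sides.\<close>

lemma sum_mult_Upair:
  fixes G :: "nat multigraph"
  assumes "multigraph G" "verts G = {..<m}" "v < m"
  shows "(\<Sum>u<m. count (edges G) (Upair v u)) = degree_of G v"
proof -
  let ?F = "{#e \<in># edges G. v \<in> set_uprod e#}"
  have inj: "inj_on (Upair v) {..<m}" by (auto simp: inj_on_def)
  have "set_mset ?F \<subseteq> Upair v ` {..<m}"
  proof
    fix e assume "e \<in> set_mset ?F"
    then have e: "e \<in># edges G" "v \<in> set_uprod e" by auto
    obtain a c where ac: "e = Upair a c" by (cases e)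
    have "a < m" "c < m" using assms e(1) ac by (auto simp: multigraph_def)
    then show "e \<in> Upair v ` {..<m}" using e(2) ac by (auto simp: Upair_inject)
  qed
  then have "size ?F = (\<Sum>e\<in>Upair v ` {..<m}. count ?F e)"
    unfolding size_multiset_overloaded_eq
    by (intro sum.mono_neutral_left) (auto simp: not_in_iff)
  also have "\<dots> = (\<Sum>u<m. count ?F (Upair v u))"
    by (simp add: sum.reindex[OF inj])
  also have "\<dots> = (\<Sum>u<m. count (edges G) (Upair v u))"
    by (rule sum.cong) auto
  finally show ?thesis by (simp add: degree_of_def)
qed

text \<open>Being orthogonal to the ones, \<open>x\<close> is independent of them. If
  \<open>l\<close> were the degree, both would be eigenvectors for it, against its multiplicity 1 as
  a root.\<close>

lemma expander_eigenvector:
  assumes ex: "spectral_expander m d \<gamma> G"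
    and s: "(\<Sum>i<m. x i) = 0" and nz: "\<exists>i<m. x i \<noteq> 0"
    and e: "\<And>i. i < m \<Longrightarrow> (\<Sum>j<m. real (count (edges G) (Upair i j)) * x j) = l * x i"
  shows "l \<noteq> real d" "\<bar>l\<bar> \<le> \<gamma> * real d"
proof -
  let ?A = "adj_matrix m G"
  let ?w = "\<lambda>i j. real (count (edges G) (Upair i j))"
  have A: "?A \<in> carrier_mat m m" by (simp add: adj_matrix_def)
  have sym: "?w i j = ?w j i" for i j by (metis Upair_inject)
  have g: "multigraph G" "verts G = {..<m}" "regular d G" "order (real d) (char_poly ?A) = 1"
    "\<And>x. eigenvalue ?A x \<Longrightarrow> x \<noteq> real d \<Longrightarrow> \<bar>x\<bar> \<le> \<gamma> * real d"
    using ex by (auto simp: spectral_expander_def)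
  have row: "(\<Sum>j<m. ?w i j) = real d" if "i < m" for i
    using sum_mult_Upair[OF g(1,2) that] g(2,3) that by (simp add: regular_def flip: of_nat_sum)
  have "eigenvector ?A (vec m x) l"
  proof -
    obtain i where "i < m" "x i \<noteq> 0" using nz by blast
    then have "vec m x \<noteq> 0\<^sub>v m" by (metis index_vec index_zero_vec(1))
    moreover have "?A *\<^sub>v vec m x = l \<cdot>\<^sub>v vec m x"
      by (rule eq_vecI) (auto simp: adj_matrix_def scalar_prod_def atLeast0LessThan e)
    ultimately show ?thesis using A by (simp add: eigenvector_def)
  qed
  then have ev: "eigenvalue ?A l" by (auto simp: eigenvalue_def)
  show "l \<noteq> real d"
  proof
    assume True: "l = real d"
    have "\<exists>p<m. \<exists>q<m. x p \<noteq> x q"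
    proof (rule ccontr)
      assume "\<not> (\<exists>p<m. \<exists>q<m. x p \<noteq> x q)"
      then have c: "\<And>p q. p < m \<Longrightarrow> q < m \<Longrightarrow> x p = x q" by blast
      obtain i where i: "i < m" "x i \<noteq> 0" using nz by blast
      have "(\<Sum>j<m. x j) = (\<Sum>j<m. x i)" by (intro sum.cong refl c) (use i in auto)
      then show False using s i by simp
    qed
    then obtain p q where pq: "p < m" "q < m" "x p \<noteq> x q" by blast
    have "[:- real d, 1:] ^ 2 dvd char_poly ?A"
    proof (rule two_left_eigenvectors_imp_square_dvd_char_poly[OF A pq(1,2),
          \<comment> \<open>Subtracting a multiple of the ones from \<open>x\<close> makes the
            second eigenvector vanish at \<open>p\<close>, but not at \<open>q\<close>.\<close>
          where y = "\<lambda>_. 1" and z = "\<lambda>i. x i - x p"])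
      fix j assume j: "j < m"
      have a: "(\<Sum>i<m. 1 * ?A $$ (i, j)) = real d"
        using row[OF j] j by (simp add: adj_matrix_def sym[of _ j])
      then show "(\<Sum>i<m. 1 * ?A $$ (i, j)) = real d * 1" by simp
      have "(\<Sum>i<m. x i * ?A $$ (i, j)) = (\<Sum>i<m. ?w j i * x i)"
        by (rule sum.cong) (use j in \<open>auto simp: adj_matrix_def sym[of _ j]\<close>)
      then have "(\<Sum>i<m. x i * ?A $$ (i, j)) = real d * x j"
        using e[OF j] True by simp
      then show "(\<Sum>i<m. (x i - x p) * ?A $$ (i, j)) = real d * (x j - x p)"
        using a by (simp add: algebra_simps sum_subtractf flip: sum_distrib_left)
    qed (use pq in auto)
    moreover have "char_poly ?A \<noteq> 0"
      using degree_monic_char_poly[OF A] by auto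
    ultimately have "2 \<le> order (real d) (char_poly ?A)"
      by (simp add: order_divides)
    then show False using g(4) by simp
  qed
  then show "\<bar>l\<bar> \<le> \<gamma> * real d" using g(5) ev by blast
qed

text \<open>With degree 0 the adjacency matrix is zero, so a vector with entries 1 and -1 and sum
  zero would be an eigenvector for the eigenvalue \<open>d = 0\<close>.\<close>

lemma expander_degree_pos:
  assumes ex: "spectral_expander m d \<gamma> G" and m: "m \<ge> 2"
  shows "d > 0"
proof (rule ccontr)
  assume "\<not> d > 0"
  then have "(\<Sum>u<m. count (edges G) (Upair v u)) = 0" if "v < m" for v
    using sum_mult_Upair[of G m v] ex that by (auto simp: spectral_expander_def regular_def)
  then have z: "count (edges G) (Upair v u) = 0" if "v < m" "u < m" for v u
    using that by simp
  let ?x = "\<lambda>i::nat. if i = 0 then 1 else if i = 1 then -1 else (0::real)"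
  have "(\<Sum>i<m. ?x i) = (\<Sum>i\<in>{0, 1}. ?x i)"
    by (rule sum.mono_neutral_right) (use m in auto)
  then have s: "(\<Sum>i<m. ?x i) = 0" by simp
  have "0 \<noteq> real d"
  proof (rule expander_eigenvector(1)[OF ex s])
    show "\<exists>i<m. ?x i \<noteq> 0" using m by (intro exI[of _ 0]) auto
  qed (use z in auto)
  then show False using \<open>\<not> d > 0\<close> by simp
qed

text \<open>A second-moment argument. With \<open>a\<close> the density of \<open>X\<close> and
  \<open>x\<close> its centred indicator, every vertex without a neighbour in \<open>X\<close>
  receives \<open>- (d * a)\<close> from the adjacency matrix, while the spectral gap bounds the sum
  of all squares by \<open>(\<gamma> * d)\<^sup>2 * card X\<close>.\<close>

lemma card_avoiding_le:
  assumes ex: "spectral_expander m d \<gamma> G" and d: "d > 0" and X: "X \<subseteq> {..<m}" "X \<noteq> {}"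
  shows "real (card {v. v < m \<and> nbrs G {v} \<inter> X = {}}) \<le> \<gamma>\<^sup>2 * (real m)\<^sup>2 / real (card X)"
proof -
  let ?w = "\<lambda>i j. real (count (edges G) (Upair i j))"
  have g: "multigraph G" "verts G = {..<m}" "regular d G"
    using ex by (auto simp: spectral_expander_def)
  have sym: "?w i j = ?w j i" for i j by (metis Upair_inject)
  have row: "(\<Sum>j<m. ?w i j) = real d" if "i < m" for i
    using sum_mult_Upair[OF g(1,2) that] g(2,3) that by (simp add: regular_def flip: of_nat_sum)
  have fX: "finite X" using X(1) finite_subset by blast
  have cX: "card X > 0" using X fX by (simp add: card_gt_0_iff)
  have m: "m > 0" using X by auto
  define a where "a = real (card X) / real m"
  have a: "a > 0" using cX m by (simp add: a_def)
  define x where "x = (\<lambda>i. indicator X i - a)"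
  have ind: "(\<Sum>i<m. f i * indicator X i) = (\<Sum>i\<in>X. f i)" for f :: "nat \<Rightarrow> real"
  proof -
    have "(\<Sum>i<m. f i * indicator X i) = (\<Sum>i\<in>{..<m} \<inter> X. f i)"
      by (simp add: sum.inter_restrict indicator_def if_distrib cong: if_cong)
    then show ?thesis using X(1) by (simp add: Int_absorb1)
  qed
  have sx: "(\<Sum>i<m. x i) = 0"
    using ind[of "\<lambda>_. 1"] m by (simp add: x_def sum_subtractf a_def)
  have nx: "(\<Sum>i<m. (x i)\<^sup>2) \<le> real (card X)"
  proof -
    have "(x i)\<^sup>2 = (1 - 2 * a) * indicator X i + a\<^sup>2" for i
      by (auto simp: x_def indicator_def power2_eq_square algebra_simps)
    then have "(\<Sum>i<m. (x i)\<^sup>2) = (1 - 2 * a) * real (card X) + real m * a\<^sup>2"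
      using ind[of "\<lambda>_. 1 - 2 * a"] by (simp add: sum.distrib)
    also have "real m * a\<^sup>2 = a * real (card X)"
      using m by (simp add: a_def power2_eq_square)
    finally have "(\<Sum>i<m. (x i)\<^sup>2) = real (card X) - a * real (card X)" by (simp add: algebra_simps)
    moreover have "0 \<le> a * real (card X)" using a by simp
    ultimately show ?thesis by linarith
  qed
  let ?M = "\<lambda>i. \<Sum>j<m. ?w i j * x j"
  have le: "(\<Sum>i<m. (?M i)\<^sup>2) \<le> (\<gamma> * real d)\<^sup>2 * (\<Sum>i<m. (x i)\<^sup>2)"
    using symmetric_contraction_orthogonal_ones[of m ?w "real d" "\<gamma> * real d" x]
      sym row expander_eigenvector(2)[OF ex] sx by blast
  let ?B = "{v. v < m \<and> nbrs G {v} \<inter> X = {}}"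
  have Mv: "?M v = - (real d * a)" if "v \<in> ?B" for v
  proof -
    have z: "?w v j = 0" if "j \<in> X" for j
      using \<open>v \<in> ?B\<close> that X(1) g(2) by (auto simp: nbrs_def not_in_iff[symmetric])
    have "?M v = (\<Sum>j<m. ?w v j * indicator X j) - (\<Sum>j<m. ?w v j) * a"
      by (simp add: x_def algebra_simps sum_subtractf sum_distrib_left)
    also have "\<dots> = - (real d * a)"
      using row[of v] that z by (simp add: ind)
    finally show ?thesis .
  qed
  have "real (card ?B) * (real d * a)\<^sup>2 = (\<Sum>v\<in>?B. (?M v)\<^sup>2)"
    using Mv by (simp del: mem_Collect_eq)
  also have "\<dots> \<le> (\<Sum>i<m. (?M i)\<^sup>2)"
    by (rule sum_mono2) auto
  also have "\<dots> \<le> (\<gamma> * real d)\<^sup>2 * real (card X)"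
    using le nx by (meson mult_left_mono order_trans zero_le_power2)
  finally have "real (card ?B) * a\<^sup>2 * (real d)\<^sup>2 \<le> \<gamma>\<^sup>2 * real (card X) * (real d)\<^sup>2"
    by (simp add: power_mult_distrib algebra_simps)
  then have "real (card ?B) * a\<^sup>2 \<le> \<gamma>\<^sup>2 * real (card X)"
    using d by simp
  then show ?thesis
    using m cX by (simp add: a_def field_simps power2_eq_square)
qed

section \<open>Splitting neighbourhoods by parities\<close>

definition chi :: "nat \<Rightarrow> nat \<Rightarrow> real" where
  "chi a j = (if par a j then - 1 else 1)"

lemma chi_double: "chi (2 * a) j = chi a (j div 2)"
  "chi (Suc (2 * a)) j = (if odd j then - 1 else 1) * chi a (j div 2)"
  by (auto simp: chi_def par_rec[of "2 * a"] par_rec[of "Suc (2 * a)"])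

lemma sum_double_interval:
  fixes f :: "nat \<Rightarrow> 'a::comm_monoid_add"
  assumes "n \<le> n'"
  shows "(\<Sum>a\<in>{2 * n..<2 * n'}. f a) = (\<Sum>a\<in>{n..<n'}. f (2 * a) + f (Suc (2 * a)))"
  using assms by (induction n' rule: dec_induct) (auto simp: add_ac)

text \<open>Summing over the last digit of the mask gives a factor 2 if \<open>j\<close> and
  \<open>j'\<close> have equal parity and 0 otherwise; in the first case the halves are still
  distinct and the induction applies. In the base case the only mask is 1 and the sum is -1.\<close>

lemma sum_chi_mult_le_0:
  assumes "j \<noteq> j'" "j < 2 ^ Suc k" "j' < 2 ^ Suc k"
  shows "(\<Sum>a\<in>{2 ^ k..<2 ^ Suc k}. chi a j * chi a j') \<le> 0"
  using assms
proof (induction k arbitrary: j j')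
  case 0
  have s: "{2 ^ 0..<2 ^ Suc 0} = {1::nat}" by auto
  have p: "chi 1 i = (if odd i then - 1 else 1)" for i
    unfolding chi_def by (subst par_rec) simp
  have "j = 0 \<and> j' = 1 \<or> j = 1 \<and> j' = 0" using 0 by auto
  then have "chi 1 j * chi 1 j' \<le> 0" unfolding p by auto
  then show ?case unfolding s by simp
next
  case (Suc k)
  let ?s = "\<lambda>j::nat. if odd j then - 1 else (1::real)"
  have "{2 ^ Suc k..<2 ^ Suc (Suc k)} = {2 * 2 ^ k..<2 * 2 ^ Suc k :: nat}" by simp
  moreover have "(2::nat) ^ k \<le> 2 ^ Suc k" by simp
  ultimately have "(\<Sum>a\<in>{2 ^ Suc k..<2 ^ Suc (Suc k)}. chi a j * chi a j') =
    (\<Sum>a\<in>{2 ^ k..<2 ^ Suc k}. chi (2 * a) j * chi (2 * a) j' + chi (Suc (2 * a)) j * chi (Suc (2 * a)) j')"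
    by (simp only: sum_double_interval)
  also have "\<dots> = (\<Sum>a\<in>{2 ^ k..<2 ^ Suc k}. (1 + ?s j * ?s j') * (chi a (j div 2) * chi a (j' div 2)))"
    by (intro sum.cong refl) (simp only: chi_double, simp add: algebra_simps)
  also have "\<dots> = (1 + ?s j * ?s j') * (\<Sum>a\<in>{2 ^ k..<2 ^ Suc k}. chi a (j div 2) * chi a (j' div 2))"
    by (simp only: sum_distrib_left)
  also have "\<dots> \<le> 0"
  proof (cases "even j = even j'")
    case True
    then have "j div 2 \<noteq> j' div 2" using Suc.prems(1) by (metis dvd_div_mult_self odd_two_times_div_two_succ)
    moreover have "j div 2 < 2 ^ Suc k" "j' div 2 < 2 ^ Suc k" using Suc.prems by auto
    ultimately have "(\<Sum>a\<in>{2 ^ k..<2 ^ Suc k}. chi a (j div 2) * chi a (j' div 2)) \<le> 0"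
      using Suc.IH by blast
    then show ?thesis using True by (auto simp: mult_le_0_iff)
  qed auto
  finally show ?case .
qed

text \<open>Chebyshev's argument: by nonpositive correlation the squares of the sign sums over
  \<open>Z\<close> add up to at most \<open>card Z * 2 ^ k\<close>, and each mask that is constant
  on \<open>Z\<close> contributes \<open>(card Z)\<^sup>2\<close> to this.\<close>

lemma card_constant_masks:
  assumes Z: "Z \<subseteq> {..<2 ^ Suc k}"
  shows "card Z * card {a \<in> {2 ^ k..<2 ^ Suc k}. \<forall>j\<in>Z. par a j = x} \<le> 2 ^ k"
proof (cases "Z = {}")
  case False
  let ?A = "{2 ^ k..<2 ^ Suc k} :: nat set"
  let ?B = "{a \<in> ?A. \<forall>j\<in>Z. par a j = x}"
  have fZ: "finite Z" using Z finite_subset by blast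
  have cA: "real (card ?A) = 2 ^ k" by simp
  have "(\<Sum>a\<in>?A. (\<Sum>j\<in>Z. chi a j)\<^sup>2) = (\<Sum>a\<in>?A. \<Sum>j\<in>Z. \<Sum>j'\<in>Z. chi a j * chi a j')"
    by (simp add: power2_eq_square sum_product)
  also have "\<dots> = (\<Sum>j\<in>Z. \<Sum>j'\<in>Z. \<Sum>a\<in>?A. chi a j * chi a j')"
    by (subst sum.swap) (intro sum.cong refl sum.swap)
  also have "\<dots> \<le> (\<Sum>j\<in>Z. \<Sum>j'\<in>Z. if j = j' then 2 ^ k else 0)"
  proof (intro sum_mono)
    fix j j' assume j: "j \<in> Z" "j' \<in> Z"
    show "(\<Sum>a\<in>?A. chi a j * chi a j') \<le> (if j = j' then 2 ^ k else 0)"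
    proof (cases "j = j'")
      case True
      have "(\<Sum>a\<in>?A. chi a j * chi a j') = (\<Sum>a\<in>?A. 1)"
        by (rule sum.cong) (auto simp: True chi_def)
      then show ?thesis using True by simp
    next
      case False
      then show ?thesis using sum_chi_mult_le_0[of j j' k] j Z by auto
    qed
  qed
  also have "\<dots> = real (card Z) * 2 ^ k" using fZ by simp
  finally have up: "(\<Sum>a\<in>?A. (\<Sum>j\<in>Z. chi a j)\<^sup>2) \<le> real (card Z) * 2 ^ k" .
  have "real (card ?B) * (real (card Z))\<^sup>2 = (\<Sum>a\<in>?B. (\<Sum>j\<in>Z. chi a j)\<^sup>2)"
  proof -
    have "(\<Sum>j\<in>Z. chi a j)\<^sup>2 = (real (card Z))\<^sup>2" if "a \<in> ?B" for a
    proof -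
      have "(\<Sum>j\<in>Z. chi a j) = (\<Sum>j\<in>Z. if x then - 1 else 1)"
        by (rule sum.cong) (use that in \<open>auto simp: chi_def\<close>)
      then show ?thesis by simp
    qed
    then show ?thesis by (simp del: mem_Collect_eq)
  qed
  also have "\<dots> \<le> (\<Sum>a\<in>?A. (\<Sum>j\<in>Z. chi a j)\<^sup>2)"
    by (rule sum_mono2) auto
  also note up
  finally have "real (card Z) * (real (card Z) * real (card ?B)) \<le> real (card Z) * 2 ^ k"
    by (simp add: power2_eq_square mult_ac)
  moreover have "real (card Z) > 0" using False fZ by (simp add: card_gt_0_iff)
  ultimately have "real (card Z) * real (card ?B) \<le> 2 ^ k" by simp
  then have "real (card Z * card ?B) \<le> real (2 ^ k)" by simp
  then show ?thesis by (simp only: of_nat_le_iff)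
qed simp

lemma par_pow2: "par a (2 ^ i) = odd (a div 2 ^ i)"
proof (induction i arbitrary: a)
  case 0
  have "par (a div 2) 0 = False"
  proof (induction "a div 2" arbitrary: a rule: less_induct)
    case less
    show ?case
    proof (cases "a div 2 = 0")
      case False
      then have "par (a div 2 div 2) 0 = False" using less[of "a div 2"] by auto
      then show ?thesis by (subst par_rec) simp
    qed simp
  qed
  then show ?case by (subst par_rec) simp
next
  case (Suc i)
  then show ?case by (subst par_rec) (simp add: div_mult2_eq)
qed

lemma masks_eqI:
  assumes "a < 2 ^ k" "a' < 2 ^ k" "\<And>i. i < k \<Longrightarrow> par a (2 ^ i) = par a' (2 ^ i)"
  shows "a = a'"
proof (rule bit_eqI)
  fix i
  have "x div 2 ^ i = 0" if "x < 2 ^ k" "\<not> i < k" for x :: nat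
  proof -
    have "(2::nat) ^ k \<le> 2 ^ i" using that(2) by simp
    then have "x < 2 ^ i" using that(1) by linarith
    then show ?thesis by simp
  qed
  then show "bit a i = bit a' i"
    using assms by (cases "i < k") (auto simp: bit_iff_odd par_pow2)
qed

section \<open>The two sides as sets of vertices\<close>

lemma rk_mono: "i \<le> i' \<Longrightarrow> rk P i \<le> rk P i'"
  by (auto simp: rk_def intro!: card_mono)

lemma rk_strict: "P u \<Longrightarrow> u < u' \<Longrightarrow> P u' \<Longrightarrow> rk P (Suc u) < rk P (Suc u')"
  using rk_mono[of "Suc u" u' P] by (simp add: rk_Suc)

lemma inj_rk: "inj_on (\<lambda>u. rk P (Suc u)) {u. P u}"
proof (rule inj_onI)
  fix u u' assume "u \<in> {u. P u}" "u' \<in> {u. P u}" "rk P (Suc u) = rk P (Suc u')"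
  then show "u = u'"
    using rk_strict[of P u u'] rk_strict[of P u' u] by (cases u u' rule: linorder_cases) auto
qed

lemma ex_rk: "0 < j \<Longrightarrow> j \<le> rk P m \<Longrightarrow> \<exists>u<m. P u \<and> rk P (Suc u) = j"
proof (induction m)
  case (Suc m)
  show ?case
  proof (cases "j \<le> rk P m")
    case True
    then show ?thesis using Suc by (auto intro: less_SucI)
  next
    case False
    then have "P m" "rk P (Suc m) = j" using Suc.prems by (auto simp: rk_Suc split: if_splits)
    then show ?thesis by blast
  qed
qed simp

text \<open>The numbering is injective with values below \<open>2 ^ Suc (lg n)\<close>, where
  \<open>n = rk P m\<close>, so the bound on constant masks carries over from numbers to
  vertices.\<close>

lemma side_empty_card:
  assumes n: "rk P m > 0" and W: "W \<subseteq> {u. u < m \<and> P u}"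
  shows "card W * card {a \<in> {2 ^ lg (rk P m)..<2 ^ Suc (lg (rk P m))}. \<forall>u\<in>W. \<not> side neg P a u} \<le> 2 ^ lg (rk P m)"
proof -
  let ?k = "lg (rk P m)"
  let ?Z = "(\<lambda>u. rk P (Suc u)) ` W"
  have "inj_on (\<lambda>u. rk P (Suc u)) W" by (rule inj_on_subset[OF inj_rk]) (use W in auto)
  then have c: "card ?Z = card W" by (rule card_image)
  have "?Z \<subseteq> {..<2 ^ Suc ?k}"
  proof (rule image_subsetI)
    fix u assume "u \<in> W"
    then have "rk P (Suc u) \<le> rk P m" using W by (intro rk_mono) auto
    then show "rk P (Suc u) \<in> {..<2 ^ Suc ?k}" using lg_bounds(2)[OF n] by simp
  qed
  from card_constant_masks[OF this, of neg] c
  have "card W * card {a \<in> {2 ^ ?k..<2 ^ Suc ?k}. \<forall>j\<in>?Z. par a j = neg} \<le> 2 ^ ?k" by simp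
  moreover have "(\<forall>j\<in>?Z. par a j = neg) \<longleftrightarrow> (\<forall>u\<in>W. \<not> side neg P a u)" for a
    using W by (auto simp: side_def)
  ultimately show ?thesis by simp
qed

text \<open>The element numbered \<open>2 ^ lg n\<close>, for \<open>n = rk P m\<close>, meets only
  the leading digit of the mask, so it is odd. The digits of 3 are those of 1 and 2 combined, so the
  elements numbered 1, 2 and 3 are not all odd.\<close>

lemma side_nonempty:
  assumes n: "4 \<le> rk P m" and a: "a \<in> {2 ^ lg (rk P m)..<2 ^ Suc (lg (rk P m))}"
  shows "\<exists>u<m. side neg P a u"
proof -
  let ?k = "lg (rk P m)"
  have n0: "rk P m > 0" using n by simp
  have "\<exists>j. 0 < j \<and> j \<le> rk P m \<and> par a j \<noteq> neg"
  proof (cases neg)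
    case False
    have "a div 2 ^ ?k = 1"
      using a by (intro div_nat_eqI) auto
    then have "par a (2 ^ ?k)" by (simp add: par_pow2)
    then show ?thesis using False lg_bounds(1)[OF n0] by (intro exI[of _ "2 ^ ?k"]) auto
  next
    case True
    have "par a 1 = odd a" using par_pow2[of a 0] by simp
    moreover have "par a 2 = odd (a div 2)" using par_pow2[of a 1] by simp
    moreover have "par a 3 = (odd a \<noteq> odd (a div 2))"
      using par_pow2[of "a div 2" 0] by (subst par_rec) simp
    ultimately have "\<not> par a 1 \<or> \<not> par a 2 \<or> \<not> par a 3" by auto
    then show ?thesis using True n by (auto intro: exI[of _ 1] exI[of _ 2] exI[of _ 3])
  qed
  then obtain j where j: "0 < j" "j \<le> rk P m" "par a j \<noteq> neg" by blast
  from ex_rk[OF j(1,2)] obtain u where "u < m" "P u" "rk P (Suc u) = j" by blast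
  then show ?thesis using j(3) by (auto simp: side_def)
qed

text \<open>All powers of two up to the number of elements occur as numbers, and the sides on which
  these elements lie spell out the digits of the mask.\<close>

lemma side_inj:
  assumes n: "0 < rk P m" and a: "a < 2 ^ Suc (lg (rk P m))" "a' < 2 ^ Suc (lg (rk P m))"
    and eq: "\<And>u. u < m \<Longrightarrow> side neg P a u = side neg P a' u"
  shows "a = a'"
proof (rule masks_eqI[OF a])
  fix i assume "i < Suc (lg (rk P m))"
  then have "(2::nat) ^ i \<le> 2 ^ lg (rk P m)" by simp
  then have "2 ^ i \<le> rk P m" using lg_bounds(1)[OF n] by linarith
  then obtain u where "u < m" "P u" "rk P (Suc u) = 2 ^ i" using ex_rk[of "2 ^ i" P m] by auto
  then show "par a (2 ^ i) = par a' (2 ^ i)" using eq[of u] by (auto simp: side_def)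
qed

section \<open>The listing and its encoding\<close>

text \<open>One list serves two purposes: its encoding is what the machine writes, and its weights
  define the distribution.\<close>

definition listing :: "nat \<Rightarrow> (nat \<Rightarrow> nat \<Rightarrow> bool) \<Rightarrow> (nat \<Rightarrow> bool) \<Rightarrow> (nat set \<times> nat set \<times> nat \<times> nat) list" where
  "listing m E g = ({}, {}, 1, Suc (rk g m)) #
     concat (map (\<lambda>v. let k = lg (rk (E v) m) in
       map (\<lambda>a. ({u. u < m \<and> side False (E v) a u}, {u. u < m \<and> side True (E v) a u}, 1, Suc (rk g m) * 2 ^ k))
         [2 ^ k..<2 ^ Suc k]) (filter g [0..<m]))"

lemma bit_vector_cong: "(\<And>u. u < n \<Longrightarrow> P u = Q u) \<Longrightarrow> bit_vector n P = bit_vector n Q"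
  by (auto simp: bit_vector_def)

lemma encode_listing_append: "encode_listing m (xs @ ys) = encode_listing m xs @ encode_listing m ys"
  by (simp add: encode_listing_def)

lemma concat_map_filter_if:
  "concat (map f (filter g xs)) = concat (map (\<lambda>x. if g x then f x else []) xs)"
  by (induction xs) auto

lemma (in layout) listing_out_eq:
  "listing_out b = encode_listing m (listing m R (good b))"
proof -
  let ?q = "Suc (gc b m)"
  have e: "entry ?q k v a = encode_listing m [({u. u < m \<and> side False (R v) a u}, {u. u < m \<and> side True (R v) a u}, 1, ?q * 2 ^ k)]" for k v a
  proof -
    have "bit_vector m (\<lambda>u. u \<in> {u. u < m \<and> P u}) = bit_vector m P" for P
      by (rule bit_vector_cong) simp
    moreover have "binary (?q * 2 ^ k) = rev (lsb ?q) @ replicate k 2"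
      using binary_mult_pow2[of ?q k] binary_lsb[of ?q] by simp
    moreover have "binary 1 = [3]" by (simp add: binary.simps)
    ultimately show ?thesis by (simp add: entry_def encode_listing_def)
  qed
  have e2: "concat (map (entry ?q k v) as) = encode_listing m (map (\<lambda>a. ({u. u < m \<and> side False (R v) a u}, {u. u < m \<and> side True (R v) a u}, 1, ?q * 2 ^ k)) as)" for k v as
    by (induction as) (simp_all add: e encode_listing_def)
  have "encode_listing m (concat (map h vs)) = concat (map (\<lambda>v. encode_listing m (h v)) vs)" for h and vs :: "nat list"
    by (induction vs) (simp_all add: encode_listing_append, simp add: encode_listing_def)
  moreover have "entries b ?q v = encode_listing m (if good b v then let k = lg (rk (R v) m) in
       map (\<lambda>a. ({u. u < m \<and> side False (R v) a u}, {u. u < m \<and> side True (R v) a u}, 1, ?q * 2 ^ k))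
         [2 ^ k..<2 ^ Suc k] else [])" for v
    by (cases "good b v") (simp_all only: entries_def e2 Let_def if_True if_False, simp add: encode_listing_def)
  ultimately have "concat (map (\<lambda>v. entries b ?q v) [0..<m]) =
    encode_listing m (concat (map (\<lambda>v. let k = lg (rk (R v) m) in
       map (\<lambda>a. ({u. u < m \<and> side False (R v) a u}, {u. u < m \<and> side True (R v) a u}, 1, ?q * 2 ^ k))
         [2 ^ k..<2 ^ Suc k]) (filter (good b) [0..<m])))"
    by (simp only: concat_map_filter_if)
  moreover have "encode_listing m [({}, {}, 1, ?q)] =
     bit_vector m (\<lambda>_. False) @ [4] @ bit_vector m (\<lambda>_. False) @ [4] @ [3, 4] @ rev (lsb ?q) @ [4]"
    using binary_lsb[of ?q] by (simp add: encode_listing_def binary.simps[of "Suc 0"])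
  ultimately show ?thesis
    using encode_listing_append[of m "[({}, {}, 1, ?q)]"]
    by (simp add: listing_out_def listing_def Let_def)
qed

lemma length_concat_equal_length:
  "(\<And>v. v < n \<Longrightarrow> length (f v) = l) \<Longrightarrow> length (concat (map f [0..<n])) = n * l"
  by (induction n) auto

lemma nth_concat_equal_length:
  assumes "\<And>v. v < n \<Longrightarrow> length (f v) = l" "v < n" "i < l"
  shows "(concat (map f [0..<n]) @ ys) ! (v * l + i) = f v ! i"
  using assms
proof (induction n arbitrary: ys)
  case (Suc n)
  have len: "length (concat (map f [0..<n])) = n * l"
    using Suc.prems(1) by (intro length_concat_equal_length) simp
  show ?case
  proof (cases "v < n")
    case True
    then show ?thesis using Suc.IH[of "f n @ ys"] Suc.prems by simp
  next
    case False
    then have "v = n" using Suc.prems by simp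
    then show ?thesis using len Suc.prems by (simp add: nth_append)
  qed
qed simp

lemma clean_binary: "clean (binary n)"
proof (induction n rule: binary.induct)
  case (1 n)
  then show ?case by (subst binary.simps) auto
qed

lemma clean_concat: "clean (concat xss) \<longleftrightarrow> (\<forall>xs\<in>set xss. clean xs)"
  by (induction xss) auto

text \<open>The clock \<open>m ^ 5\<close> comes from
  \<open>Suc (Suc m * Suc m) \<le> 5 * (m * m) \<le> m ^ 5\<close>, valid from \<open>m = 2\<close>
  on.\<close>

lemma layout_encode_input:
  assumes m: "m \<ge> 2"
  shows "layout (m ^ 5) m (encode_input m G c) (\<lambda>v u. if v = m then c u else Upair v u \<in># edges G)"
proof -
  let ?R = "\<lambda>v u. if v = m then c u else Upair v u \<in># edges G"
  let ?f = "\<lambda>v. bit_vector m (?R v) @ [4]"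
  let ?rest = "concat (map (\<lambda>(u, v). binary (count (edges G) (Upair u v)) @ [sep]) (List.product [0..<m] [0..<m]))"
  have enc: "encode_input m G c = concat (map ?f [0..<Suc m]) @ ?rest"
  proof -
    have "map ?f [0..<m] = map (\<lambda>u. bit_vector m (\<lambda>v. Upair u v \<in># edges G) @ [sep]) [0..<m]"
      by (rule map_cong) auto
    moreover have "concat (map ?f [0..<Suc m]) = concat (map ?f [0..<m]) @ bit_vector m c @ [4]"
      by simp
    ultimately show ?thesis by (simp only: encode_input_def append_assoc)
  qed
  have len: "length (?f v) = Suc m" for v by (simp add: bit_vector_def)
  have lenc: "length (concat (map ?f [0..<Suc m])) = Suc m * Suc m"
    by (rule length_concat_equal_length) (rule len)
  have nth: "tape_of (encode_input m G c) (Suc (v * Suc m) + i) = ?f v ! i" if "v \<le> m" "i \<le> m" for v i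
  proof -
    have "v * Suc m \<le> m * Suc m" using that(1) by (rule mult_le_mono1)
    then have "v * Suc m + i < Suc m * Suc m" using that(2) by simp
    then have "tape_of (encode_input m G c) (Suc (v * Suc m) + i) = encode_input m G c ! (v * Suc m + i)"
      using lenc unfolding tape_of_def enc by simp
    also have "\<dots> = ?f v ! i"
      unfolding enc by (rule nth_concat_equal_length) (use that len in auto)
    finally show ?thesis .
  qed
  have m5: "Suc (Suc m * Suc m) \<le> m ^ 5"
  proof -
    have "Suc m \<le> 2 * m" using m by simp
    then have "Suc m * Suc m \<le> 2 * m * (2 * m)" by (rule mult_le_mono) (use m in simp)
    moreover have "1 \<le> m * m" using m by (simp add: Suc_le_eq)
    ultimately have "Suc (Suc m * Suc m) \<le> 5 * (m * m)" by simp
    also have "\<dots> \<le> (m * m * m) * (m * m)"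
    proof (rule mult_le_mono1)
      have "2 * 2 * 2 \<le> m * m * m" using m by (intro mult_le_mono)
      then show "5 \<le> m * m * m" by simp
    qed
    also have "\<dots> = m ^ 5" by (simp add: numeral_eq_Suc)
    finally show ?thesis .
  qed
  show ?thesis
  proof
    have "2 * 2 \<le> m * m" using m by (intro mult_le_mono)
    then show "3 \<le> m ^ 5" using m5 m by simp
    show "clean (encode_input m G c)"
      by (auto simp: encode_input_def clean_concat clean_binary)
    show "tape_of (encode_input m G c) (Suc (v * Suc m) + u) = bit_sym (?R v u)" if "v \<le> m" "u < m" for v u
      unfolding nth[OF that(1) less_imp_le[OF that(2)]] using that by (simp add: nth_append bit_vector_def)
    show "tape_of (encode_input m G c) (Suc (v * Suc m) + m) = 4" if "v \<le> m" for v
      unfolding nth[OF that le_refl] by (simp add: nth_append bit_vector_def)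
    show "Suc (Suc m * Suc m) \<le> m ^ 5" by (rule m5)
    show "0 < m" using m by simp
  qed
qed

section \<open>The hitting distribution\<close>

lemma distinct_concat_map_inj:
  assumes "distinct vs" "\<And>v. distinct (as v)"
    and "\<And>v v' a a'. v \<in> set vs \<Longrightarrow> v' \<in> set vs \<Longrightarrow> a \<in> set (as v) \<Longrightarrow> a' \<in> set (as v') \<Longrightarrow>
      f v a = f v' a' \<Longrightarrow> v = v' \<and> a = a'"
  shows "distinct (concat (map (\<lambda>v. map (f v) (as v)) vs))"
  using assms(1,3)
proof (induction vs)
  case (Cons v vs)
  have "distinct (map (f v) (as v))"
    using Cons.prems(2)[of v v] assms(2) by (auto simp: distinct_map inj_on_def)
  moreover have "set (map (f v) (as v)) \<inter> set (concat (map (\<lambda>v. map (f v) (as v)) vs)) = {}"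
  proof -
    have "f v a \<noteq> f v' a'" if "a \<in> set (as v)" "v' \<in> set vs" "a' \<in> set (as v')" for a v' a'
      using Cons.prems(2)[of v v' a a'] Cons.prems(1) that by auto
    then show ?thesis by fastforce
  qed
  moreover have "distinct (concat (map (\<lambda>v. map (f v) (as v)) vs))"
    by (rule Cons.IH) (use Cons.prems in auto)
  ultimately show ?case by simp
qed simp

lemma sum_list_filter_key:
  fixes xs :: "('a \<times> real) list"
  assumes "distinct (map fst xs)" "(x, p) \<in> set xs"
  shows "sum_list (map snd (filter (\<lambda>z. fst z = x) xs)) = p"
  using assms
proof (induction xs)
  case (Cons z xs)
  show ?case
  proof (cases "fst z = x")
    case True
    then have "filter (\<lambda>z. fst z = x) xs = []" using Cons.prems by (auto simp: filter_empty_conv image_iff)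
    moreover have "snd z = p" using Cons.prems True by (cases z) (auto simp: image_iff)
    ultimately show ?thesis using True by simp
  next
    case False
    then show ?thesis using Cons by auto
  qed
qed simp

section \<open>The distribution of a family of split neighbourhoods\<close>

text \<open>\<open>uniq\<close> is the hypothesis on common neighbours seen from the other side: two
  distinct points lie together in at most one neighbourhood.\<close>

locale splitting =
  fixes m :: nat and E :: "nat \<Rightarrow> nat \<Rightarrow> bool" and g :: "nat \<Rightarrow> bool"
  assumes large: "\<And>v. v < m \<Longrightarrow> g v \<Longrightarrow> 4 \<le> rk (E v) m"
    and uniq: "\<And>v v' x y. v < m \<Longrightarrow> v' < m \<Longrightarrow> x < m \<Longrightarrow> y < m \<Longrightarrow> x \<noteq> y \<Longrightarrow>
      E v x \<Longrightarrow> E v y \<Longrightarrow> E v' x \<Longrightarrow> E v' y \<Longrightarrow> v = v'"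
begin

definition masks :: "nat \<Rightarrow> nat set" where
  "masks v = {2 ^ lg (rk (E v) m)..<2 ^ Suc (lg (rk (E v) m))}"

definition lside :: "nat \<Rightarrow> nat \<Rightarrow> nat set" where
  "lside v a = {u. u < m \<and> side False (E v) a u}"

definition rside :: "nat \<Rightarrow> nat \<Rightarrow> nat set" where
  "rside v a = {u. u < m \<and> side True (E v) a u}"

definition rect :: "nat \<Rightarrow> nat \<Rightarrow> (nat \<times> nat) set" where
  "rect v a = lside v a \<times> rside v a"

lemma sides_nonempty: "v < m \<Longrightarrow> g v \<Longrightarrow> a \<in> masks v \<Longrightarrow> lside v a \<noteq> {} \<and> rside v a \<noteq> {}"
  using side_nonempty[OF large, of v a] unfolding lside_def rside_def masks_def by blast

text \<open>A nonempty product determines its factors. One point from each factor gives two distinct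
  neighbours, which determine the vertex, and then the left factor alone determines the
  mask.\<close>

lemma rect_inj:
  assumes v: "v < m" "g v" "v' < m" "g v'" and a: "a \<in> masks v" "a' \<in> masks v'"
    and eq: "rect v a = rect v' a'"
  shows "v = v' \<and> a = a'"
proof -
  obtain x y where xy: "x \<in> lside v a" "y \<in> rside v a" using sides_nonempty v a by blast
  have eqs: "lside v a = lside v' a'" "rside v a = rside v' a'"
    using eq sides_nonempty[OF v(1,2) a(1)] by (auto simp: rect_def times_eq_iff)
  have "x \<noteq> y" using xy by (auto simp: lside_def rside_def side_def)
  then have vv: "v = v'"
    using uniq[of v v' x y] v xy eqs by (auto simp: lside_def rside_def side_def)
  have "a = a'"
  proof (rule side_inj)
    show "0 < rk (E v) m" using large v by fastforce
    show "a < 2 ^ Suc (lg (rk (E v) m))" "a' < 2 ^ Suc (lg (rk (E v) m))"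
      using a vv by (auto simp: masks_def)
    show "side False (E v) a u = side False (E v) a' u" if "u < m" for u
      using eqs(1) vv that by (auto simp: lside_def set_eq_iff)
  qed
  then show ?thesis using vv by simp
qed

definition weighted :: "((nat \<times> nat) set \<times> real) list" where
  "weighted = map (\<lambda>(U, V, p, q). (U \<times> V, real p / real q)) (listing m E g)"

lemma weighted_eq:
  "weighted = ({}, 1 / real (Suc (rk g m))) #
     concat (map (\<lambda>v. map (\<lambda>a. (rect v a, 1 / (real (Suc (rk g m)) * 2 ^ lg (rk (E v) m))))
       [2 ^ lg (rk (E v) m)..<2 ^ Suc (lg (rk (E v) m))]) (filter g [0..<m]))"
  by (simp add: weighted_def listing_def map_concat comp_def Let_def rect_def lside_def rside_def
      del: upt_Suc power_Suc of_nat_Suc mult_Suc One_nat_def)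

lemma sum_weighted:
  fixes f :: "(nat \<times> nat) set \<times> real \<Rightarrow> real"
  shows "sum_list (map f weighted) = f ({}, 1 / real (Suc (rk g m))) +
    (\<Sum>v | v < m \<and> g v. \<Sum>a\<in>masks v. f (rect v a, 1 / (real (Suc (rk g m)) * 2 ^ lg (rk (E v) m))))"
proof -
  have "sum_list (map f (concat (map h vs))) = sum_list (map (\<lambda>v. sum_list (map f (h v))) vs)"
    for h :: "nat \<Rightarrow> ((nat \<times> nat) set \<times> real) list" and vs
    by (induction vs) auto
  moreover have "{v. v < m \<and> g v} = set (filter g [0..<m])" by auto
  ultimately show ?thesis
    by (simp add: weighted_eq comp_def masks_def sum_list_distinct_conv_sum_set
        del: upt_Suc power_Suc of_nat_Suc set_filter)
qed

lemma card_masks: "card (masks v) = 2 ^ lg (rk (E v) m)"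
  by (simp add: masks_def)

lemma weighted_wf: "pmf_of_list_wf weighted"
proof (rule pmf_of_list_wfI)
  show "x \<ge> 0" if "x \<in> set (map snd weighted)" for x
    using that by (auto simp: weighted_def)
  let ?q = "real (Suc (rk g m))"
  have "(\<Sum>a\<in>masks v. 1 / (?q * 2 ^ lg (rk (E v) m))) = 1 / ?q" for v
    by (simp add: card_masks)
  then have "sum_list (map snd weighted) = 1 / ?q + real (rk g m) * (1 / ?q)"
    by (simp add: sum_weighted rk_def del: of_nat_Suc)
  also have "\<dots> = 1" by (simp add: field_simps)
  finally show "sum_list (map snd weighted) = 1" .
qed

text \<open>\<open>pmf_of_list\<close> adds up the weights of equal entries; without repetitions the
  listed weight is the probability itself.\<close>

lemma distinct_weighted: "distinct (map fst weighted)"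
proof -
  have "distinct (concat (map (\<lambda>v. map (rect v) [2 ^ lg (rk (E v) m)..<2 ^ Suc (lg (rk (E v) m))]) (filter g [0..<m])))"
  proof (rule distinct_concat_map_inj)
    fix v v' a a' assume "v \<in> set (filter g [0..<m])" "v' \<in> set (filter g [0..<m])"
      "a \<in> set [2 ^ lg (rk (E v) m)..<2 ^ Suc (lg (rk (E v) m))]"
      "a' \<in> set [2 ^ lg (rk (E v') m)..<2 ^ Suc (lg (rk (E v') m))]" "rect v a = rect v' a'"
    then show "v = v' \<and> a = a'" by (intro rect_inj) (auto simp: masks_def)
  qed auto
  moreover have "{} \<noteq> rect v a" if "v < m" "g v" "a \<in> masks v" for v a
    using sides_nonempty[OF that] by (auto simp: rect_def)
  ultimately show ?thesis
    by (auto simp: weighted_eq map_concat comp_def masks_def simp del: upt_Suc power_Suc of_nat_Suc)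
qed

definition mu :: "(nat \<times> nat) set pmf" where
  "mu = pmf_of_list weighted"

lemma pmf_mu: "(x, p) \<in> set weighted \<Longrightarrow> pmf mu x = p"
  using sum_list_filter_key[OF distinct_weighted] by (simp add: mu_def pmf_pmf_of_list[OF weighted_wf])

lemma set_weighted:
  "set weighted = insert ({}, 1 / real (Suc (rk g m)))
     {(rect v a, 1 / (real (Suc (rk g m)) * 2 ^ lg (rk (E v) m))) | v a. v < m \<and> g v \<and> a \<in> masks v}"
  by (auto simp: weighted_eq masks_def simp del: upt_Suc power_Suc of_nat_Suc)

lemma set_mu: "set_pmf mu = fst ` set weighted"
proof
  show "set_pmf mu \<subseteq> fst ` set weighted"
    using set_pmf_of_list[OF weighted_wf] by (simp add: mu_def)
  show "fst ` set weighted \<subseteq> set_pmf mu"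
  proof
    fix x assume "x \<in> fst ` set weighted"
    then obtain p where p: "(x, p) \<in> set weighted" by auto
    then have "p > 0" unfolding set_weighted by auto
    then show "x \<in> set_pmf mu" using pmf_mu[OF p] by (simp add: set_pmf_iff)
  qed
qed

lemma mu_cases:
  assumes "x \<in> set_pmf mu"
  obtains "x = {}" | v a where "v < m" "g v" "a \<in> masks v" "x = rect v a"
  using assms unfolding set_mu set_weighted by auto

lemma pmf_mu_Rats: "pmf mu x \<in> \<rat>"
proof (cases "x \<in> set_pmf mu")
  case True
  then obtain p where p: "(x, p) \<in> set weighted" by (auto simp: set_mu)
  then have "p \<in> \<rat>" unfolding set_weighted by (auto simp del: of_nat_Suc)
  then show ?thesis using pmf_mu[OF p] by simp
next
  case False
  then show ?thesis by (simp add: set_pmf_iff)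
qed

lemma lists_mu: "lists_distribution m mu (encode_listing m (listing m E g))"
proof -
  have "map (\<lambda>(U, V, p, q). U \<times> V) (listing m E g) = map fst weighted"
    by (auto simp: weighted_def)
  moreover have "U \<subseteq> {..<m} \<and> V \<subseteq> {..<m} \<and> q > 0" if "(U, V, p, q) \<in> set (listing m E g)" for U V p q
    using that by (auto simp: listing_def Let_def simp del: upt_Suc power_Suc)
  moreover have "pmf mu (U \<times> V) = real p / real q" if "(U, V, p, q) \<in> set (listing m E g)" for U V p q
    by (rule pmf_mu) (use that in \<open>force simp: weighted_def\<close>)
  ultimately show ?thesis
    unfolding lists_distribution_def
    by (intro exI[of _ "listing m E g"] conjI)
      (simp_all only: distinct_weighted set_mu set_map, blast)
qed

text \<open>A mask misses only if it puts all neighbours from \<open>X\<close> on the right or all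
  those from \<open>Y\<close> on the left. Each of the two events takes at most 1/64 of the
  masks.\<close>

lemma masks_hit:
  assumes v: "v < m" "g v" and XY: "X \<subseteq> {..<m}" "Y \<subseteq> {..<m}"
    and c: "64 \<le> card {u \<in> X. E v u}" "64 \<le> card {u \<in> Y. E v u}"
  shows "31 * 2 ^ lg (rk (E v) m) \<le> 32 * card {a \<in> masks v. rect v a \<inter> (X \<times> Y) \<noteq> {}}"
proof -
  let ?k = "lg (rk (E v) m)"
  let ?MX = "{a \<in> masks v. \<forall>u\<in>{u \<in> X. E v u}. \<not> side False (E v) a u}"
  let ?MY = "{a \<in> masks v. \<forall>u\<in>{u \<in> Y. E v u}. \<not> side True (E v) a u}"
  let ?H = "{a \<in> masks v. rect v a \<inter> (X \<times> Y) \<noteq> {}}"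
  have n: "0 < rk (E v) m" using large v by fastforce
  have fin: "finite (masks v)" by (simp add: masks_def)
  have "card {u \<in> X. E v u} * card ?MX \<le> 2 ^ ?k" "card {u \<in> Y. E v u} * card ?MY \<le> 2 ^ ?k"
    unfolding masks_def by (rule side_empty_card[OF n]; use XY in auto)+
  then have "64 * card ?MX \<le> 2 ^ ?k" "64 * card ?MY \<le> 2 ^ ?k"
    using mult_le_mono1[OF c(1), of "card ?MX"] mult_le_mono1[OF c(2), of "card ?MY"] by linarith+
  moreover have "masks v \<subseteq> ?H \<union> (?MX \<union> ?MY)"
  proof
    fix a assume a: "a \<in> masks v"
    show "a \<in> ?H \<union> (?MX \<union> ?MY)"
    proof (cases "a \<in> ?MX \<or> a \<in> ?MY")
      case False
      then obtain x y where "x \<in> X" "side False (E v) a x" "y \<in> Y" "side True (E v) a y" using a by auto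
      then have "(x, y) \<in> rect v a \<inter> (X \<times> Y)" using XY by (auto simp: rect_def lside_def rside_def)
      then show ?thesis using a by blast
    qed auto
  qed
  then have "card (masks v) \<le> card (?H \<union> (?MX \<union> ?MY))"
    using fin by (intro card_mono) auto
  then have "card (masks v) \<le> card ?H + (card ?MX + card ?MY)"
    using card_Un_le[of ?H "?MX \<union> ?MY"] card_Un_le[of ?MX ?MY] by linarith
  ultimately show ?thesis by (simp add: card_masks)
qed

lemma prob_hit:
  assumes XY: "X \<subseteq> {..<m}" "Y \<subseteq> {..<m}"
  shows "31 / 32 * real (card {v. v < m \<and> g v \<and> 64 \<le> card {u \<in> X. E v u} \<and> 64 \<le> card {u \<in> Y. E v u}})
    / real (Suc (rk g m)) \<le> measure_pmf.prob mu {R. R \<inter> (X \<times> Y) \<noteq> {}}"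
proof -
  let ?q = "real (Suc (rk g m))"
  let ?A = "{R. R \<inter> (X \<times> Y) \<noteq> {}}"
  let ?G = "{v. v < m \<and> g v \<and> 64 \<le> card {u \<in> X. E v u} \<and> 64 \<le> card {u \<in> Y. E v u}}"
  let ?s = "\<lambda>v. \<Sum>a\<in>masks v. if rect v a \<in> ?A then 1 / (?q * 2 ^ lg (rk (E v) m)) else 0"
  have "31 / 32 / ?q \<le> ?s v" if "v \<in> ?G" for v
  proof -
    let ?k = "lg (rk (E v) m)"
    have "?s v = real (card {a \<in> masks v. rect v a \<inter> (X \<times> Y) \<noteq> {}}) * (1 / (?q * 2 ^ ?k))"
      by (subst sum.inter_filter[symmetric]) (auto simp: masks_def)
    moreover have "31 * 2 ^ ?k \<le> 32 * card {a \<in> masks v. rect v a \<inter> (X \<times> Y) \<noteq> {}}"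
      using masks_hit[OF _ _ XY, of v] that by simp
    then have "real (31 * 2 ^ ?k) \<le> real (32 * card {a \<in> masks v. rect v a \<inter> (X \<times> Y) \<noteq> {}})"
      by (simp only: of_nat_le_iff)
    then have "31 / 32 * 2 ^ ?k \<le> real (card {a \<in> masks v. rect v a \<inter> (X \<times> Y) \<noteq> {}})" by simp
    then have "31 / 32 * 2 ^ ?k * (1 / (?q * 2 ^ ?k)) \<le>
       real (card {a \<in> masks v. rect v a \<inter> (X \<times> Y) \<noteq> {}}) * (1 / (?q * 2 ^ ?k))"
      by (rule mult_right_mono) simp
    ultimately show ?thesis by (simp del: of_nat_Suc)
  qed
  then have "(\<Sum>v\<in>?G. 31 / 32 / ?q) \<le> (\<Sum>v\<in>?G. ?s v)" by (rule sum_mono)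
  also have "\<dots> \<le> (\<Sum>v | v < m \<and> g v. ?s v)"
    by (rule sum_mono2) (auto intro!: sum_nonneg)
  \<comment> \<open>The empty rectangle meets nothing, so its term drops out.\<close>
  also have "\<dots> = measure_pmf.prob mu ?A"
    by (simp add: mu_def measure_pmf_of_list[OF weighted_wf] sum_list_map_filter' sum_weighted del: of_nat_Suc cong: if_cong)
  finally show ?thesis by (simp del: of_nat_Suc)
qed

end

section \<open>Vertices with few neighbours in a large set\<close>

lemma ex_disjoint_subsets:
  assumes "finite X" "n * s \<le> card X"
  shows "\<exists>P. (\<forall>i<n. P i \<subseteq> X \<and> card (P i) = s) \<and> (\<forall>i<n. \<forall>j<n. i \<noteq> j \<longrightarrow> P i \<inter> P j = {})"
  using assms
proof (induction n arbitrary: X)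
  case (Suc n)
  obtain T where T: "T \<subseteq> X" "card T = s" "finite T"
    using obtain_subset_with_card_n[of s X] Suc.prems by auto
  have "n * s \<le> card (X - T)" using Suc.prems T by (simp add: card_Diff_subset)
  then obtain P where P: "\<forall>i<n. P i \<subseteq> X - T \<and> card (P i) = s" "\<forall>i<n. \<forall>j<n. i \<noteq> j \<longrightarrow> P i \<inter> P j = {}"
    using Suc.IH[of "X - T"] Suc.prems by auto
  show ?case
  proof (intro exI[of _ "P(n := T)"] conjI allI impI)
    fix i assume i: "i < Suc n"
    show "(P(n := T)) i \<subseteq> X" "card ((P(n := T)) i) = s"
      using P(1) T i by (cases "i = n"; force simp: less_Suc_eq)+
    fix j assume "j < Suc n" "i \<noteq> j"
    then show "(P(n := T)) i \<inter> (P(n := T)) j = {}"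
      using P i by (fastforce simp: less_Suc_eq)
  qed
qed simp

text \<open>A vertex with a neighbour in each of 64 disjoint pieces has 64 neighbours in
  \<open>X\<close>. Rounding down costs the pieces at most a factor 2, and 64 exceptional sets of at
  most \<open>128 / 2 ^ 100 * m\<close> vertices each make up less than m / 4000.\<close>

lemma card_few_neighbours_le:
  assumes ex: "spectral_expander m d \<gamma> G" and \<gamma>: "\<gamma> > 0" and mg: "real m \<ge> 1 / \<gamma>\<^sup>2"
    and X: "X \<subseteq> {..<m}" and big: "2 ^ 100 * \<gamma>\<^sup>2 * real m \<le> real (card X)"
  shows "real (card {v. v < m \<and> card (nbrs G {v} \<inter> X) < 64}) \<le> real m / 4000"
proof -
  have fX: "finite X" using X finite_subset by blast
  have gm: "1 \<le> \<gamma>\<^sup>2 * real m" using mg \<gamma> by (simp add: field_simps)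
  \<comment> \<open>This keeps the pieces nonempty and leaves at least two vertices, which the
    positivity of the degree requires.\<close>
  then have X100: "2 ^ 100 \<le> real (card X)" using big by simp
  have "card X \<le> m" using card_mono[OF _ X] by simp
  then have "real (card X) \<le> real m" by simp
  then have "m \<ge> 2" using X100 by simp
  then have d: "d > 0" by (rule expander_degree_pos[OF ex])
  define s where "s = card X div 64"
  have s: "real s \<ge> real (card X) / 128" "64 * s \<le> card X"
  proof -
    have "card X < 64 * s + 64" unfolding s_def by presburger
    then have "real (card X) \<le> 64 * real s + 64" by linarith
    then show "real s \<ge> real (card X) / 128" using X100 by simp
    show "64 * s \<le> card X" unfolding s_def by presburger
  qed
  then have s0: "s > 0" using X100 by (cases s) auto
  obtain P :: "nat \<Rightarrow> nat set" where
    "(\<forall>i<64. P i \<subseteq> X \<and> card (P i) = s) \<and> (\<forall>i<64. \<forall>j<64. i \<noteq> j \<longrightarrow> P i \<inter> P j = {})"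
    using ex_disjoint_subsets[OF fX s(2)] by (elim exE)
  then have P: "\<And>i. i < 64 \<Longrightarrow> P i \<subseteq> X \<and> card (P i) = s"
    "\<And>i j. i < 64 \<Longrightarrow> j < 64 \<Longrightarrow> i \<noteq> j \<Longrightarrow> P i \<inter> P j = {}"
    by simp_all
  let ?B = "\<lambda>i. {v. v < m \<and> nbrs G {v} \<inter> P i = {}}"
  have sub: "{v. v < m \<and> card (nbrs G {v} \<inter> X) < 64} \<subseteq> (\<Union>i<64. ?B i)"
  proof (rule ccontr)
    assume "\<not> ?thesis"
    then obtain v where v: "v < m" "card (nbrs G {v} \<inter> X) < 64" "\<And>i. i < 64 \<Longrightarrow> nbrs G {v} \<inter> P i \<noteq> {}"
      by blast
    then have "\<forall>i. \<exists>u. i < 64 \<longrightarrow> u \<in> nbrs G {v} \<inter> P i" by blast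
    then obtain f where f: "\<And>i. i < 64 \<Longrightarrow> f i \<in> nbrs G {v} \<inter> P i" by metis
    have "inj_on f {..<64::nat}"
      using f P(2) by (intro inj_onI) (metis IntD2 disjoint_iff lessThan_iff)
    then have "card (f ` {..<64}) = 64" by (simp add: card_image)
    moreover have "f ` {..<64} \<subseteq> nbrs G {v} \<inter> X" using f P(1) by blast
    then have "card (f ` {..<64}) \<le> card (nbrs G {v} \<inter> X)" using fX by (intro card_mono) auto
    ultimately show False using v(2) by simp
  qed
  have B: "real (card (?B i)) \<le> 128 / 2 ^ 100 * real m" if "i < 64" for i
  proof -
    have "P i \<noteq> {}" using P(1)[OF that] s0 by auto
    then have "real (card (?B i)) \<le> \<gamma>\<^sup>2 * (real m)\<^sup>2 / real s"
      using card_avoiding_le[OF ex d, of "P i"] P(1)[OF that] X by auto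
    also have "\<dots> \<le> \<gamma>\<^sup>2 * (real m)\<^sup>2 / (2 ^ 100 * \<gamma>\<^sup>2 * real m / 128)"
    proof (rule divide_left_mono)
      show "2 ^ 100 * \<gamma>\<^sup>2 * real m / 128 \<le> real s" using s(1) big by linarith
    qed (use s0 \<gamma> \<open>m \<ge> 2\<close> in auto)
    also have "\<dots> = 128 / 2 ^ 100 * real m"
      using \<gamma> \<open>m \<ge> 2\<close> by (simp add: field_simps power2_eq_square)
    finally show ?thesis .
  qed
  have "card {v. v < m \<and> card (nbrs G {v} \<inter> X) < 64} \<le> card (\<Union>i<64. ?B i)"
    by (rule card_mono[OF _ sub]) auto
  also have "\<dots> \<le> (\<Sum>i<64. card (?B i))" by (rule card_UN_le) simp
  finally have "real (card {v. v < m \<and> card (nbrs G {v} \<inter> X) < 64}) \<le> (\<Sum>i<64. real (card (?B i)))"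
    unfolding of_nat_sum[symmetric] by (rule of_nat_mono)
  also have "\<dots> \<le> (\<Sum>i<(64::nat). 128 / 2 ^ 100 * real m)"
    by (rule sum_mono) (use B in auto)
  also have "\<dots> \<le> real m / 4000" by simp
  finally show ?thesis .
qed

text \<open>Without the floor this is an equality; rounding the exponent down only raises the size
  demanded of \<open>X\<close> and \<open>Y\<close>.\<close>

lemma hitting_threshold:
  assumes "\<gamma> > 0"
  shows "2 ^ 100 * \<gamma>\<^sup>2 \<le> 2 powr (- real_of_int (\<lfloor>2 * log 2 (1 / \<gamma>)\<rfloor> - 100))"
proof -
  have "2 ^ 100 * \<gamma>\<^sup>2 = 2 powr 100 * 2 powr (2 * log 2 \<gamma>)"
  proof -
    have "2 powr (2 * log 2 \<gamma>) = (2 powr log 2 \<gamma>) powr 2" by (simp add: powr_powr mult.commute)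
    also have "\<dots> = \<gamma>\<^sup>2" using assms by (simp add: powr_numeral)
    finally show ?thesis by (simp add: powr_numeral)
  qed
  also have "\<dots> = 2 powr (100 + 2 * log 2 \<gamma>)" by (simp only: powr_add)
  also have "\<dots> = 2 powr (100 - 2 * log 2 (1 / \<gamma>))" using assms by (simp add: log_divide)
  also have "\<dots> \<le> 2 powr (- real_of_int (\<lfloor>2 * log 2 (1 / \<gamma>)\<rfloor> - 100))"
    by (rule powr_mono) auto
  finally show ?thesis .
qed

text \<open>Balance is symmetric in the colours: the upper bound on one class is the lower bound on
  the other.\<close>

lemma color_class_large:
  assumes "balanced_coloring G c" "verts G = {..<m}"
  shows "real m / 3 \<le> real (card {v. v < m \<and> c v = b})"
proof (cases b)
  case True
  have "{v \<in> verts G. c v} = {v. v < m \<and> c v = b}" using True assms(2) by auto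
  then show ?thesis using assms by (simp add: balanced_coloring_def)
next
  case False
  have eq: "{v. v < m \<and> c v = b} = {..<m} - {v \<in> verts G. c v}" using False assms(2) by auto
  have "card {v. v < m \<and> c v = b} = m - card {v \<in> verts G. c v}"
    unfolding eq by (subst card_Diff_subset) (use assms(2) in auto)
  moreover have "card {v \<in> verts G. c v} \<le> m"
    using card_mono[of "{..<m}" "{v \<in> verts G. c v}"] assms(2) by auto
  ultimately show ?thesis using assms by (simp add: balanced_coloring_def of_nat_diff)
qed

theorem theorem2:
  fixes b :: bool
  shows "\<exists>k a M K. turing_machine k a M \<and>
    (\<forall>(m::nat) (d::nat) (\<gamma>::real) (G::nat multigraph) (c::nat \<Rightarrow> bool).
       spectral_expander m d \<gamma> G \<and>
       (\<forall>u \<in> verts G. \<forall>v \<in> verts G. u \<noteq> v \<longrightarrow> card (nbrs G {u} \<inter> nbrs G {v}) \<le> 1) \<and>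
       balanced_coloring G c \<and>
       \<gamma> > 0 \<and> real m \<ge> 1 / \<gamma>\<^sup>2 \<longrightarrow>
       (\<exists>\<mu> :: (nat \<times> nat) set pmf.
          (\<forall>R \<in> set_pmf \<mu>. rectangle (verts G) (verts G) R \<and> monochromatic (gadget G c) b R) \<and>
          hitting (1 / 10) (\<lfloor>2 * log 2 (1 / \<gamma>)\<rfloor> - 100) (verts G) (verts G) \<mu> \<and>
          (\<forall>R. pmf \<mu> R \<in> \<rat>) \<and>
          (\<exists>ys. computes_in k M (encode_input m G c) (m ^ K) ys \<and> lists_distribution m \<mu> ys)))"
proof (rule exI[of _ 6], rule exI[of _ 5], rule exI[of _ "compile (Lister b) 0"], rule exI[of _ 300],
    intro conjI allI impI; (elim conjE)?)
  show "turing_machine 6 5 (compile (Lister b) 0)"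
    by (rule turing_machine_compile[OF wf_Lister])
next
  fix m d :: nat and \<gamma> :: real and G :: "nat multigraph" and c :: "nat \<Rightarrow> bool"
  assume ex: "spectral_expander m d \<gamma> G"
    and common: "\<forall>u \<in> verts G. \<forall>v \<in> verts G. u \<noteq> v \<longrightarrow> card (nbrs G {u} \<inter> nbrs G {v}) \<le> 1"
    and bal: "balanced_coloring G c" and \<gamma>: "\<gamma> > 0" and mg: "real m \<ge> 1 / \<gamma>\<^sup>2"
  have V: "verts G = {..<m}" using ex by (simp add: spectral_expander_def)
  \<comment> \<open>A single vertex has no balanced colouring, as a class size of 0 or 1 does not
    lie between 1/3 and 2/3.\<close>
  have m2: "m \<ge> 2"
  proof -
    have "m > 0" using mg \<gamma> by (cases m) auto
    moreover have "m \<noteq> 1"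
    proof
      assume "m = 1"
      then have "1 / 3 \<le> real (card {v \<in> verts G. c v}) \<and> real (card {v \<in> verts G. c v}) \<le> 2 / 3"
        using bal V by (simp add: balanced_coloring_def)
      then show False by (cases "card {v \<in> verts G. c v}") auto
    qed
    ultimately show ?thesis by simp
  qed
  define R where "R = (\<lambda>v u. if v = m then c u else Upair v u \<in># edges G)"
  interpret L: layout "m ^ 5" m "encode_input m G c" R
    unfolding R_def by (rule layout_encode_input[OF m2])
  have Rm: "R m = c" and RE: "\<And>v u. v < m \<Longrightarrow> R v u \<longleftrightarrow> Upair v u \<in># edges G"
    by (auto simp: R_def)
  have comm: "Upair x y = Upair y x" for x y :: nat by (simp add: Upair_inject)
  have nbr: "nbrs G {v} = {u. u < m \<and> R v u}" if "v < m" for v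
    using that V by (auto simp: nbrs_def RE)
  have uniq: "v = v'" if "v < m" "v' < m" "x < m" "y < m" "x \<noteq> y" "R v x" "R v y" "R v' x" "R v' y" for v v' x y
  proof -
    have "v \<in> nbrs G {x} \<inter> nbrs G {y}" "v' \<in> nbrs G {x} \<inter> nbrs G {y}"
      using that V by (auto simp: nbrs_def RE comm[of x] comm[of y])
    moreover have "finite (nbrs G {x} \<inter> nbrs G {y})" using V by (auto simp: nbrs_def)
    moreover have "card (nbrs G {x} \<inter> nbrs G {y}) \<le> Suc 0" using common that V by auto
    ultimately show ?thesis using card_le_Suc0_iff_eq by blast
  qed
  interpret D: splitting m R "L.good b"
  proof
    show "4 \<le> rk (R v) m" if "v < m" "L.good b v" for v using that(2) by (simp add: L.good_def)
  qed (rule uniq)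
  show "\<exists>\<mu> :: (nat \<times> nat) set pmf.
          (\<forall>R \<in> set_pmf \<mu>. rectangle (verts G) (verts G) R \<and> monochromatic (gadget G c) b R) \<and>
          hitting (1 / 10) (\<lfloor>2 * log 2 (1 / \<gamma>)\<rfloor> - 100) (verts G) (verts G) \<mu> \<and>
          (\<forall>R. pmf \<mu> R \<in> \<rat>) \<and>
          (\<exists>ys. computes_in 6 (compile (Lister b) 0) (encode_input m G c) (m ^ 300) ys \<and> lists_distribution m \<mu> ys)"
  proof (intro exI[of _ D.mu] conjI ballI allI)
    fix Q assume Q: "Q \<in> set_pmf D.mu"
    have "rectangle (verts G) (verts G) Q \<and> monochromatic (gadget G c) b Q"
      using Q
    proof (cases rule: D.mu_cases)
      case 1
      then show ?thesis by (auto simp: rectangle_def monochromatic_def)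
    next
      case (2 v a)
      have "gadget G c (x, y) = Some b" if "x \<in> D.lside v a" "y \<in> D.rside v a" for x y
      proof -
        have xy: "x < m" "y < m" "x \<noteq> y" "R v x" "R v y"
          using that by (auto simp: D.lside_def D.rside_def side_def)
        have cv: "c v = b" using 2(2) by (simp add: L.good_def Rm)
        have vn: "w \<in> nbrs G {x} \<inter> nbrs G {y} \<longleftrightarrow> w = v" for w
        proof
          assume "w \<in> nbrs G {x} \<inter> nbrs G {y}"
          then have "w < m" "R w x" "R w y" using V by (auto simp: nbrs_def RE comm[of x] comm[of y])
          then show "w = v" using uniq[of w v x y] xy 2(1) by blast
        next
          assume "w = v"
          then show "w \<in> nbrs G {x} \<inter> nbrs G {y}"
            using xy 2(1) V by (auto simp: nbrs_def RE comm[of x] comm[of y])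
        qed
        then have "nbrs G {x} \<inter> nbrs G {y} = {v}" by blast
        then show ?thesis using xy(3) cv by (simp add: gadget_def)
      qed
      then have "monochromatic (gadget G c) b Q"
        unfolding 2(4) D.rect_def monochromatic_def by auto
      moreover have "rectangle (verts G) (verts G) Q"
        unfolding 2(4) D.rect_def rectangle_def V
        by (intro exI[of _ "D.lside v a"] exI[of _ "D.rside v a"]) (auto simp: D.lside_def D.rside_def)
      ultimately show ?thesis by blast
    qed
    then show "rectangle (verts G) (verts G) Q" "monochromatic (gadget G c) b Q" by auto
  next
    show "hitting (1 / 10) (\<lfloor>2 * log 2 (1 / \<gamma>)\<rfloor> - 100) (verts G) (verts G) D.mu"
      unfolding hitting_def V
    proof (intro conjI allI impI; (elim conjE)?)
      fix X Y :: "nat set"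
      let ?t = "2 powr (- real_of_int (\<lfloor>2 * log 2 (1 / \<gamma>)\<rfloor> - 100))"
      assume XY: "X \<subseteq> {..<m}" "Y \<subseteq> {..<m}"
        and tX: "?t * real (card {..<m}) \<le> real (card X)" and tY: "?t * real (card {..<m}) \<le> real (card Y)"
      have big: "2 ^ 100 * \<gamma>\<^sup>2 * real m \<le> real (card Z)" if "?t * real (card {..<m}) \<le> real (card Z)" for Z :: "nat set"
        using mult_right_mono[OF hitting_threshold[OF \<gamma>], of "real m"] that by simp
      let ?low = "\<lambda>Z. {v. v < m \<and> card (nbrs G {v} \<inter> Z) < 64}"
      let ?G = "{v. v < m \<and> L.good b v}"
      let ?G1 = "{v. v < m \<and> L.good b v \<and> 64 \<le> card {u \<in> X. R v u} \<and> 64 \<le> card {u \<in> Y. R v u}}"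
      let ?C = "{v. v < m \<and> c v = b}"
      have nb: "{u \<in> Z. R v u} = nbrs G {v} \<inter> Z" if "Z \<subseteq> {..<m}" "v < m" for Z v
        using nbr[OF that(2)] that(1) by auto
      have low: "real (card (?low X \<union> ?low Y)) \<le> real m / 2000"
      proof -
        have "real (card (?low X \<union> ?low Y)) \<le> real (card (?low X)) + real (card (?low Y))"
          using card_Un_le[of "?low X" "?low Y"] by linarith
        then show ?thesis
          using card_few_neighbours_le[OF ex \<gamma> mg XY(1) big[OF tX]]
            card_few_neighbours_le[OF ex \<gamma> mg XY(2) big[OF tY]] by simp
      qed
      have "?C \<subseteq> ?G1 \<union> (?low X \<union> ?low Y)"
      proof
        fix v assume v: "v \<in> ?C"
        show "v \<in> ?G1 \<union> (?low X \<union> ?low Y)"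
        proof (cases "v \<in> ?low X \<union> ?low Y")
          case False
          then have c: "64 \<le> card {u \<in> X. R v u}" "64 \<le> card {u \<in> Y. R v u}"
            using v nb XY by auto
          have "card {u \<in> X. R v u} \<le> rk (R v) m"
            unfolding rk_def using XY by (intro card_mono) auto
          then show ?thesis using v c by (auto simp: L.good_def Rm)
        qed simp
      qed
      then have "card ?C \<le> card (?G1 \<union> (?low X \<union> ?low Y))" by (intro card_mono) auto
      then have "card ?C \<le> card ?G1 + card (?low X \<union> ?low Y)"
        using card_Un_le[of ?G1 "?low X \<union> ?low Y"] by linarith
      then have 1: "real m / 3 \<le> real (card ?G1) + real m / 2000"
        using color_class_large[OF bal V, of b] low by linarith
      have "?G \<subseteq> ?G1 \<union> (?low X \<union> ?low Y)" using nb XY by auto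
      then have "card ?G \<le> card (?G1 \<union> (?low X \<union> ?low Y))" by (intro card_mono) auto
      then have "card ?G \<le> card ?G1 + card (?low X \<union> ?low Y)"
        using card_Un_le[of ?G1 "?low X \<union> ?low Y"] by linarith
      then have 2: "real (rk (L.good b) m) \<le> real (card ?G1) + real m / 2000"
        using low unfolding rk_def by linarith
      \<comment> \<open>The mere existence of such an \<open>X\<close> forces \<open>m\<close> to be
        at least \<open>2 ^ 100\<close>; for smaller graphs the hitting condition is void.\<close>
      have "1 \<le> \<gamma>\<^sup>2 * real m" using mg \<gamma> by (simp add: field_simps)
      then have "2 ^ 100 \<le> real (card X)" using big[OF tX] by simp
      moreover have "card X \<le> m" using card_mono[OF _ XY(1)] by simp
      then have "real (card X) \<le> real m" by simp
      ultimately have 3: "2000 \<le> real m" by simp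
      \<comment> \<open>Together, the empty rectangle and the vertices in use outside
        \<open>?G1\<close> count as at most m / 1000 vertices, less than 1/300 of
        \<open>card ?G1\<close>, which is far inside the gap between 9/10 and 31/32.\<close>
      have "9 / 10 * real (Suc (rk (L.good b) m)) \<le> 31 / 32 * real (card ?G1)"
        using 1 2 3 by simp
      then have "1 - 1 / 10 \<le> 31 / 32 * real (card ?G1) / real (Suc (rk (L.good b) m))"
        by (simp add: field_simps)
      also have "\<dots> \<le> measure_pmf.prob D.mu {R. R \<inter> (X \<times> Y) \<noteq> {}}"
        by (rule D.prob_hit[OF XY])
      finally show "1 - 1 / 10 \<le> measure_pmf.prob D.mu {R. R \<inter> (X \<times> Y) \<noteq> {}}" .
    qed simp
  next
    show "pmf D.mu Q \<in> \<rat>" for Q by (rule D.pmf_mu_Rats)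
  next
    \<comment> \<open>The exponent is 300 = 5 * 60: the clock is \<open>m ^ 5\<close>, and the
      program runs within its 60th power.\<close>
    have "computes_in 6 (compile (Lister b) 0) (encode_input m G c) (m ^ 300) (L.listing_out b)"
      using L.computes_Lister[of b] by (simp flip: power_mult)
    then show "\<exists>ys. computes_in 6 (compile (Lister b) 0) (encode_input m G c) (m ^ 300) ys \<and> lists_distribution m D.mu ys"
      using D.lists_mu L.listing_out_eq by metis
  qed
qed

end
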